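(* Let $T$ be a dp-minimal theory with property (D). Let $M \models T$ (a small elementary submodel of the monster model $\mathcal U$), let $x$ be a finite tuple of variables, and let $\phi(x;d)$, with $d$ a finite tuple from $\mathcal U$, be a formula over $\mathcal U$ which does not fork over $M$. Then there is a complete type $p(x)$ over $\mathcal U$ which contains $\phi(x;d)$ and is $M$-definable.
   Context: $T$ is a complete countable first-order theory in a language $L$, and $\mathcal U$ is a monster model of $T$. All small models are elementary submodels of $\mathcal U$. For a set $A$, $L(A)$ denotes the formulas with parameters from $A$. A global type is a complete type over $\mathcal U$. For sets of parameters $A \subseteq B$, a complete type $p \in S_x(B)$ is $A$-definable (definable over $A$) if for every formula $\phi(x;y)\in L$ there is a formula $d\phi(y)\in L(A)$ such that for every tuple $e$ from $B$ of length $|y|$, $\phi(x;e)\in p$ if and only if $\mathcal U\models d\phi(e)$. $T$ is dp-minimal if for every small $A\subset \mathcal U$, every singleton $a\in\mathcal U$ and any two infinite sequences $I_0,I_1$ of tuples such that $I_0$ is indiscernible over $A I_1$ and $I_1$ is indiscernible over $A I_0$, there is $k\in\{0,1\}$ such that $I_k$ is indiscernible over $Aa$. $T$ has property (D) if for every small set $A$ of real elements (elements of $\mathcal U$, not imaginaries) and every consistent formula $\phi(x)\in L(A)$ with $x$ a single variable, there is an $A$-definable complete type $p\in S_x(A)$ containing $\phi(x)$. (The type $p$ is not required to extend to a global $A$-definable type.) Forking is understood in the usual sense in $\mathcal U$: a formula forks over $M$ if it implies a finite disjunction of formulas each of which divides over $M$. *)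

theory Defs
  imports "HOL-Library.Countable_Set"
begin

unbundle cardinal_syntax

text \<open>A one-sorted language: function symbols (constants being the nullary ones) and relation
  symbols, with their arities. Equality is a logical symbol.\<close>

record ('f, 'r) lang =
  funs :: "'f set"
  fun_arity :: "'f \<Rightarrow> nat"
  rels :: "'r set"
  rel_arity :: "'r \<Rightarrow> nat"

definition countable_lang :: "('f, 'r) lang \<Rightarrow> bool" where
  "countable_lang L \<longleftrightarrow> countable (funs L) \<and> countable (rels L)"

text \<open>Variables are de Bruijn indices. Under \<open>Ex\<close>, index 0 is the bound variable and the
  free variable \<open>i\<close> becomes \<open>Suc i\<close>.\<close>

datatype 'f trm = Var nat | Fn 'f "'f trm list"

datatype ('f, 'r) fm =
    Rel 'r "'f trm list"
  | Eq "'f trm" "'f trm"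
  | Neg "('f, 'r) fm"
  | And "('f, 'r) fm" "('f, 'r) fm"
  | Ex "('f, 'r) fm"

fun trm_in :: "('f, 'r) lang \<Rightarrow> nat \<Rightarrow> 'f trm \<Rightarrow> bool" where
  "trm_in L k (Var i) \<longleftrightarrow> i < k"
| "trm_in L k (Fn f ts) \<longleftrightarrow>
     f \<in> funs L \<and> length ts = fun_arity L f \<and> (\<forall>t\<in>set ts. trm_in L k t)"

text \<open>\<open>fm_in L k \<phi>\<close>: \<open>\<phi>\<close> is an \<open>L\<close>-formula whose free variables are among the first \<open>k\<close>.\<close>

fun fm_in :: "('f, 'r) lang \<Rightarrow> nat \<Rightarrow> ('f, 'r) fm \<Rightarrow> bool" where
  "fm_in L k (Rel r ts) \<longleftrightarrow>
     r \<in> rels L \<and> length ts = rel_arity L r \<and> (\<forall>t\<in>set ts. trm_in L k t)"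
| "fm_in L k (Eq s t) \<longleftrightarrow> trm_in L k s \<and> trm_in L k t"
| "fm_in L k (Neg \<phi>) \<longleftrightarrow> fm_in L k \<phi>"
| "fm_in L k (And \<phi> \<psi>) \<longleftrightarrow> fm_in L k \<phi> \<and> fm_in L k \<psi>"
| "fm_in L k (Ex \<phi>) \<longleftrightarrow> fm_in L (Suc k) \<phi>"

record ('f, 'r, 'u) interp =
  funI :: "'f \<Rightarrow> 'u list \<Rightarrow> 'u"
  relI :: "'r \<Rightarrow> 'u list \<Rightarrow> bool"

fun val :: "('f, 'r, 'u) interp \<Rightarrow> 'u list \<Rightarrow> 'f trm \<Rightarrow> 'u" where
  "val U xs (Var i) = xs ! i"
| "val U xs (Fn f ts) = funI U f (map (val U xs) ts)"

text \<open>Satisfaction in the structure with universe \<open>D\<close>, the variable \<open>i\<close> being assigned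
  \<open>xs ! i\<close>. The universe is a parameter because elementary submodels are given
  by subsets.\<close>

fun sat_in :: "('f, 'r, 'u) interp \<Rightarrow> 'u set \<Rightarrow> 'u list \<Rightarrow> ('f, 'r) fm \<Rightarrow> bool" where
  "sat_in U D xs (Rel r ts) \<longleftrightarrow> relI U r (map (val U xs) ts)"
| "sat_in U D xs (Eq s t) \<longleftrightarrow> val U xs s = val U xs t"
| "sat_in U D xs (Neg \<phi>) \<longleftrightarrow> \<not> sat_in U D xs \<phi>"
| "sat_in U D xs (And \<phi> \<psi>) \<longleftrightarrow> sat_in U D xs \<phi> \<and> sat_in U D xs \<psi>"
| "sat_in U D xs (Ex \<phi>) \<longleftrightarrow> (\<exists>a\<in>D. sat_in U D (a # xs) \<phi>)"

text \<open>The universe of the monster model is the whole type \<open>'u\<close>.\<close>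

abbreviation sat :: "('f, 'r, 'u) interp \<Rightarrow> 'u list \<Rightarrow> ('f, 'r) fm \<Rightarrow> bool" where
  "sat U \<equiv> sat_in U UNIV"

text \<open>A complete theory is identified with its deductive closure: it contains exactly one of
  \<open>\<sigma>\<close>, \<open>Neg \<sigma>\<close> for each sentence \<open>\<sigma>\<close>. Satisfiability is witnessed by the monster model.\<close>

definition complete_theory :: "('f, 'r) lang \<Rightarrow> ('f, 'r) fm set \<Rightarrow> bool" where
  "complete_theory L T \<longleftrightarrow>
     T \<subseteq> {\<sigma>. fm_in L 0 \<sigma>} \<and> (\<forall>\<sigma>. fm_in L 0 \<sigma> \<longrightarrow> (\<sigma> \<in> T \<longleftrightarrow> Neg \<sigma> \<notin> T))"

definition elementary_submodel :: "('f, 'r) lang \<Rightarrow> ('f, 'r, 'u) interp \<Rightarrow> 'u set \<Rightarrow> bool" where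
  "elementary_submodel L U M \<longleftrightarrow>
     M \<noteq> {} \<and>
     (\<forall>f\<in>funs L. \<forall>xs\<in>lists M. length xs = fun_arity L f \<longrightarrow> funI U f xs \<in> M) \<and>
     (\<forall>\<phi>. \<forall>xs\<in>lists M. fm_in L (length xs) \<phi> \<longrightarrow> (sat_in U M xs \<phi> \<longleftrightarrow> sat U xs \<phi>))"

text \<open>A formula with parameters \<open>\<phi>(x;b)\<close>, where \<open>|x| = n\<close>, is a pair \<open>(\<phi>, b)\<close> with
  \<open>fm_in L (n + length b) \<phi>\<close>; its instance at \<open>a\<close> is \<open>sat U (a @ b) \<phi>\<close>.\<close>

definition param_fms ::
  "('f, 'r) lang \<Rightarrow> nat \<Rightarrow> 'u set \<Rightarrow> (('f, 'r) fm \<times> 'u list) set" where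
  "param_fms L n B = {(\<phi>, b). b \<in> lists B \<and> fm_in L (n + length b) \<phi>}"

definition complete_type ::
  "('f, 'r) lang \<Rightarrow> ('f, 'r, 'u) interp \<Rightarrow> nat \<Rightarrow> 'u set \<Rightarrow> (('f, 'r) fm \<times> 'u list) set \<Rightarrow> bool" where
  "complete_type L U n B p \<longleftrightarrow>
     p \<subseteq> param_fms L n B \<and>
     (\<forall>q\<subseteq>p. finite q \<longrightarrow> (\<exists>a. length a = n \<and> (\<forall>(\<phi>, b)\<in>q. sat U (a @ b) \<phi>))) \<and>
     (\<forall>(\<phi>, b)\<in>param_fms L n B. (\<phi>, b) \<in> p \<or> (Neg \<phi>, b) \<in> p)"

definition definable_type ::
  "('f, 'r) lang \<Rightarrow> ('f, 'r, 'u) interp \<Rightarrow> 'u set \<Rightarrow> nat \<Rightarrow> 'u set \<Rightarrow>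
   (('f, 'r) fm \<times> 'u list) set \<Rightarrow> bool" where
  "definable_type L U A n B p \<longleftrightarrow>
     (\<forall>m \<phi>. fm_in L (n + m) \<phi> \<longrightarrow>
       (\<exists>(\<psi>, a)\<in>param_fms L m A. \<forall>e\<in>lists B. length e = m \<longrightarrow>
          ((\<phi>, e) \<in> p \<longleftrightarrow> sat U (e @ a) \<psi>)))"

definition same_type ::
  "('f, 'r) lang \<Rightarrow> ('f, 'r, 'u) interp \<Rightarrow> 'u set \<Rightarrow> 'u list \<Rightarrow> 'u list \<Rightarrow> bool" where
  "same_type L U A xs ys \<longleftrightarrow>
     length xs = length ys \<and>
     (\<forall>(\<phi>, b)\<in>param_fms L (length xs) A. sat U (xs @ b) \<phi> \<longleftrightarrow> sat U (ys @ b) \<phi>)"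

definition small :: "'k rel \<Rightarrow> 'u set \<Rightarrow> bool" where
  "small \<kappa> A \<longleftrightarrow> |A| <o \<kappa>"

definition saturated :: "('f, 'r) lang \<Rightarrow> 'k rel \<Rightarrow> ('f, 'r, 'u) interp \<Rightarrow> bool" where
  "saturated L \<kappa> U \<longleftrightarrow>
     (\<forall>A p. small \<kappa> A \<and> complete_type L U 1 A p \<longrightarrow>
        (\<exists>a. \<forall>(\<phi>, b)\<in>p. sat U (a # b) \<phi>))"

definition automorphism :: "('f, 'r) lang \<Rightarrow> ('f, 'r, 'u) interp \<Rightarrow> ('u \<Rightarrow> 'u) \<Rightarrow> bool" where
  "automorphism L U \<sigma> \<longleftrightarrow>
     bij \<sigma> \<and>
     (\<forall>f\<in>funs L. \<forall>xs. length xs = fun_arity L f \<longrightarrow>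
        \<sigma> (funI U f xs) = funI U f (map \<sigma> xs)) \<and>
     (\<forall>r\<in>rels L. \<forall>xs. length xs = rel_arity L r \<longrightarrow>
        (relI U r xs \<longleftrightarrow> relI U r (map \<sigma> xs)))"

definition strongly_homogeneous ::
  "('f, 'r) lang \<Rightarrow> 'k rel \<Rightarrow> ('f, 'r, 'u) interp \<Rightarrow> bool" where
  "strongly_homogeneous L \<kappa> U \<longleftrightarrow>
     (\<forall>A g. small \<kappa> A \<and> (\<forall>xs\<in>lists A. same_type L U {} xs (map g xs)) \<longrightarrow>
        (\<exists>\<sigma>. automorphism L U \<sigma> \<and> (\<forall>a\<in>A. \<sigma> a = g a)))"

text \<open>\<open>\<kappa>\<close>-saturated and strongly \<open>\<kappa>\<close>-homogeneous. The languages considered are countable, and of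
  \<open>\<kappa>\<close> only uncountability is required, so every usual choice of a large \<open>\<kappa>\<close>
  (strong limit, inaccessible) is covered.\<close>

definition monster_model ::
  "('f, 'r) lang \<Rightarrow> ('f, 'r) fm set \<Rightarrow> 'k rel \<Rightarrow> ('f, 'r, 'u) interp \<Rightarrow> bool" where
  "monster_model L T \<kappa> U \<longleftrightarrow>
     (\<forall>\<sigma>\<in>T. sat U [] \<sigma>) \<and> Card_order \<kappa> \<and> natLeq <o \<kappa> \<and>
     saturated L \<kappa> U \<and> strongly_homogeneous L \<kappa> U"

definition seq_elems :: "(nat \<Rightarrow> 'u list) \<Rightarrow> 'u set" where
  "seq_elems I = (\<Union>i. set (I i))"

definition indiscernible ::
  "('f, 'r) lang \<Rightarrow> ('f, 'r, 'u) interp \<Rightarrow> 'u set \<Rightarrow> (nat \<Rightarrow> 'u list) \<Rightarrow> bool" where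
  "indiscernible L U A I \<longleftrightarrow>
     (\<exists>n. \<forall>i. length (I i) = n) \<and>
     (\<forall>is js. sorted_wrt (<) is \<and> sorted_wrt (<) js \<and> length is = length js \<longrightarrow>
        same_type L U A (concat (map I is)) (concat (map I js)))"

definition dp_minimal :: "('f, 'r) lang \<Rightarrow> 'k rel \<Rightarrow> ('f, 'r, 'u) interp \<Rightarrow> bool" where
  "dp_minimal L \<kappa> U \<longleftrightarrow>
     (\<forall>A a I\<^sub>0 I\<^sub>1. small \<kappa> A \<and>
        indiscernible L U (A \<union> seq_elems I\<^sub>1) I\<^sub>0 \<and>
        indiscernible L U (A \<union> seq_elems I\<^sub>0) I\<^sub>1 \<longrightarrow>
        indiscernible L U (insert a A) I\<^sub>0 \<or> indiscernible L U (insert a A) I\<^sub>1)"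

definition property_D :: "('f, 'r) lang \<Rightarrow> 'k rel \<Rightarrow> ('f, 'r, 'u) interp \<Rightarrow> bool" where
  "property_D L \<kappa> U \<longleftrightarrow>
     (\<forall>A. small \<kappa> A \<longrightarrow>
       (\<forall>(\<phi>, b)\<in>param_fms L 1 A. (\<exists>a. sat U (a # b) \<phi>) \<longrightarrow>
          (\<exists>p. complete_type L U 1 A p \<and> (\<phi>, b) \<in> p \<and> definable_type L U A 1 A p)))"

text \<open>\<open>\<phi>(x;b)\<close> divides over \<open>A\<close>: for some \<open>k\<close> there are \<open>(b\<^sub>i)\<close>, \<open>i < \<omega>\<close>, with the type of \<open>b\<close>
  over \<open>A\<close>, such that the family of formulas \<open>\<phi>(x;b\<^sub>i)\<close> is \<open>k\<close>-inconsistent.\<close>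

definition divides ::
  "('f, 'r) lang \<Rightarrow> ('f, 'r, 'u) interp \<Rightarrow> 'u set \<Rightarrow> nat \<Rightarrow> ('f, 'r) fm \<times> 'u list \<Rightarrow> bool" where
  "divides L U A n = (\<lambda>(\<phi>, b).
     \<exists>(c :: nat \<Rightarrow> 'u list) k. (\<forall>i. same_type L U A b (c i)) \<and>
       (\<forall>S. finite S \<and> card S = k \<longrightarrow>
          \<not> (\<exists>a. length a = n \<and> (\<forall>i\<in>S. sat U (a @ c i) \<phi>))))"

definition forks ::
  "('f, 'r) lang \<Rightarrow> ('f, 'r, 'u) interp \<Rightarrow> 'u set \<Rightarrow> nat \<Rightarrow> ('f, 'r) fm \<times> 'u list \<Rightarrow> bool" where
  "forks L U A n = (\<lambda>(\<phi>, b).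
     \<exists>\<Delta>. finite \<Delta> \<and> \<Delta> \<subseteq> param_fms L n UNIV \<and> (\<forall>\<delta>\<in>\<Delta>. divides L U A n \<delta>) \<and>
       (\<forall>a. length a = n \<and> sat U (a @ b) \<phi> \<longrightarrow> (\<exists>(\<psi>, c)\<in>\<Delta>. sat U (a @ c) \<psi>)))"

end

theory Submission
  imports Defs "HOL-Library.Ramsey"
begin

text \<open>If \<open>\<phi>(x;d)\<close> does not fork over \<open>M\<close> then, by NIP, any finitely many conjugates \<open>\<phi>(x;e)\<close> with
  \<open>e \<equiv>\<^sub>M d\<close> are jointly consistent. From this a tuple \<open>a\<close> satisfying \<open>\<phi>(x;d)\<close> whose type over \<open>M d\<close> is definable over
  \<open>M\<close> is found by induction on the length of \<open>x\<close>. Write \<open>x = u y\<close>. Choose \<open>d\<^sub>1 \<equiv>\<^sub>M d\<close> such that for every coheir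
  \<open>V\<close> of the type of \<open>d\<close> the pair \<open>(d, d\<^sub>1)\<close> starts two mutually indiscernible Morley sequences of \<open>V\<close>, and
  apply induction to \<open>\<exists>u. \<phi>(u,y;d) \<and> \<phi>(u,y;d\<^sub>1)\<close>, which gives \<open>a\<close> and a witness \<open>u\<^sub>0\<close>. Either the type of \<open>u\<^sub>0 a\<close> is
  already as required, or some formula over \<open>M u\<^sub>0 a\<close> changes its truth value along
  one of two mutually indiscernible sequences; dp-minimality then forces an implication between instances of formulas along them,
  which holds for every \<open>u\<close>. All the parameters but \<open>d\<close> are then moved into \<open>M\<close> by finite satisfiability, and property (D)
  chooses \<open>u\<close> definably.\<close>

section \<open>Definable sets\<close>

text \<open>Joint consistency of the conjugates replaces non-forking because it survives the
  induction: a conjugate of \<open>(d, d\<^sub>1)\<close> consists of two conjugates of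
  \<open>d\<close>. The second copy is there because dp-minimality keeps one of two sequences
  indiscernible over \<open>u\<close> without saying which; asking for both instances puts a true
  instance at the head of either row. The coheir \<open>V\<close> along which a truth value has to
  change is known only after \<open>a\<close> and \<open>u\<^sub>0\<close>, so
  \<open>d\<^sub>1\<close> has to serve all coheirs at once. Property (D) yields a type over
  \<open>M a\<close> only, with no promise about larger sets, so the \<open>u\<close> that it
  chooses is controlled on \<open>M\<close> alone. This is why an implication valid for every
  \<open>u\<close> is needed: it also holds for the \<open>u\<close> picked by property (D), it can
  be tested at points of \<open>M\<close>, and elementarity then carries the result to
  \<open>d\<close>.\<close>

fun trm_ren :: "(nat \<Rightarrow> nat) \<Rightarrow> 'f trm \<Rightarrow> 'f trm" where
  "trm_ren \<rho> (Var i) = Var (\<rho> i)"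
| "trm_ren \<rho> (Fn f ts) = Fn f (map (trm_ren \<rho>) ts)"

fun fm_ren :: "(nat \<Rightarrow> nat) \<Rightarrow> ('f, 'r) fm \<Rightarrow> ('f, 'r) fm" where
  "fm_ren \<rho> (Rel r ts) = Rel r (map (trm_ren \<rho>) ts)"
| "fm_ren \<rho> (Eq s t) = Eq (trm_ren \<rho> s) (trm_ren \<rho> t)"
| "fm_ren \<rho> (Neg \<phi>) = Neg (fm_ren \<rho> \<phi>)"
| "fm_ren \<rho> (And \<phi> \<psi>) = And (fm_ren \<rho> \<phi>) (fm_ren \<rho> \<psi>)"
| "fm_ren \<rho> (Ex \<phi>) = Ex (fm_ren (case_nat 0 (\<lambda>i. Suc (\<rho> i))) \<phi>)"

lemma val_trm_ren:
  "trm_in L k t \<Longrightarrow> \<forall>i<k. xs ! \<rho> i = ys ! i \<Longrightarrow> val U xs (trm_ren \<rho> t) = val U ys t"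
proof (induction t)
  case (Fn f ts)
  then have "map (val U xs \<circ> trm_ren \<rho>) ts = map (val U ys) ts"
    by (intro map_cong) (auto simp: in_set_conv_nth)
  then show ?case by (simp del: map_eq_conv)
qed simp

lemma trm_in_ren: "trm_in L k t \<Longrightarrow> \<forall>i<k. \<rho> i < l \<Longrightarrow> trm_in L l (trm_ren \<rho> t)"
  by (induction t) auto

lemma sat_fm_ren:
  "fm_in L k \<phi> \<Longrightarrow> \<forall>i<k. xs ! \<rho> i = ys ! i \<Longrightarrow> sat_in U D xs (fm_ren \<rho> \<phi>) = sat_in U D ys \<phi>"
proof (induction \<phi> arbitrary: k \<rho> xs ys)
  case (Rel r ts)
  then have "map (val U xs \<circ> trm_ren \<rho>) ts = map (val U ys) ts"
    by (intro map_cong) (auto intro: val_trm_ren)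
  then show ?case by (simp del: map_eq_conv)
next
  case (Eq s t)
  then show ?case using val_trm_ren[of L k _ xs \<rho> ys U] by simp
next
  case (Ex \<phi>)
  have "sat_in U D (a # xs) (fm_ren (case_nat 0 (\<lambda>i. Suc (\<rho> i))) \<phi>) = sat_in U D (a # ys) \<phi>" for a
    using Ex.prems by (intro Ex.IH[of "Suc k"]) (auto split: nat.split)
  then show ?case by simp
next
  case (And \<phi> \<psi>)
  then show ?case using And.IH[of k xs \<rho> ys] by simp
qed simp

lemma fm_in_ren: "fm_in L k \<phi> \<Longrightarrow> \<forall>i<k. \<rho> i < l \<Longrightarrow> fm_in L l (fm_ren \<rho> \<phi>)"
proof (induction \<phi> arbitrary: k l \<rho>)
  case (Ex \<phi>)
  show ?case using Ex.prems by (auto intro!: Ex.IH[of "Suc k"] split: nat.split)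
qed (auto intro: trm_in_ren)

section \<open>Predicates definable with parameters and their closure properties\<close>

locale struct =
  fixes L :: "('f, 'r) lang" and U :: "('f, 'r, 'u) interp"
begin

text \<open>Formulas are represented by the predicates on tuples that they define.\<close>

definition dfn :: "'u set \<Rightarrow> nat \<Rightarrow> ('u list \<Rightarrow> bool) \<Rightarrow> bool" where
  "dfn A n R \<longleftrightarrow> (\<exists>\<psi> b. b \<in> lists A \<and> fm_in L (n + length b) \<psi> \<and>
     (\<forall>a. length a = n \<longrightarrow> (R a \<longleftrightarrow> sat U (a @ b) \<psi>)))"

text \<open>The tuple \<open>F a\<close> consists of entries of \<open>a\<close> and of fixed elements of \<open>A\<close>.\<close>

definition slc :: "'u set \<Rightarrow> nat \<Rightarrow> nat \<Rightarrow> ('u list \<Rightarrow> 'u list) \<Rightarrow> bool" where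
  "slc A k n F \<longleftrightarrow> (\<exists>c \<rho>. c \<in> lists A \<and> (\<forall>i<n. \<rho> i < k + length c) \<and>
     (\<forall>a. length a = k \<longrightarrow> length (F a) = n \<and> (\<forall>i<n. F a ! i = (a @ c) ! \<rho> i)))"

lemma dfnI:
  "b \<in> lists A \<Longrightarrow> fm_in L (n + length b) \<psi> \<Longrightarrow>
    (\<And>a. length a = n \<Longrightarrow> R a \<longleftrightarrow> sat U (a @ b) \<psi>) \<Longrightarrow> dfn A n R"
  unfolding dfn_def by blast

lemma dfn_mono: "dfn A n R \<Longrightarrow> A \<subseteq> B \<Longrightarrow> dfn B n R"
  unfolding dfn_def using lists_mono by blast

lemma dfn_slc:
  assumes "dfn A n R" "slc A k n F"
  shows "dfn A k (\<lambda>a. R (F a))"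
proof -
  obtain \<psi> b where b: "b \<in> lists A" "fm_in L (n + length b) \<psi>"
    "\<And>a. length a = n \<Longrightarrow> R a \<longleftrightarrow> sat U (a @ b) \<psi>"
    using assms(1) unfolding dfn_def by blast
  obtain c \<rho> where c: "c \<in> lists A" "\<And>i. i < n \<Longrightarrow> \<rho> i < k + length c"
    "\<And>a. length a = k \<Longrightarrow> length (F a) = n"
    "\<And>a i. length a = k \<Longrightarrow> i < n \<Longrightarrow> F a ! i = (a @ c) ! \<rho> i"
    using assms(2) unfolding slc_def by blast
  \<comment> \<open>The places from \<open>n\<close> on belong to the parameters \<open>b\<close>;
    in the new tuple \<open>a @ c @ b\<close> they come after \<open>a\<close> and
    \<open>c\<close>.\<close>
  define \<rho>' where "\<rho>' i = (if i < n then \<rho> i else k + length c + (i - n))" for i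
  have 1: "\<forall>i<n + length b. \<rho>' i < k + length (c @ b)"
  proof (intro allI impI)
    fix i assume "i < n + length b"
    then show "\<rho>' i < k + length (c @ b)" using c(2)[of i] by (cases "i < n") (auto simp: \<rho>'_def)
  qed
  show ?thesis
  proof (rule dfnI)
    show "c @ b \<in> lists A" using b(1) c(1) by simp
    show "fm_in L (k + length (c @ b)) (fm_ren \<rho>' \<psi>)"
      using fm_in_ren[OF b(2)] 1 by blast
    fix a :: "'u list" assume a: "length a = k"
    have "(a @ c @ b) ! \<rho>' i = (F a @ b) ! i" if "i < n + length b" for i
    proof (cases "i < n")
      case True
      then have "(a @ c @ b) ! \<rho>' i = (a @ c) ! \<rho> i"
        using c(2)[OF True] a by (simp add: \<rho>'_def nth_append flip: append_assoc)
      then show ?thesis using True c(3,4)[OF a] by (simp add: nth_append)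
    next
      case False
      then have "(a @ c @ b) ! \<rho>' i = b ! (i - n)"
        using False a nth_append_length_plus[of "a @ c" b "i - n"] by (simp add: \<rho>'_def)
      then show ?thesis using False c(3)[OF a] by (simp add: nth_append)
    qed
    then have "sat U (a @ c @ b) (fm_ren \<rho>' \<psi>) = sat U (F a @ b) \<psi>"
      by (intro sat_fm_ren[OF b(2)]) auto
    then show "R (F a) \<longleftrightarrow> sat U (a @ c @ b) (fm_ren \<rho>' \<psi>)" using b(3)[OF c(3)[OF a]] by simp
  qed
qed

lemma slc_const: "set c \<subseteq> A \<Longrightarrow> slc A k (length c) (\<lambda>_. c)"
  unfolding slc_def
  by (intro exI[of _ c] exI[of _ "\<lambda>i. k + i"]) (auto simp: nth_append)

lemma slc_seg: "i + j \<le> k \<Longrightarrow> slc A k j (\<lambda>a. take j (drop i a))"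
  unfolding slc_def
  by (intro exI[of _ "[]"] exI[of _ "\<lambda>r. i + r"]) auto

lemma slc_take: "j \<le> k \<Longrightarrow> slc A k j (take j)"
  using slc_seg[of 0 j k] by simp

lemma slc_drop: "k = i + j \<Longrightarrow> slc A k j (drop i)"
  unfolding slc_def
  by (intro exI[of _ "[]"] exI[of _ "\<lambda>r. i + r"]) auto

lemma dfn_slc_eq: "dfn A m R \<Longrightarrow> slc A k n F \<Longrightarrow> n = m \<Longrightarrow> dfn A k (\<lambda>a. R (F a))"
  using dfn_slc by blast

lemma slc_drop_le: "i \<le> k \<Longrightarrow> slc A k (k - i) (drop i)"
  by (rule slc_drop) simp

lemma slc_id: "slc A k k (\<lambda>a. a)"
  unfolding slc_def
  by (intro exI[of _ "[]"] exI[of _ "\<lambda>r. r"]) auto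

lemma slc_append:
  assumes "slc A k n F" "slc A k m G"
  shows "slc A k (n + m) (\<lambda>a. F a @ G a)"
proof -
  obtain c \<rho> where c: "c \<in> lists A" "\<And>i. i < n \<Longrightarrow> \<rho> i < k + length c"
    "\<And>a. length a = k \<Longrightarrow> length (F a) = n"
    "\<And>a i. length a = k \<Longrightarrow> i < n \<Longrightarrow> F a ! i = (a @ c) ! \<rho> i"
    using assms(1) unfolding slc_def by blast
  obtain c' \<rho>' where c': "c' \<in> lists A" "\<And>i. i < m \<Longrightarrow> \<rho>' i < k + length c'"
    "\<And>a. length a = k \<Longrightarrow> length (G a) = m"
    "\<And>a i. length a = k \<Longrightarrow> i < m \<Longrightarrow> G a ! i = (a @ c') ! \<rho>' i"
    using assms(2) unfolding slc_def by blast
  \<comment> \<open>In the joint list of constants \<open>c @ c'\<close> the constants of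
    \<open>G\<close> are displaced by \<open>length c\<close>, while entries of the argument keep
    their places.\<close>
  let ?r = "\<lambda>i. if i < n then \<rho> i else if \<rho>' (i - n) < k then \<rho>' (i - n) else \<rho>' (i - n) + length c"
  show ?thesis unfolding slc_def
  proof (intro exI[of _ "c @ c'"] exI[of _ ?r] conjI allI impI)
    show "c @ c' \<in> lists A" using c(1) c'(1) by simp
  next
    fix i assume "i < n + m"
    then show "?r i < k + length (c @ c')"
      using c(2)[of i] c'(2)[of "i - n"] by auto
  next
    fix a :: "'u list" assume a: "length a = k"
    then show "length (F a @ G a) = n + m" using c(3) c'(3) by simp
    fix i assume i: "i < n + m"
    show "(F a @ G a) ! i = (a @ c @ c') ! ?r i"
    proof (cases "i < n")
      case True
      then show ?thesis using c(2)[OF True] c(3,4)[OF a] a by (simp add: nth_append) linarith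
    next
      case False
      then have "i - n < m" using i by simp
      then show ?thesis using False c'(2)[of "i - n"] c'(3,4)[OF a] c(3)[OF a] a
        by (simp add: nth_append) linarith
    qed
  qed
qed

lemma dfn_not: "dfn A n R \<Longrightarrow> dfn A n (\<lambda>a. \<not> R a)"
  unfolding dfn_def by (metis fm_in.simps(3) sat_in.simps(3))

lemma dfn_ex:
  assumes "dfn A (Suc n) R" shows "dfn A n (\<lambda>a. \<exists>u. R (u # a))"
proof -
  obtain \<psi> b where b: "b \<in> lists A" "fm_in L (Suc n + length b) \<psi>"
    "\<And>a. length a = Suc n \<Longrightarrow> R a \<longleftrightarrow> sat U (a @ b) \<psi>"
    using assms unfolding dfn_def by blast
  show ?thesis using b by (intro dfnI[of b _ _ "Ex \<psi>"]) auto
qed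

lemma dfn_param:
  assumes "dfn A n R"
  obtains c R' where "set c \<subseteq> A" "dfn {} (n + length c) R'" "\<And>a. length a = n \<Longrightarrow> R a \<longleftrightarrow> R' (a @ c)"
proof -
  obtain \<psi> b where b: "b \<in> lists A" "fm_in L (n + length b) \<psi>"
    "\<And>a. length a = n \<Longrightarrow> R a \<longleftrightarrow> sat U (a @ b) \<psi>"
    using assms unfolding dfn_def by blast
  have "dfn {} (n + length b) (\<lambda>a. sat U a \<psi>)"
    using b(2) by (intro dfnI[of "[]" _ _ \<psi>]) auto
  then show ?thesis using that[of b "\<lambda>a. sat U a \<psi>"] b by auto
qed

lemma dfn_fm: "fm_in L n \<psi> \<Longrightarrow> dfn A n (\<lambda>a. sat U a \<psi>)"
  by (rule dfnI[of "[]" _ _ \<psi>]) auto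

lemma dfn_empty_fm:
  assumes "dfn {} n R"
  obtains \<psi> where "fm_in L n \<psi>" "\<And>a. length a = n \<Longrightarrow> R a \<longleftrightarrow> sat U a \<psi>"
  using assms unfolding dfn_def by auto

lemma dfn_conj:
  assumes "dfn A n R" "dfn A n S" shows "dfn A n (\<lambda>a. R a \<and> S a)"
proof -
  obtain c R' where c: "set c \<subseteq> A" "dfn {} (n + length c) R'" "\<And>a. length a = n \<Longrightarrow> R a \<longleftrightarrow> R' (a @ c)"
    using assms(1) by (rule dfn_param) blast
  obtain c' S' where c': "set c' \<subseteq> A" "dfn {} (n + length c') S'"
    "\<And>a. length a = n \<Longrightarrow> S a \<longleftrightarrow> S' (a @ c')"
    using assms(2) by (rule dfn_param) blast
  \<comment> \<open>Each formula has its own parameter list. Both are read in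
    \<open>n + length c + length c'\<close> variables, so that they can be conjoined under the joint
    list \<open>c @ c'\<close>.\<close>
  let ?N = "n + length c + length c'"
  have 1: "dfn {} ?N (\<lambda>a. R' (take (n + length c) a))"
    by (intro dfn_slc[OF c(2)] slc_take) simp
  have 2: "dfn {} ?N (\<lambda>a. S' (take n a @ drop (n + length c) a))"
    by (intro dfn_slc[OF c'(2)] slc_append slc_take slc_drop) simp_all
  obtain \<psi> where \<psi>: "fm_in L ?N \<psi>" "\<And>a. length a = ?N \<Longrightarrow> R' (take (n + length c) a) \<longleftrightarrow> sat U a \<psi>"
    using dfn_empty_fm[OF 1] by blast
  obtain \<psi>' where \<psi>': "fm_in L ?N \<psi>'"
    "\<And>a. length a = ?N \<Longrightarrow> S' (take n a @ drop (n + length c) a) \<longleftrightarrow> sat U a \<psi>'"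
    using dfn_empty_fm[OF 2] by blast
  show ?thesis
  proof (rule dfnI)
    show "c @ c' \<in> lists A" using c c' by auto
    show "fm_in L (n + length (c @ c')) (And \<psi> \<psi>')" using \<psi> \<psi>' by (simp add: add.assoc)
    fix a :: "'u list" assume "length a = n"
    then show "R a \<and> S a \<longleftrightarrow> sat U (a @ c @ c') (And \<psi> \<psi>')"
      using \<psi>(2)[of "a @ c @ c'"] \<psi>'(2)[of "a @ c @ c'"] c(3)[of a] c'(3)[of a] by simp
  qed
qed

lemma dfn_disj:
  assumes "dfn A n R" "dfn A n S" shows "dfn A n (\<lambda>a. R a \<or> S a)"
  using dfn_not[OF dfn_conj[OF assms[THEN dfn_not]]] by simp

lemma dfn_imp:
  assumes "dfn A n R" "dfn A n S" shows "dfn A n (\<lambda>a. R a \<longrightarrow> S a)"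
  using dfn_disj[OF dfn_not[OF assms(1)] assms(2)] by simp

lemma dfn_iff:
  assumes "dfn A n R" "dfn A n S" shows "dfn A n (\<lambda>a. R a \<longleftrightarrow> S a)"
  using dfn_conj[OF dfn_imp[OF assms] dfn_imp[OF assms(2,1)]] by (simp add: iff_conv_conj_imp)

text \<open>The syntax has no constant for truth, and for \<open>n = 0\<close> without parameters
  there is no free variable to write an equation with; the quantifier supplies one.\<close>

lemma dfn_True: "dfn A n (\<lambda>_. True)"
  by (rule dfnI[of "[]" _ _ "Neg (Ex (Neg (Eq (Var 0) (Var 0))))"]) auto

lemma dfn_Const: "dfn A n (\<lambda>_. P)"
  using dfn_True[of A n] dfn_not[OF dfn_True, of A n] by (cases P) auto

lemma dfn_ball: "finite F \<Longrightarrow> (\<And>i. i \<in> F \<Longrightarrow> dfn A n (R i)) \<Longrightarrow> dfn A n (\<lambda>a. \<forall>i\<in>F. R i a)"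
  by (induction F rule: finite_induct) (auto intro: dfn_True dfn_conj)

lemma dfn_bex: "finite F \<Longrightarrow> (\<And>i. i \<in> F \<Longrightarrow> dfn A n (R i)) \<Longrightarrow> dfn A n (\<lambda>a. \<exists>i\<in>F. R i a)"
  using dfn_not[OF dfn_ball[of F A n "\<lambda>i a. \<not> R i a"]] dfn_not by simp

lemma dfn_all: "dfn A (Suc n) R \<Longrightarrow> dfn A n (\<lambda>a. \<forall>u. R (u # a))"
  using dfn_not[OF dfn_ex[OF dfn_not[of A "Suc n" R]]] by simp

lemma dfn_exs: "dfn A (k + n) R \<Longrightarrow> dfn A n (\<lambda>a. \<exists>x. length x = k \<and> R (x @ a))"
proof (induction k arbitrary: R)
  case (Suc k)
  have "dfn A (k + n) (\<lambda>a. \<exists>u. R (u # a))" using Suc.prems by (intro dfn_ex) simp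
  then have "dfn A n (\<lambda>a. \<exists>x. length x = k \<and> (\<exists>u. R (u # x @ a)))" by (rule Suc.IH)
  moreover have "(\<exists>x. length x = k \<and> (\<exists>u. R (u # x @ a))) \<longleftrightarrow> (\<exists>x. length x = Suc k \<and> R (x @ a))" for a
    by (metis append_Cons length_Cons length_Suc_conv)
  ultimately show ?case by simp
qed simp

lemma dfn_inst:
  assumes "dfn A (n + k) R" "set c \<subseteq> A" "length c = k"
  shows "dfn A n (\<lambda>a. R (a @ c))"
  using assms by (auto intro!: dfn_slc[OF assms(1)] slc_append slc_id slc_const)

lemma dfn_inst1:
  assumes "dfn A (k + n) R" "set c \<subseteq> A" "length c = k"
  shows "dfn A n (\<lambda>a. R (c @ a))"
  using assms by (auto intro!: dfn_slc[OF assms(1)] slc_append slc_id slc_const)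

section \<open>Equality of types over a set of parameters\<close>

definition tpeq :: "'u set \<Rightarrow> 'u list \<Rightarrow> 'u list \<Rightarrow> bool" where
  "tpeq A xs ys \<longleftrightarrow> length xs = length ys \<and> (\<forall>R. dfn A (length xs) R \<longrightarrow> (R xs \<longleftrightarrow> R ys))"

lemma same_type_iff: "same_type L U A xs ys \<longleftrightarrow> tpeq A xs ys"
proof
  assume *: "same_type L U A xs ys"
  then have l: "length xs = length ys" by (simp add: same_type_def)
  have "R xs \<longleftrightarrow> R ys" if "dfn A (length xs) R" for R
  proof -
    obtain \<psi> b where "b \<in> lists A" "fm_in L (length xs + length b) \<psi>"
      "\<And>a. length a = length xs \<Longrightarrow> R a \<longleftrightarrow> sat U (a @ b) \<psi>"
      using \<open>dfn A _ R\<close> unfolding dfn_def by blast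
    then show ?thesis using * l unfolding same_type_def param_fms_def by auto
  qed
  then show "tpeq A xs ys" using l by (simp add: tpeq_def)
next
  assume *: "tpeq A xs ys"
  have "sat U (xs @ b) \<phi> \<longleftrightarrow> sat U (ys @ b) \<phi>" if "(\<phi>, b) \<in> param_fms L (length xs) A" for \<phi> b
  proof -
    have "dfn A (length xs) (\<lambda>a. sat U (a @ b) \<phi>)"
      using that by (intro dfnI[of b _ _ \<phi>]) (auto simp: param_fms_def)
    then show ?thesis using * by (auto simp: tpeq_def)
  qed
  then show "same_type L U A xs ys" using * by (auto simp: same_type_def tpeq_def)
qed

lemma tpeq_refl: "tpeq A xs xs"
  by (simp add: tpeq_def)

lemma tpeq_sym: "tpeq A xs ys \<Longrightarrow> tpeq A ys xs"
  unfolding tpeq_def by metis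

lemma tpeq_trans: "tpeq A xs ys \<Longrightarrow> tpeq A ys zs \<Longrightarrow> tpeq A xs zs"
  unfolding tpeq_def by metis

lemma tpeqD: "tpeq A xs ys \<Longrightarrow> dfn A n R \<Longrightarrow> length xs = n \<Longrightarrow> R xs \<longleftrightarrow> R ys"
  by (auto simp: tpeq_def)

lemma tpeq_length: "tpeq A xs ys \<Longrightarrow> length xs = length ys"
  by (auto simp: tpeq_def)

lemma tpeqI:
  "length xs = n \<Longrightarrow> length ys = n \<Longrightarrow> (\<And>R. dfn A n R \<Longrightarrow> R xs \<Longrightarrow> R ys) \<Longrightarrow> tpeq A xs ys"
  unfolding tpeq_def by (auto dest: dfn_not)

lemma tpeq_slc:
  assumes "tpeq A xs ys" "slc A (length xs) n F" shows "tpeq A (F xs) (F ys)"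
proof (rule tpeqI[of _ n])
  show "length (F xs) = n" "length (F ys) = n"
    using assms tpeq_length[OF assms(1)] unfolding slc_def by auto
  fix R assume "dfn A n R" "R (F xs)"
  then show "R (F ys)"
    using tpeqD[OF assms(1) dfn_slc[OF _ assms(2)]] by blast
qed

text \<open>Presents a parameter list from \<open>A \<union> set c\<close> as a function of
  \<open>c\<close> over \<open>A\<close>, so that the elements of \<open>c\<close> can afterwards be
  treated as variables.\<close>

lemma slc_params:
  "set p \<subseteq> A \<union> set c \<Longrightarrow> \<exists>F. slc A (length c) (length p) F \<and> F c = p"
proof (induction p)
  case Nil
  then show ?case using slc_const[of "[]" A] by fastforce
next
  case (Cons z p)
  then obtain F where F: "slc A (length c) (length p) F" "F c = p" by auto
  have "\<exists>G. slc A (length c) 1 G \<and> G c = [z]"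
  proof (cases "z \<in> A")
    case True
    then show ?thesis using slc_const[of "[z]" A] by fastforce
  next
    case False
    then obtain i where "i < length c" "z = c ! i" using Cons.prems by (auto simp: in_set_conv_nth)
    then show ?thesis using slc_seg[of i 1 "length c"]
      by (intro exI[of _ "\<lambda>a. take 1 (drop i a)"]) (simp add: take_Suc hd_drop_conv_nth)
  qed
  then obtain G where "slc A (length c) 1 G" "G c = [z]" by blast
  then show ?case using slc_append[of A "length c" 1 G "length p" F] F
    by (intro exI[of _ "\<lambda>a. G a @ F a"]) simp
qed

lemma slc_comp:
  assumes "slc A k n F" "slc A n l G" shows "slc A k l (\<lambda>a. G (F a))"
proof -
  obtain c \<rho> where c: "c \<in> lists A" "\<And>i. i < n \<Longrightarrow> \<rho> i < k + length c"
    "\<And>a. length a = k \<Longrightarrow> length (F a) = n"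
    "\<And>a i. length a = k \<Longrightarrow> i < n \<Longrightarrow> F a ! i = (a @ c) ! \<rho> i"
    using assms(1) unfolding slc_def by blast
  obtain c' \<rho>' where c': "c' \<in> lists A" "\<And>i. i < l \<Longrightarrow> \<rho>' i < n + length c'"
    "\<And>a. length a = n \<Longrightarrow> length (G a) = l"
    "\<And>a i. length a = n \<Longrightarrow> i < l \<Longrightarrow> G a ! i = (a @ c') ! \<rho>' i"
    using assms(2) unfolding slc_def by blast
  let ?r = "\<lambda>i. if \<rho>' i < n then \<rho> (\<rho>' i) else k + length c + (\<rho>' i - n)"
  show ?thesis unfolding slc_def
  proof (intro exI[of _ "c @ c'"] exI[of _ ?r] conjI allI impI)
    show "c @ c' \<in> lists A" using c(1) c'(1) by simp
  next
    fix i assume "i < l"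
    then show "?r i < k + length (c @ c')" using c(2)[of "\<rho>' i"] c'(2)[of i] by auto
  next
    fix a :: "'u list" assume a: "length a = k"
    then show "length (G (F a)) = l" using c(3) c'(3) by simp
    fix i assume i: "i < l"
    have *: "G (F a) ! i = (F a @ c') ! \<rho>' i" using c'(4)[OF c(3)[OF a] i] .
    show "G (F a) ! i = (a @ c @ c') ! ?r i"
    proof (cases "\<rho>' i < n")
      case True
      then show ?thesis using * c(2)[OF True] c(3,4)[OF a] a
        by (simp add: nth_append flip: append_assoc)
    next
      case False
      then show ?thesis
        using * c(3)[OF a] a nth_append_length_plus[of "a @ c" c' "\<rho>' i - n"]
        by (simp add: nth_append[of "F a"])
    qed
  qed
qed

lemma dfn_set_params:
  assumes "dfn (A \<union> set c) n R"
  obtains S where "dfn A (length c + n) S" "\<And>x. length x = n \<Longrightarrow> R x \<longleftrightarrow> S (c @ x)"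
proof -
  obtain p R' where p: "set p \<subseteq> A \<union> set c" "dfn {} (n + length p) R'"
    "\<And>a. length a = n \<Longrightarrow> R a \<longleftrightarrow> R' (a @ p)"
    using assms by (rule dfn_param) blast
  obtain F where F: "slc A (length c) (length p) F" "F c = p" using slc_params[OF p(1)] by blast
  have "dfn A (length c + n) (\<lambda>a. R' (drop (length c) a @ F (take (length c) a)))"
    by (intro dfn_slc[OF dfn_mono[OF p(2) empty_subsetI]] slc_append slc_drop
        slc_comp[OF slc_take F(1)]) auto
  then show thesis using that[of "\<lambda>a. R' (drop (length c) a @ F (take (length c) a))"] p(3) F(2) by simp
qed

lemma dfn_finite_params:
  assumes "dfn (A \<union> C) n R"
  obtains c where "set c \<subseteq> C" "dfn (A \<union> set c) n R"
proof -
  obtain \<psi> b where b: "b \<in> lists (A \<union> C)" "fm_in L (n + length b) \<psi>"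
    "\<And>a. length a = n \<Longrightarrow> R a \<longleftrightarrow> sat_in U UNIV (a @ b) \<psi>"
    using assms unfolding dfn_def by blast
  show thesis
  proof (rule that)
    show "set (filter (\<lambda>z. z \<in> C) b) \<subseteq> C" by auto
    show "dfn (A \<union> set (filter (\<lambda>z. z \<in> C) b)) n R" using b by (intro dfnI[of b]) auto
  qed
qed

text \<open>A formula mentions finitely many parameters, so types over \<open>A \<union> C\<close>
  can be compared over \<open>A\<close> after putting finite tuples of \<open>C\<close> in
  front.\<close>

lemma tpeq_params:
  assumes "\<And>c. set c \<subseteq> C \<Longrightarrow> tpeq A (c @ xs) (c @ ys)"
  shows "tpeq (A \<union> C) xs ys"
proof -
  have l: "length xs = length ys" using assms[of "[]"] tpeq_length by fastforce
  show ?thesis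
  proof (rule tpeqI[OF refl l[symmetric]])
    fix R assume R: "dfn (A \<union> C) (length xs) R" "R xs"
    obtain c where c: "set c \<subseteq> C" "dfn (A \<union> set c) (length xs) R"
      using R(1) by (rule dfn_finite_params)
    obtain S where S: "dfn A (length c + length xs) S" "\<And>x. length x = length xs \<Longrightarrow> R x \<longleftrightarrow> S (c @ x)"
      using c(2) by (rule dfn_set_params) blast
    show "R ys" using tpeqD[OF assms[OF c(1)] S(1)] S(2)[of xs] S(2)[of ys] l R(2) by simp
  qed
qed

lemma tpeq_sub:
  assumes "tpeq A (E @ xs) (E @ ys)" "set p \<subseteq> set E" "length xs = length ys"
  shows "tpeq A (p @ xs) (p @ ys)"
proof -
  obtain F where F: "slc A (length E) (length p) F" "F E = p" using slc_params[of p A E] assms(2) by auto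
  have "slc A (length (E @ xs)) (length p + length xs) (\<lambda>a. F (take (length E) a) @ drop (length E) a)"
    by (intro slc_append slc_drop slc_comp[OF slc_take F(1)]) auto
  from tpeq_slc[OF assms(1) this] show ?thesis using F(2) by simp
qed

end

section \<open>Ultrafilters and saturation\<close>

definition ultra :: "'a filter \<Rightarrow> bool" where
  "ultra V \<longleftrightarrow> V \<noteq> bot \<and> (\<forall>P. eventually P V \<or> eventually (\<lambda>x. \<not> P x) V)"

lemma ultra_not: "ultra V \<Longrightarrow> eventually (\<lambda>x. \<not> P x) V \<longleftrightarrow> \<not> eventually P V"
  unfolding ultra_def using eventually_conj[of P V "\<lambda>x. \<not> P x"] by (auto simp: eventually_False)

lemma ultra_happens: "ultra V \<Longrightarrow> eventually P V \<Longrightarrow> \<exists>x. P x"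
  unfolding ultra_def using eventually_happens by blast

lemma ultra_const: "ultra V \<Longrightarrow> eventually (\<lambda>x. P) V \<longleftrightarrow> P"
  unfolding ultra_def by (simp add: eventually_const)

text \<open>By Zorn's lemma \<open>F\<close> lies in a maximal family with the finite intersection
  property. A predicate stays outside such a family only if finitely many members exclude it, which
  makes the family an ultrafilter.\<close>

lemma eventually_in_ultra_filter:
  assumes fip: "\<And>G. finite G \<Longrightarrow> G \<subseteq> F \<Longrightarrow> \<exists>x. \<forall>P\<in>G. P x"
  obtains V where "ultra V" "\<And>P. P \<in> F \<Longrightarrow> eventually P V"
proof -
  define good where "good H \<longleftrightarrow> F \<subseteq> H \<and> (\<forall>G. finite G \<longrightarrow> G \<subseteq> H \<longrightarrow> (\<exists>x. \<forall>P\<in>G. P x))"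
    for H :: "('a \<Rightarrow> bool) set"
  have "\<exists>M\<in>{H. good H}. \<forall>X\<in>{H. good H}. M \<subseteq> X \<longrightarrow> X = M"
  proof (rule subset_Zorn_nonempty)
    show "{H. good H} \<noteq> {}" using fip by (auto simp: good_def)
    fix C assume C: "C \<noteq> {}" "subset.chain {H. good H} C"
    have "\<exists>x. \<forall>P\<in>G. P x" if G: "finite G" "G \<subseteq> \<Union>C" for G
    proof -
      obtain H where "H \<in> C" "G \<subseteq> H"
        using finite_subset_Union_chain[OF G C] by blast
      then show ?thesis using C(2) G(1) by (auto simp: subset.chain_def good_def)
    qed
    moreover have "F \<subseteq> \<Union>C"
    proof -
      obtain H where "H \<in> C" using C(1) by blast
      moreover from this have "good H" using C(2) by (auto simp: subset.chain_def)
      ultimately show ?thesis by (auto simp: good_def)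
    qed
    ultimately show "\<Union>C \<in> {H. good H}" by (simp add: good_def)
  qed
  then obtain M where M: "good M" and max: "\<And>H. good H \<Longrightarrow> M \<subseteq> H \<Longrightarrow> H = M" by blast
  have out: "\<exists>G. finite G \<and> G \<subseteq> M \<and> (\<forall>x. P x \<longrightarrow> (\<exists>Q\<in>G. \<not> Q x))" if "P \<notin> M" for P
  proof -
    have "\<not> good (insert P M)" using max[of "insert P M"] that by blast
    moreover have "F \<subseteq> insert P M" using M by (auto simp: good_def)
    ultimately obtain G where G: "finite G" "G \<subseteq> insert P M" "\<forall>x. \<exists>Q\<in>G. \<not> Q x"
      by (auto simp: good_def)
    then show ?thesis by (intro exI[of _ "G - {P}"]) auto
  qed
  have fin: "\<exists>x. \<forall>P\<in>G. P x" if "finite G" "G \<subseteq> M" for G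
    using M that by (simp add: good_def)
  have in_M: "P \<in> M" if g: "finite G" "G \<subseteq> M" "\<And>x. \<forall>Q\<in>G. Q x \<Longrightarrow> P x" for P G
  proof (rule ccontr)
    assume "P \<notin> M"
    then obtain G' where "finite G'" "G' \<subseteq> M" "\<forall>x. P x \<longrightarrow> (\<exists>Q\<in>G'. \<not> Q x)"
      using out[of P] by auto
    moreover from this obtain x where "\<forall>Q\<in>G \<union> G'. Q x" using fin[of "G \<union> G'"] g(1,2) by auto
    ultimately show False using g(3)[of x] by auto
  qed
  have flt: "is_filter (\<lambda>P. P \<in> M)"
  proof
    show "(\<lambda>x. True) \<in> M" by (rule in_M[of "{}"]) auto
    fix P Q assume "P \<in> M"
    then show "Q \<in> M \<Longrightarrow> (\<lambda>x. P x \<and> Q x) \<in> M" by (intro in_M[of "{P, Q}"]) auto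
    show "\<forall>x. P x \<longrightarrow> Q x \<Longrightarrow> Q \<in> M" using \<open>P \<in> M\<close> by (intro in_M[of "{P}"]) auto
  qed
  let ?V = "Abs_filter (\<lambda>P. P \<in> M)"
  have ev: "eventually P ?V \<longleftrightarrow> P \<in> M" for P using eventually_Abs_filter[OF flt] by simp
  have "P \<in> M \<or> (\<lambda>x. \<not> P x) \<in> M" for P
  proof (rule ccontr)
    assume "\<not> ?thesis"
    then obtain G G' where "finite G" "G \<subseteq> M" "\<forall>x. P x \<longrightarrow> (\<exists>Q\<in>G. \<not> Q x)"
      "finite G'" "G' \<subseteq> M" "\<forall>x. \<not> P x \<longrightarrow> (\<exists>Q\<in>G'. \<not> Q x)"
      using out[of P] out[of "\<lambda>x. \<not> P x"] by auto
    moreover from this obtain x where "\<forall>Q\<in>G \<union> G'. Q x" using fin[of "G \<union> G'"] by auto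
    ultimately show False by (cases "P x") auto
  qed
  moreover have "?V \<noteq> bot"
  proof
    assume "?V = bot"
    then have "(\<lambda>x. False) \<in> M" using ev[of "\<lambda>x. False"] by simp
    then show False using fin[of "{\<lambda>x. False}"] by auto
  qed
  ultimately have "ultra ?V" by (simp add: ultra_def ev)
  moreover have "eventually P ?V" if "P \<in> F" for P using that ev M by (auto simp: good_def)
  ultimately show thesis by (rule that)
qed

lemma ultra_filter_ex:
  assumes "\<And>G. finite G \<Longrightarrow> G \<subseteq> F \<Longrightarrow> \<exists>x. \<forall>P\<in>G. P x"
  shows "\<exists>V. ultra V \<and> (\<forall>P\<in>F. eventually P V)"
proof (rule eventually_in_ultra_filter[of F, OF assms])
  fix V assume "ultra V" and *: "\<And>P. P \<in> F \<Longrightarrow> eventually P V"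
  then show ?thesis by (intro exI[of _ V] conjI ballI *)
qed

text \<open>Block \<open>q\<close> of indices lies between \<open>T * q\<close> and
  \<open>T * q + T\<close>. This is used when a sequence is cut into consecutive blocks and the
  sequence of blocks has to inherit indiscernibility.\<close>

lemma sorted_blocks:
  fixes T :: nat
  assumes "\<And>q. sorted_wrt (<) (h q)" "\<And>q i. i \<in> set (h q) \<Longrightarrow> i < T"
  shows "sorted_wrt (<) qs \<Longrightarrow> sorted_wrt (<) (concat (map (\<lambda>q. map ((+) (T * q)) (h q)) qs))"
proof (induction qs)
  case (Cons q qs)
  have "T * q + i < T * q' + j" if "i \<in> set (h q)" "q' \<in> set qs" for i q' j
  proof -
    have "T * Suc q \<le> T * q'" using Cons.prems that(2) by (intro mult_le_mono2) auto
    then show ?thesis using assms(2)[OF that(1)] by simp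
  qed
  then show ?case using Cons assms(1)[of q] by (auto simp: sorted_wrt_append sorted_wrt_map)
qed simp

section \<open>Realising types, and compactness for sequences\<close>

locale saturated_struct = struct L U for L :: "('f, 'r) lang" and U :: "('f, 'r, 'u) interp" +
  fixes \<kappa> :: "'k rel"
  assumes card: "Card_order \<kappa>" "natLeq <o \<kappa>" and sat: "saturated L \<kappa> U"
begin

lemma small_Un_countable:
  assumes "small \<kappa> A" "countable C" shows "small \<kappa> (A \<union> C)"
proof -
  have "|C| \<le>o |UNIV :: nat set|"
    using assms(2) card_of_ordLeq[of C "UNIV :: nat set"] by (auto simp: countable_def)
  then have "|C| \<le>o natLeq" using card_of_nat ordLeq_ordIso_trans by blast
  then have "|C| <o \<kappa>" using card(2) ordLeq_ordLess_trans by blast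
  moreover have "\<not> finite (Field \<kappa>)"
  proof
    assume "finite (Field \<kappa>)"
    then have "|Field \<kappa>| <o natLeq" by (simp add: finite_iff_ordLess_natLeq)
    then show False
      using card card_of_Field_ordIso ordIso_ordLess_trans ordLess_transitive ordLess_irreflexive
        not_ordLess_ordLeq ordIso_iff_ordLeq ordLess_imp_ordLeq by metis
  qed
  ultimately show ?thesis
    using card_of_Un_ordLess_infinite_Field[of \<kappa> A C] card(1) assms(1) by (simp add: small_def)
qed

text \<open>\<open>saturated\<close> speaks of complete types only; an ultrafilter that contains
  \<open>F\<close> completes the finitely satisfiable family.\<close>

lemma realize1:
  assumes B: "small \<kappa> B" and F: "\<And>R. R \<in> F \<Longrightarrow> dfn B 1 R"
    and fin: "\<And>G. finite G \<Longrightarrow> G \<subseteq> F \<Longrightarrow> \<exists>u. \<forall>R\<in>G. R [u]"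
  shows "\<exists>u. \<forall>R\<in>F. R [u]"
proof -
  have "\<exists>u. \<forall>P\<in>G. P u" if "finite G" "G \<subseteq> (\<lambda>R u. R [u]) ` F" for G
    using fin finite_subset_image[OF that] by auto
  from eventually_in_ultra_filter[OF this] obtain V where V: "ultra V"
    "\<And>P. P \<in> (\<lambda>R u. R [u]) ` F \<Longrightarrow> eventually P V" by blast
  define p where "p = {(\<phi>, b) \<in> param_fms L 1 B. eventually (\<lambda>u. sat_in U UNIV (u # b) \<phi>) V}"
  have "complete_type L U 1 B p" unfolding complete_type_def
  proof (intro conjI allI impI)
    fix q assume q: "q \<subseteq> p" "finite q"
    have "eventually (\<lambda>u. \<forall>x\<in>q. sat_in U UNIV (u # snd x) (fst x)) V"
      using q by (intro eventually_ball_finite) (auto simp: p_def)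
    then obtain u where "\<forall>x\<in>q. sat_in U UNIV (u # snd x) (fst x)"
      using ultra_happens[OF V(1)] by blast
    then show "\<exists>a. length a = 1 \<and> (\<forall>(\<phi>, b)\<in>q. sat_in U UNIV (a @ b) \<phi>)"
      by (intro exI[of _ "[u]"]) auto
  qed (use V(1) in \<open>auto simp: p_def ultra_def param_fms_def\<close>)
  then obtain a where a: "\<forall>(\<phi>, b)\<in>p. sat_in U UNIV (a # b) \<phi>"
    using sat B unfolding saturated_def by blast
  have "R [a]" if R: "R \<in> F" for R
  proof -
    obtain \<psi> b where b: "b \<in> lists B" "fm_in L (1 + length b) \<psi>"
      "\<And>a. length a = 1 \<Longrightarrow> R a \<longleftrightarrow> sat_in U UNIV (a @ b) \<psi>"
      using F[OF R] unfolding dfn_def by blast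
    have "eventually (\<lambda>u. sat_in U UNIV (u # b) \<psi>) V"
      using V(2)[of "\<lambda>u. R [u]"] R b(3)[of "[_]"] by auto
    then have "(\<psi>, b) \<in> p" using b by (simp add: p_def param_fms_def)
    then show ?thesis using a b(3)[of "[a]"] by auto
  qed
  then show ?thesis by blast
qed

lemma realize:
  assumes B: "small \<kappa> B" and F: "\<And>R. R \<in> F \<Longrightarrow> dfn B n R"
    and fin: "\<And>G. finite G \<Longrightarrow> G \<subseteq> F \<Longrightarrow> \<exists>a. length a = n \<and> (\<forall>R\<in>G. R a)"
  shows "\<exists>a. length a = n \<and> (\<forall>R\<in>F. R a)"
  using F fin
proof (induction n arbitrary: F)
  case 0
  then have "R []" if "R \<in> F" for R using 0(2)[of "{R}"] that by auto
  then show ?case by auto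
next
  case (Suc n)
  \<comment> \<open>All entries but the first must satisfy the existential closures of the finite
    conjunctions from \<open>F\<close>. The first entry is then found with those entries as
    additional parameters.\<close>
  define F' where "F' = (\<lambda>G a. \<exists>u. \<forall>R\<in>G. R (u # a)) ` {G. finite G \<and> G \<subseteq> F}"
  have "\<exists>a. length a = n \<and> (\<forall>R\<in>F'. R a)"
  proof (rule Suc.IH)
    fix R assume "R \<in> F'"
    then obtain G where G: "finite G" "G \<subseteq> F" "R = (\<lambda>a. \<exists>u. \<forall>R\<in>G. R (u # a))"
      by (auto simp: F'_def)
    have "dfn B (Suc n) (\<lambda>a. \<forall>R\<in>G. R a)" using G Suc.prems(1) by (intro dfn_ball) auto
    from dfn_ex[OF this] show "dfn B n R" using G(3) by simp
  next
    fix H assume H: "finite H" "H \<subseteq> F'"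
    obtain K where K: "finite K" "K \<subseteq> {G. finite G \<and> G \<subseteq> F}"
      "H = (\<lambda>G a. \<exists>u. \<forall>R\<in>G. R (u # a)) ` K"
      using finite_subset_image[OF H[unfolded F'_def]] by blast
    have "finite (\<Union>K)" "\<Union>K \<subseteq> F" using K by auto
    then obtain a where a: "length a = Suc n" "\<forall>R\<in>\<Union>K. R a" using Suc.prems(2) by blast
    then show "\<exists>a. length a = n \<and> (\<forall>R\<in>H. R a)"
      using K(3) by (cases a) auto
  qed
  then obtain a where a: "length a = n" "\<And>G. finite G \<Longrightarrow> G \<subseteq> F \<Longrightarrow> \<exists>u. \<forall>R\<in>G. R (u # a)"
    by (auto simp: F'_def)
  have "\<exists>u. \<forall>R\<in>(\<lambda>R x. R (x @ a)) ` F. R [u]"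
  proof (rule realize1)
    show "small \<kappa> (B \<union> set a)" using B by (intro small_Un_countable countable_finite) auto
    show "dfn (B \<union> set a) 1 R" if R: "R \<in> (\<lambda>R x. R (x @ a)) ` F" for R
    proof -
      obtain S where S: "S \<in> F" "R = (\<lambda>x. S (x @ a))" using R by auto
      have "dfn (B \<union> set a) (1 + n) S" using dfn_mono[OF Suc.prems(1)[OF S(1)], of "B \<union> set a"] by simp
      from dfn_inst[OF this _ a(1)] show ?thesis using S(2) by simp
    qed
    fix G assume "finite G" "G \<subseteq> (\<lambda>R x. R (x @ a)) ` F"
    from finite_subset_image[OF this]
    obtain G' where "finite G'" "G' \<subseteq> F" "G = (\<lambda>R x. R (x @ a)) ` G'" by auto
    then show "\<exists>u. \<forall>R\<in>G. R [u]" using a(2)[of G'] by auto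
  qed
  then obtain u where "\<forall>R\<in>F. R (u # a)" by auto
  then show ?case using a(1) by (intro exI[of _ "u # a"]) simp
qed

lemma dfn_exs_right:
  assumes "dfn A (n + k) R" shows "dfn A n (\<lambda>a. \<exists>x. length x = k \<and> R (a @ x))"
proof -
  have "dfn A (k + n) (\<lambda>a. R (drop k a @ take k a))"
    by (intro dfn_slc[OF assms] slc_append slc_take slc_drop) auto
  from dfn_exs[OF this] show ?thesis by (auto cong: conj_cong)
qed

text \<open>The formulas that hold of initial segments for \<open>W\<close>-almost all sequences
  form a limit type over \<open>B\<close>, and \<open>J\<close> realises it. It is built one tuple
  at a time, each step realising a type over \<open>B\<close> and the finitely many tuples found
  before.\<close>

lemma realize_seq:
  assumes B: "small \<kappa> B" and W: "ultra W" "eventually (\<lambda>K. \<forall>i::nat. length (K i) = m) W"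
  obtains J where "\<And>i. length (J i) = m"
    "\<And>N R. dfn B (N * m) R \<Longrightarrow> R (concat (map J [0..<N])) \<longleftrightarrow>
       eventually (\<lambda>K. R (concat (map K [0..<N]))) W"
proof -
  let ?E = "\<lambda>N R. eventually (\<lambda>K. R (concat (map K [0..<N]))) W"
  let ?P = "\<lambda>N s. length s = N * m \<and> (\<forall>R. dfn B (N * m) R \<longrightarrow> (R s \<longleftrightarrow> ?E N R))"
  have "\<exists>f. \<forall>N. ?P N (f N) \<and> (\<exists>v. length v = m \<and> f (Suc N) = f N @ v)"
  proof (rule dependent_nat_choice)
    show "\<exists>s. ?P 0 s" using ultra_const[OF W(1)] by simp
  next
    fix s N assume s: "?P N s"
    let ?F = "{\<lambda>v. R (s @ v) | R. dfn B (N * m + m) R \<and> ?E (Suc N) R}"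
    have "\<exists>v. length v = m \<and> (\<forall>R\<in>?F. R v)"
    proof (rule realize)
      show "small \<kappa> (B \<union> set s)" using B by (intro small_Un_countable countable_finite) auto
      fix R assume "R \<in> ?F"
      then obtain S where S: "dfn B (N * m + m) S" "R = (\<lambda>v. S (s @ v))" by auto
      have "dfn (B \<union> set s) (N * m + m) S" using dfn_mono[OF S(1)] by simp
      from dfn_inst1[OF this, of s] show "dfn (B \<union> set s) m R" using S(2) s by simp
    next
      fix G assume G: "finite G" "G \<subseteq> ?F"
      have "?F = (\<lambda>R v. R (s @ v)) ` {R. dfn B (N * m + m) R \<and> ?E (Suc N) R}" by auto
      from finite_subset_image[OF G[unfolded this]]
      obtain G' where G': "finite G'" "G' \<subseteq> {R. dfn B (N * m + m) R \<and> ?E (Suc N) R}"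
        "G = (\<lambda>R v. R (s @ v)) ` G'" by auto
      have d: "dfn B (N * m) (\<lambda>s. \<exists>v. length v = m \<and> (\<forall>R\<in>G'. R (s @ v)))"
        using G' by (intro dfn_exs_right dfn_ball) auto
      have "eventually (\<lambda>K. (\<forall>i. length (K i) = m) \<and> (\<forall>R\<in>G'. R (concat (map K [0..<Suc N])))) W"
        using G' W by (intro eventually_conj eventually_ball_finite) auto
      then have "?E N (\<lambda>s. \<exists>v. length v = m \<and> (\<forall>R\<in>G'. R (s @ v)))"
        by (rule eventually_mono) auto
      then show "\<exists>v. length v = m \<and> (\<forall>R\<in>G. R v)" using s d G'(3) by auto
    qed
    then obtain v where v1: "length v = m" "\<forall>R\<in>?F. R v" by (elim exE conjE) (rule that)
    have v: "length v = m" "\<And>R. dfn B (N * m + m) R \<Longrightarrow> ?E (Suc N) R \<Longrightarrow> R (s @ v)"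
      using v1 by auto
    have "R (s @ v) \<longleftrightarrow> ?E (Suc N) R" if "dfn B (N * m + m) R" for R
      using v(2)[OF that] v(2)[OF dfn_not[OF that]]
        ultra_not[OF W(1), of "\<lambda>K. R (concat (map K [0..<Suc N]))"] by argo
    then show "\<exists>s'. ?P (Suc N) s' \<and> (\<exists>v. length v = m \<and> s' = s @ v)"
      using s v(1) by (intro exI[of _ "s @ v"]) (auto simp: add.commute)
  qed
  then obtain f where f: "\<And>N. ?P N (f N)" "\<And>N. \<exists>v. length v = m \<and> f (Suc N) = f N @ v" by blast
  obtain J where J: "\<And>N. length (J N) = m" "\<And>N. f (Suc N) = f N @ J N" using f(2) by metis
  have "concat (map J [0..<N]) = f N" for N
    by (induction N) (use f(1)[of 0] J in auto)
  then show thesis using that[of J] J(1) f(1) by metis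
qed

lemma compact_seq:
  assumes B: "small \<kappa> B" and G: "\<And>N R. (N, R) \<in> \<Gamma> \<Longrightarrow> dfn B (N * m) R"
    and fin: "\<And>\<Delta>. finite \<Delta> \<Longrightarrow> \<Delta> \<subseteq> \<Gamma> \<Longrightarrow>
       \<exists>K. (\<forall>i::nat. length (K i) = m) \<and> (\<forall>(N, R)\<in>\<Delta>. R (concat (map K [0..<N])))"
  obtains J where "\<And>i. length (J i) = m" "\<And>N R. (N, R) \<in> \<Gamma> \<Longrightarrow> R (concat (map J [0..<N]))"
proof -
  define f where "f x K \<longleftrightarrow> (\<forall>i::nat. length (K i) = m) \<and> snd x (concat (map K [0..<fst x]))"
    for x :: "nat \<times> ('u list \<Rightarrow> bool)" and K
  \<comment> \<open>The trivial condition carries the requirement on the lengths, so that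
    \<open>W\<close> contains it even when \<open>\<Gamma>\<close> is empty.\<close>
  let ?G = "insert (0, \<lambda>_. True) \<Gamma>"
  have "\<exists>K. \<forall>P\<in>G. P K" if g: "finite G" "G \<subseteq> f ` ?G" for G
  proof -
    from finite_subset_image[OF g] obtain \<Delta> where \<Delta>: "\<Delta> \<subseteq> ?G" "finite \<Delta>" "G = f ` \<Delta>" by auto
    have "\<exists>K. (\<forall>i::nat. length (K i) = m) \<and> (\<forall>(N, R)\<in>\<Delta> - {(0, \<lambda>_. True)}. R (concat (map K [0..<N])))"
      using \<Delta> by (intro fin) auto
    then obtain K where K: "\<forall>i. length (K i) = m"
      "\<forall>(N, R)\<in>\<Delta> - {(0, \<lambda>_. True)}. R (concat (map K [0..<N]))"
      by (elim exE conjE) (rule that)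
    have "f x K" if "x \<in> \<Delta>" for x
    proof (cases "x = (0, \<lambda>_. True)")
      case False
      then have "x \<in> \<Delta> - {(0, \<lambda>_. True)}" using that by blast
      from bspec[OF K(2) this] show ?thesis using K(1) by (simp add: f_def case_prod_beta)
    qed (use K(1) in \<open>simp add: f_def\<close>)
    then have "\<forall>P\<in>G. P K" using \<Delta>(3) by blast
    then show ?thesis by blast
  qed
  from eventually_in_ultra_filter[OF this] obtain W where W: "ultra W"
    "\<And>P. P \<in> f ` ?G \<Longrightarrow> eventually P W" by metis
  have f: "eventually (f x) W" if "x \<in> ?G" for x using W(2) that by auto
  have "eventually (\<lambda>K. \<forall>i. length (K i) = m) W"
    by (rule eventually_mono[OF f[of "(0, \<lambda>_. True)"]]) (auto simp: f_def)
  from realize_seq[OF B W(1) this] obtain J where J: "\<And>i. length (J i) = m"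
    "\<And>N R. dfn B (N * m) R \<Longrightarrow> R (concat (map J [0..<N])) \<longleftrightarrow>
       eventually (\<lambda>K. R (concat (map K [0..<N]))) W" by metis
  have "R (concat (map J [0..<N]))" if "(N, R) \<in> \<Gamma>" for N R
  proof -
    have "eventually (\<lambda>K. R (concat (map K [0..<N]))) W"
      by (rule eventually_mono[OF f[of "(N, R)"]]) (use that in \<open>auto simp: f_def\<close>)
    then show ?thesis using J(2) G that by blast
  qed
  then show thesis using that J(1) by blast
qed

section \<open>Indiscernible sequences\<close>

lemma indiscernible_iff:
  "indiscernible L U A I \<longleftrightarrow> (\<exists>n. \<forall>i. length (I i) = n) \<and>
     (\<forall>is js. sorted_wrt (<) is \<and> sorted_wrt (<) js \<and> length is = length js \<longrightarrow>
        tpeq A (concat (map I is)) (concat (map I js)))"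
  by (simp add: indiscernible_def same_type_iff)

lemma indiscernibleD:
  "indiscernible L U A I \<Longrightarrow> sorted_wrt (<) is \<Longrightarrow> sorted_wrt (<) js \<Longrightarrow> length is = length js \<Longrightarrow>
     tpeq A (concat (map I is)) (concat (map I js))"
  by (simp add: indiscernible_iff)

section \<open>Blocks of a concatenated sequence, and extraction of indiscernible sequences\<close>

lemma length_concat_const: "(\<And>x. x \<in> set xs \<Longrightarrow> length (f x) = m) \<Longrightarrow> length (concat (map f xs)) = length xs * m"
  by (induction xs) auto

text \<open>Turns a condition on a subsequence into a condition on an initial segment, the form that
  \<open>compact_seq\<close> accepts.\<close>

definition pick :: "nat \<Rightarrow> nat list \<Rightarrow> 'u list \<Rightarrow> 'u list" where
  "pick m is a = concat (map (\<lambda>i. take m (drop (i * m) a)) is)"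

lemma pick_concat:
  assumes "\<And>i. length (J i) = m" "\<And>i. i \<in> set is \<Longrightarrow> i < N"
  shows "pick m is (concat (map J [0..<N])) = concat (map J is)"
proof -
  have "take m (drop (i * m) (concat (map J [0..<N]))) = J i" if "i < N" for i
  proof -
    have "[0..<N] = [0..<i] @ i # [Suc i..<N]"
      using that by (metis le0 less_imp_le_nat upt_add_eq_append upt_conv_Cons le_add_diff_inverse add_0)
    then have "concat (map J [0..<N]) = concat (map J [0..<i]) @ J i @ concat (map J [Suc i..<N])"
      by simp
    moreover have "length (concat (map J [0..<i])) = i * m"
      using length_concat_const[of "[0..<i]" J m] assms(1) by simp
    ultimately show ?thesis using assms(1)[of i] by simp
  qed
  then show ?thesis unfolding pick_def using assms(2) by (intro arg_cong[of _ _ concat] map_cong) auto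
qed

lemma slc_pick: "(\<And>i. i \<in> set is \<Longrightarrow> i < N) \<Longrightarrow> slc A (N * m) (length is * m) (pick m is)"
proof (induction "is")
  case Nil
  then show ?case using slc_const[of "[]" A "N * m"] by (simp add: pick_def[abs_def])
next
  case (Cons i "is")
  have "Suc i * m \<le> N * m" using Cons.prems[of i] by (intro mult_le_mono1) auto
  then have "slc A (N * m) m (\<lambda>a. take m (drop (i * m) a))" by (intro slc_seg) simp
  from slc_append[OF this Cons.IH] Cons.prems show ?case by (simp add: pick_def[abs_def])
qed

lemma indiscernibleI:
  assumes l: "\<And>i. length (J i) = m"
    and J: "\<And>is js R. sorted_wrt (<) is \<Longrightarrow> sorted_wrt (<) js \<Longrightarrow> length is = length js \<Longrightarrow>
      dfn A (length is * m) R \<Longrightarrow> R (concat (map J is)) \<Longrightarrow> R (concat (map J js))"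
  shows "indiscernible L U A J"
  unfolding indiscernible_iff
proof (intro conjI allI impI)
  show "\<exists>n. \<forall>i. length (J i) = n" using l by blast
  fix "is" js :: "nat list" assume *: "sorted_wrt (<) is \<and> sorted_wrt (<) js \<and> length is = length js"
  show "tpeq A (concat (map J is)) (concat (map J js))"
    using * J l by (intro tpeqI[of _ "length is * m"]) (auto simp: length_concat_const[of _ J m])
qed

text \<open>Ramsey's theorem is applied to one colouring after another, each time inside the set
  already homogeneous for the earlier ones; homogeneity passes to subsets.\<close>

lemma homogeneous_subset:
  fixes Q :: "'i \<Rightarrow> nat set \<Rightarrow> bool" and k :: "'i \<Rightarrow> nat"
  assumes "finite D"
  shows "\<exists>H. infinite H \<and> (\<forall>d\<in>D. \<forall>X Y. X \<subseteq> H \<longrightarrow> Y \<subseteq> H \<longrightarrow> finite X \<longrightarrow> finite Y \<longrightarrow>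
     card X = k d \<longrightarrow> card Y = k d \<longrightarrow> (Q d X \<longleftrightarrow> Q d Y))"
proof -
  define hom where "hom d H \<longleftrightarrow> (\<forall>X Y. X \<subseteq> H \<longrightarrow> Y \<subseteq> H \<longrightarrow> finite X \<longrightarrow> finite Y \<longrightarrow>
     card X = k d \<longrightarrow> card Y = k d \<longrightarrow> (Q d X \<longleftrightarrow> Q d Y))" for d H
  have mono: "hom d Y" if "hom d H" "Y \<subseteq> H" for d H Y
    using that unfolding hom_def by (meson subset_trans)
  have "\<exists>H. infinite H \<and> (\<forall>d\<in>D. hom d H)"
    using assms
  proof (induction D rule: finite_induct)
    case empty
    show ?case by (intro exI[of _ UNIV]) auto
  next
    case (insert d D)
    then obtain H where H: "infinite H" "\<forall>d\<in>D. hom d H" by blast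
    define f where "f X = (if Q d X then 0 else 1 :: nat)" for X
    have "\<forall>X. X \<subseteq> H \<and> finite X \<and> card X = k d \<longrightarrow> f X < 2" by (auto simp: f_def)
    from Ramsey[OF H(1) this] obtain Y t where Y: "Y \<subseteq> H" "infinite Y"
      "\<forall>X. X \<subseteq> Y \<and> finite X \<and> card X = k d \<longrightarrow> f X = t" by blast
    have "f X = t \<and> f Z = t" if "X \<subseteq> Y" "Z \<subseteq> Y" "finite X" "finite Z" "card X = k d" "card Z = k d" for X Z
      using Y(3) that by blast
    then have "hom d Y" unfolding hom_def by (metis f_def zero_neq_one)
    then show ?case using Y H mono by (intro exI[of _ Y]) blast
  qed
  then show ?thesis unfolding hom_def by simp
qed

text \<open>Finitely many of the required conditions involve finitely many formulas, and Ramsey's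
  theorem gives a subsequence of \<open>I\<close> that satisfies them; compactness does the rest.
  The last conclusion is the link to \<open>I\<close>: whatever holds of all its increasing tuples
  is passed on to \<open>J\<close>.\<close>

lemma extract_indiscernible:
  assumes A: "small \<kappa> A" and I: "\<And>i :: nat. length (I i) = m"
  obtains J where "\<And>i. length (J i) = m" "indiscernible L U A J"
    "\<And>k R is. dfn A (k * m) R \<Longrightarrow>
       (\<And>js. sorted_wrt (<) js \<Longrightarrow> length js = k \<Longrightarrow> R (concat (map I js))) \<Longrightarrow>
       sorted_wrt (<) is \<Longrightarrow> length is = k \<Longrightarrow> R (concat (map J is))"
proof -
  define \<Gamma>1 where "\<Gamma>1 = {(N, \<lambda>a. R (pick m is a) \<longleftrightarrow> R (pick m js a)) | N R is js k.
     dfn A (k * m) R \<and> sorted_wrt (<) is \<and> sorted_wrt (<) js \<and> length is = k \<and> length js = k \<and>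
     set is \<subseteq> {..<N} \<and> set js \<subseteq> {..<N}}"
  define \<Gamma>2 where "\<Gamma>2 = {(N, \<lambda>a. R (pick m is a)) | N R is k. dfn A (k * m) R \<and>
     (\<forall>js. sorted_wrt (<) js \<longrightarrow> length js = k \<longrightarrow> R (concat (map I js))) \<and> sorted_wrt (<) is \<and>
     length is = k \<and> set is \<subseteq> {..<N}}"
  have dp: "dfn A (N * m) (\<lambda>a. R (pick m is a))" if "dfn A (length is * m) R" "set is \<subseteq> {..<N}" for N R "is"
    using that by (intro dfn_slc[OF that(1)] slc_pick) auto
  obtain J where J: "\<And>i. length (J i) = m" "\<And>N R. (N, R) \<in> \<Gamma>1 \<union> \<Gamma>2 \<Longrightarrow> R (concat (map J [0..<N]))"
  proof (rule compact_seq[OF A, of "\<Gamma>1 \<union> \<Gamma>2" m])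
    fix N R assume "(N, R) \<in> \<Gamma>1 \<union> \<Gamma>2"
    then show "dfn A (N * m) R" unfolding \<Gamma>1_def \<Gamma>2_def by (auto intro!: dfn_iff dp)
  next
    fix \<Delta> assume \<Delta>: "finite \<Delta>" "\<Delta> \<subseteq> \<Gamma>1 \<union> \<Gamma>2"
    define rel where "rel x R is js k \<longleftrightarrow>
      x = (fst x, \<lambda>a. R (pick m is a) \<longleftrightarrow> R (pick m js a)) \<and>
      sorted_wrt (<) is \<and> sorted_wrt (<) js \<and> length is = k \<and> length js = k \<and>
      set is \<subseteq> {..<fst x} \<and> set js \<subseteq> {..<fst x}"
      for x :: "nat \<times> ('u list \<Rightarrow> bool)" and R "is" js k
    have "\<exists>R is js k. rel x R is js k" if "x \<in> \<Gamma>1" for x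
      using that unfolding \<Gamma>1_def rel_def by fastforce
    then obtain r s t k where rs: "\<And>x. x \<in> \<Gamma>1 \<Longrightarrow> rel x (r x) (s x) (t x) (k x)" by metis
    \<comment> \<open>Ramsey's theorem colours finite sets; a set stands here for its increasing
      enumeration.\<close>
    define Q where "Q x X \<longleftrightarrow> r x (concat (map I (sorted_list_of_set X)))" for x X
    obtain H where H: "infinite H" "\<forall>d\<in>\<Delta>. \<forall>X Y. X \<subseteq> H \<longrightarrow> Y \<subseteq> H \<longrightarrow> finite X \<longrightarrow> finite Y \<longrightarrow>
      card X = k d \<longrightarrow> card Y = k d \<longrightarrow> (Q d X \<longleftrightarrow> Q d Y)"
      using homogeneous_subset[OF \<Delta>(1), of k Q] by (elim exE conjE) (rule that)
    define g where "g = enumerate H"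
    have g: "strict_mono g" "\<And>i. g i \<in> H"
      using H(1) by (auto simp: g_def strict_mono_enumerate enumerate_in_set)
    define K where "K = I \<circ> g"
    have K: "length (K i) = m" for i by (simp add: K_def I)
    have srt: "sorted_wrt (<) (map g is)" if "sorted_wrt (<) is" for "is"
      using that g(1) by (auto simp: sorted_wrt_map strict_mono_def elim: sorted_wrt_mono_rel[rotated])
    have sl: "map g is = sorted_list_of_set (set (map g is))" "card (set (map g is)) = length is"
      if "sorted_wrt (<) is" for "is"
      using srt[OF that] by (metis strict_sorted_equal set_sorted_list_of_set strict_sorted_list_of_set finite_set)
        (metis distinct_card length_map srt strict_sorted_iff that)
    have "snd x (concat (map K [0..<fst x]))" if x: "x \<in> \<Delta>" for x
    proof (cases "x \<in> \<Gamma>1")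
      case True
      note rx = rs[OF True, unfolded rel_def]
      have e: "concat (map K (s x)) = concat (map I (sorted_list_of_set (set (map g (s x)))))"
        "concat (map K (t x)) = concat (map I (sorted_list_of_set (set (map g (t x)))))"
        using rx sl(1)[of "s x"] sl(1)[of "t x"] by (simp_all add: K_def flip: map_map)
      have "r x (concat (map K (s x))) \<longleftrightarrow> r x (concat (map K (t x)))"
        unfolding e using H(2)[rule_format, OF x, unfolded Q_def] rx g(2) sl(2)
        by (metis finite_set image_subsetI set_map)
      moreover have "pick m (s x) (concat (map K [0..<fst x])) = concat (map K (s x))"
        "pick m (t x) (concat (map K [0..<fst x])) = concat (map K (t x))"
        using rx K by (auto intro!: pick_concat)
      moreover have "snd x = (\<lambda>a. r x (pick m (s x) a) \<longleftrightarrow> r x (pick m (t x) a))"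
        using arg_cong[OF conjunct1[OF rx], of snd] by (simp only: snd_conv)
      ultimately show ?thesis by simp
    next
      case False
      then have "x \<in> \<Gamma>2" using x \<Delta> by blast
      then obtain R "is" where R: "x = (fst x, \<lambda>a. R (pick m is a))"
        "\<And>js. sorted_wrt (<) js \<Longrightarrow> length js = length is \<Longrightarrow> R (concat (map I js))" "sorted_wrt (<) is"
        "set is \<subseteq> {..<fst x}" unfolding \<Gamma>2_def by auto
      have "R (concat (map K is))" using R(2)[of "map g is"] srt[OF R(3)] by (simp add: K_def)
      moreover have "pick m is (concat (map K [0..<fst x])) = concat (map K is)"
        using R(4) K by (auto intro!: pick_concat)
      moreover have "snd x = (\<lambda>a. R (pick m is a))"
        using arg_cong[OF R(1), of snd] by (simp only: snd_conv)
      ultimately show ?thesis by simp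
    qed
    then show "\<exists>K. (\<forall>i. length (K i) = m) \<and> (\<forall>(N, R)\<in>\<Delta>. R (concat (map K [0..<N])))"
      using K by (intro exI[of _ K]) auto
  qed blast
  have bound: "\<exists>N. set is \<subseteq> {..<N}" for "is" :: "nat list"
    using finite_nat_iff_bounded[of "set is"] by simp
  have "indiscernible L U A J"
  proof (rule indiscernibleI[OF J(1)])
    fix "is" js :: "nat list" and R
    assume *: "sorted_wrt (<) is" "sorted_wrt (<) js" "length is = length js" "dfn A (length is * m) R"
      "R (concat (map J is))"
    obtain N where N: "set (is @ js) \<subseteq> {..<N}" using bound by blast
    then have "(N, \<lambda>a. R (pick m is a) \<longleftrightarrow> R (pick m js a)) \<in> \<Gamma>1"
      unfolding \<Gamma>1_def using * by auto
    then have "R (pick m is (concat (map J [0..<N]))) \<longleftrightarrow> R (pick m js (concat (map J [0..<N])))"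
      using J(2) by blast
    moreover have "pick m is (concat (map J [0..<N])) = concat (map J is)"
      "pick m js (concat (map J [0..<N])) = concat (map J js)" using N J(1) by (auto intro!: pick_concat)
    ultimately show "R (concat (map J js))" using * by simp
  qed
  moreover have "R (concat (map J is))" if *: "dfn A (k * m) R"
       "\<And>js. sorted_wrt (<) js \<Longrightarrow> length js = k \<Longrightarrow> R (concat (map I js))"
       "sorted_wrt (<) is" "length is = k" for k R "is"
  proof -
    obtain N where N: "set is \<subseteq> {..<N}" using bound by blast
    then have "(N, \<lambda>a. R (pick m is a)) \<in> \<Gamma>2" unfolding \<Gamma>2_def using * by auto
    then have "R (pick m is (concat (map J [0..<N])))" using J(2) by blast
    moreover have "pick m is (concat (map J [0..<N])) = concat (map J is)"
      using N J(1) by (auto intro!: pick_concat)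
    ultimately show ?thesis by simp
  qed
  ultimately show thesis using that[of J] J(1) by blast
qed

lemma tpeq_swap:
  assumes "tpeq A (x @ y) (x' @ y')" "length x = length x'"
  shows "tpeq A (y @ x) (y' @ x')"
proof -
  have "length y = length y'" using tpeq_length[OF assms(1)] assms(2) by simp
  moreover have "slc A (length (x @ y)) (length y + length x) (\<lambda>a. drop (length x) a @ take (length x) a)"
    by (intro slc_append slc_drop slc_take) auto
  from tpeq_slc[OF assms(1) this] have "tpeq A (y @ x) (drop (length x) (x' @ y') @ take (length x) (x' @ y'))"
    by simp
  ultimately show ?thesis using assms(2) by simp
qed

lemma tpeq_append1:
  assumes "tpeq A (x @ y) (x' @ y')" "length x = length x'" shows "tpeq A x x'"
proof -
  have "slc A (length (x @ y)) (length x) (take (length x))" by (intro slc_take) auto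
  from tpeq_slc[OF assms(1) this] show ?thesis using assms(2) by simp
qed

lemma tpeq_append2:
  assumes "tpeq A (x @ y) (x' @ y')" "length x = length x'" shows "tpeq A y y'"
  using tpeq_append1[OF tpeq_swap[OF assms]] tpeq_length[OF assms(1)] assms(2) by simp

text \<open>Any finite part of the type of \<open>zs\<close> over \<open>xs\<close> has its
  existential closure in the common type of \<open>xs\<close> and \<open>ys\<close>, hence is
  satisfiable over \<open>ys\<close>; saturation realises all of it at once.\<close>

lemma tpeq_extend:
  assumes "small \<kappa> A" "tpeq A xs ys"
  obtains ws where "length ws = length zs" "tpeq A (xs @ zs) (ys @ ws)"
proof -
  have l: "length xs = length ys" using tpeq_length[OF assms(2)] .
  let ?D = "{R. dfn A (length xs + length zs) R \<and> R (xs @ zs)}"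
  have "\<exists>w. length w = length zs \<and> (\<forall>R\<in>(\<lambda>R w. R (ys @ w)) ` ?D. R w)"
  proof (rule realize)
    show "small \<kappa> (A \<union> set ys)" using assms(1) by (intro small_Un_countable countable_finite) auto
    fix R assume "R \<in> (\<lambda>R w. R (ys @ w)) ` ?D"
    then obtain S where S: "dfn A (length xs + length zs) S" "R = (\<lambda>w. S (ys @ w))" by auto
    have "dfn (A \<union> set ys) (length xs + length zs) S" using dfn_mono[OF S(1)] by simp
    from dfn_inst1[OF this, of ys] show "dfn (A \<union> set ys) (length zs) R" using S(2) l by simp
  next
    fix G assume "finite G" "G \<subseteq> (\<lambda>R w. R (ys @ w)) ` ?D"
    from finite_subset_image[OF this] obtain G' where G': "finite G'" "G' \<subseteq> ?D" "G = (\<lambda>R w. R (ys @ w)) ` G'"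
      by auto
    have "dfn A (length xs) (\<lambda>x. \<exists>w. length w = length zs \<and> (\<forall>R\<in>G'. R (x @ w)))"
      using G' by (intro dfn_exs_right dfn_ball) auto
    from tpeqD[OF assms(2) this] have "\<exists>w. length w = length zs \<and> (\<forall>R\<in>G'. R (ys @ w))"
      using G'(2) by auto
    then show "\<exists>w. length w = length zs \<and> (\<forall>R\<in>G. R w)" using G'(3) by simp
  qed
  then obtain w where w: "length w = length zs" "\<forall>R\<in>(\<lambda>R w. R (ys @ w)) ` ?D. R w"
    by (elim exE conjE) (rule that)
  have "tpeq A (xs @ zs) (ys @ w)"
    using w l by (intro tpeqI[of _ "length xs + length zs"]) auto
  with w(1) show thesis by (rule that)
qed

section \<open>Coheirs and Morley sequences\<close>

text \<open>An ultrafilter on the tuples of \<open>M\<close> is a global type finitely satisfiable in \<open>M\<close>.\<close>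

definition ultra_on :: "'u set \<Rightarrow> nat \<Rightarrow> 'u list filter \<Rightarrow> bool" where
  "ultra_on M m V \<longleftrightarrow> ultra V \<and> eventually (\<lambda>c. set c \<subseteq> M \<and> length c = m) V"

lemma ultra_onD:
  assumes "ultra_on M m V"
  shows "ultra V" "eventually (\<lambda>c. set c \<subseteq> M) V" "eventually (\<lambda>c. length c = m) V"
  using assms unfolding ultra_on_def by (auto elim: eventually_mono)

definition realises :: "'u set \<Rightarrow> 'u list filter \<Rightarrow> 'u list \<Rightarrow> bool" where
  "realises B V b \<longleftrightarrow> (\<forall>R. dfn B (length b) R \<longrightarrow> (R b \<longleftrightarrow> eventually R V))"

lemma realises_mono: "realises B V b \<Longrightarrow> A \<subseteq> B \<Longrightarrow> realises A V b"
  unfolding realises_def using dfn_mono by meson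

lemma realisesD: "realises B V b \<Longrightarrow> dfn B m R \<Longrightarrow> length b = m \<Longrightarrow> R b \<longleftrightarrow> eventually R V"
  unfolding realises_def by simp

lemma realisesI:
  "ultra V \<Longrightarrow> length b = m \<Longrightarrow> (\<And>R. dfn B m R \<Longrightarrow> eventually R V \<Longrightarrow> R b) \<Longrightarrow> realises B V b"
  unfolding realises_def by (metis dfn_not ultra_not)

lemma realises_ex:
  assumes "small \<kappa> B" "ultra_on M m V" shows "\<exists>b. length b = m \<and> realises B V b"
proof -
  have V: "ultra V" "eventually (\<lambda>c. length c = m) V"
    using assms(2) unfolding ultra_on_def by (auto elim: eventually_mono)
  have "\<exists>b. length b = m \<and> (\<forall>R\<in>{R. dfn B m R \<and> eventually R V}. R b)"
  proof (rule realize[OF assms(1)])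
    fix G assume G: "finite G" "G \<subseteq> {R. dfn B m R \<and> eventually R V}"
    have "eventually (\<lambda>c. length c = m \<and> (\<forall>R\<in>G. R c)) V"
      using G V by (intro eventually_conj eventually_ball_finite) auto
    then show "\<exists>a. length a = m \<and> (\<forall>R\<in>G. R a)" using ultra_happens[OF V(1)] by auto
  qed auto
  then obtain b where "length b = m" "\<forall>R\<in>{R. dfn B m R \<and> eventually R V}. R b" by (elim exE conjE) (rule that)
  then show ?thesis by (intro exI[of _ b] conjI realisesI[OF V(1)]) auto
qed

text \<open>\<open>R\<close> is definable over \<open>B\<close> and is transferred by the type of
  \<open>b\<close>, whereas \<open>P\<close> is an arbitrary \<open>V\<close>-large predicate whose
  parameters may lie outside \<open>B\<close>. The ultrafilter combines both in one point of
  \<open>M\<close>.\<close>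

lemma realises_pull:
  assumes "realises B V b" "ultra_on M m V" "dfn B m R" "R b" "length b = m" "eventually P V"
  obtains c where "set c \<subseteq> M" "length c = m" "R c" "P c"
proof -
  have "eventually R V" using realisesD[OF assms(1,3,5)] assms(4) by simp
  then have "eventually (\<lambda>c. R c \<and> P c \<and> (set c \<subseteq> M \<and> length c = m)) V"
    using assms(6) ultra_onD[OF assms(2)] by (intro eventually_conj)
  from ultra_happens[OF ultra_onD(1)[OF assms(2)] this] show thesis using that by auto
qed

text \<open>Invariance of a type finitely satisfiable in \<open>M\<close>: as long as
  \<open>x\<close> ranges over \<open>M\<close>, the formula \<open>S\<close> cannot tell
  \<open>c\<close> from \<open>c'\<close>.\<close>

lemma ultra_on_ev_inv:
  assumes "ultra_on M m V" "M \<subseteq> B" "tpeq B c c'" "dfn B (length c + m) S"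
  shows "eventually (\<lambda>x. S (c @ x)) V \<longleftrightarrow> eventually (\<lambda>x. S (c' @ x)) V"
proof -
  have "S (c @ x) \<longleftrightarrow> S (c' @ x)" if "set x \<subseteq> M \<and> length x = m" for x
    using tpeqD[OF assms(3) dfn_inst[OF assms(4), of x]] assms(2) that by auto
  then have "eventually (\<lambda>x. S (c @ x) \<longleftrightarrow> S (c' @ x)) V"
    using assms(1) unfolding ultra_on_def by (auto elim: eventually_mono)
  then show ?thesis by (rule eventually_subst)
qed

lemma realises_tpeq:
  assumes "ultra_on M m V" "M \<subseteq> B" "tpeq B c c'" "realises (B \<union> set c) V b" "realises (B \<union> set c') V b'"
    "length b = m" "length b' = m"
  shows "tpeq B (c @ b) (c' @ b')"
proof (rule tpeqI[of _ "length c + m"])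
  fix R assume R: "dfn B (length c + m) R" "R (c @ b)"
  have l: "length c = length c'" using tpeq_length[OF assms(3)] .
  have 1: "dfn (B \<union> set c) m (\<lambda>x. R (c @ x))" "dfn (B \<union> set c') m (\<lambda>x. R (c' @ x))"
    using dfn_mono[OF R(1)] l by (auto intro!: dfn_inst1)
  show "R (c' @ b')"
    using realisesD[OF assms(4) 1(1)] realisesD[OF assms(5) 1(2)] ultra_on_ev_inv[OF assms(1-3) R(1)] assms(6,7) R(2) by blast
qed (use assms tpeq_length[OF assms(3)] in auto)

text \<open>By invariance, realising \<open>V\<close> over \<open>M\<close> and \<open>c\<close>
  depends only on the type of \<open>c @ b\<close> over \<open>M\<close>. Copies of Morley sequences
  are therefore again Morley sequences.\<close>

lemma realises_inv:
  assumes "ultra_on M m V" "realises (M \<union> set c) V b" "tpeq M (c @ b) (c' @ b')" "length c = length c'" "length b = m"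
  shows "realises (M \<union> set c') V b'"
proof -
  have l: "length b' = m" using tpeq_length[OF assms(3)] assms by simp
  have cc: "tpeq M c c'" using tpeq_append1[OF assms(3,4)] .
  show ?thesis
  proof (rule realisesI[OF _ l])
    show "ultra V" using assms(1) by (simp add: ultra_on_def)
    fix R assume R: "dfn (M \<union> set c') m R" "eventually R V"
    obtain S where S: "dfn M (length c' + m) S" "\<And>x. length x = m \<Longrightarrow> R x \<longleftrightarrow> S (c' @ x)"
      using R(1) by (rule dfn_set_params) blast
    have "eventually (\<lambda>x. R x \<and> (set x \<subseteq> M \<and> length x = m)) V"
      using R(2) ultra_onD[OF assms(1)] by (intro eventually_conj)
    then have "eventually (\<lambda>x. S (c' @ x)) V" by (rule eventually_mono) (use S(2) in auto)
    then have "eventually (\<lambda>x. S (c @ x)) V"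
      using ultra_on_ev_inv[OF assms(1) subset_refl cc] S(1) assms(4) by simp
    moreover have "dfn (M \<union> set c) m (\<lambda>x. S (c @ x))"
      using dfn_mono[OF S(1)] assms(4) by (auto intro!: dfn_inst1)
    ultimately have "S (c @ b)" using realisesD[OF assms(2)] assms(5) by blast
    then show "R b'" using tpeqD[OF assms(3) S(1)] assms(4,5) S(2)[OF l] by simp
  qed
qed

text \<open>The base absorbs the entries from the left, so a realisation of \<open>V\<close> over
  the base can be put in front of a list that is Morley over the larger base.\<close>

primrec morley_list :: "nat \<Rightarrow> 'u list filter \<Rightarrow> 'u set \<Rightarrow> 'u list list \<Rightarrow> bool" where
  "morley_list m V B [] \<longleftrightarrow> True"
| "morley_list m V B (v # vs) \<longleftrightarrow> length v = m \<and> realises B V v \<and> morley_list m V (B \<union> set v) vs"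

definition morley :: "nat \<Rightarrow> 'u list filter \<Rightarrow> 'u set \<Rightarrow> (nat \<Rightarrow> 'u list) \<Rightarrow> bool" where
  "morley m V B e \<longleftrightarrow> (\<forall>i. length (e i) = m \<and> realises (B \<union> (\<Union>j<i. set (e j))) V (e i))"

lemma morley_length: "morley m V B e \<Longrightarrow> length (e i) = m"
  by (simp add: morley_def)

lemma morley_realises: "morley m V B e \<Longrightarrow> A \<subseteq> B \<union> (\<Union>j<i. set (e j)) \<Longrightarrow> realises A V (e i)"
  unfolding morley_def using realises_mono by blast

lemma morley_ex:
  assumes "small \<kappa> B" "ultra_on M m V" shows "\<exists>e. morley m V B e"
proof -
  define ch where "ch C = (SOME b. length b = m \<and> realises C V b)" for C
  have ch: "length (ch C) = m \<and> realises C V (ch C)" if "small \<kappa> C" for C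
    unfolding ch_def using someI_ex[OF realises_ex[OF that assms(2)]] .
  define f where "f = rec_nat [] (\<lambda>_ s. s @ ch (B \<union> set s))"
  define e where "e N = ch (B \<union> set (f N))" for N
  have f: "set (f N) = (\<Union>j<N. set (e j))" for N
    by (induction N) (auto simp: f_def e_def lessThan_Suc)
  have "small \<kappa> (B \<union> set (f N))" for N using assms(1) by (intro small_Un_countable countable_finite) auto
  then show ?thesis using ch f unfolding morley_def e_def by metis
qed

lemma morley_list_mono: "morley_list m V B vs \<Longrightarrow> A \<subseteq> B \<Longrightarrow> morley_list m V A vs"
proof (induction vs arbitrary: A B)
  case (Cons v vs)
  then show ?case using realises_mono[of B V v A] Cons.IH[of "B \<union> set v" "A \<union> set v"] by auto
qed simp

lemma morley_morley_list:
  assumes "morley m V B e"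
  shows "sorted_wrt (<) is \<Longrightarrow> morley_list m V B (map e is)"
proof -
  have "sorted_wrt (<) is \<Longrightarrow> \<forall>i\<in>set is. k \<le> i \<Longrightarrow> morley_list m V (B \<union> (\<Union>j<k. set (e j))) (map e is)" for k
  proof (induction "is" arbitrary: k)
    case (Cons i "is")
    have 1: "realises (B \<union> (\<Union>j<k. set (e j))) V (e i)"
      using Cons.prems by (intro morley_realises[OF assms] Un_mono order_refl UN_mono) auto
    have "morley_list m V (B \<union> (\<Union>j<Suc i. set (e j))) (map e is)"
      using Cons.prems by (intro Cons.IH) (auto simp: Suc_le_eq)
    then have "morley_list m V (B \<union> (\<Union>j<k. set (e j)) \<union> set (e i)) (map e is)"
    proof (rule morley_list_mono)
      have "(\<Union>j<k. set (e j)) \<subseteq> (\<Union>j<Suc i. set (e j))" using Cons.prems by (intro UN_mono) auto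
      then show "B \<union> (\<Union>j<k. set (e j)) \<union> set (e i) \<subseteq> B \<union> (\<Union>j<Suc i. set (e j))" by auto
    qed
    then show ?case using 1 morley_length[OF assms] by simp
  qed simp
  from this[of 0] show "sorted_wrt (<) is \<Longrightarrow> morley_list m V B (map e is)" by simp
qed

lemma morley_list_tpeq:
  assumes "ultra_on M m V" "M \<subseteq> B"
  shows "morley_list m V (B \<union> set c) vs \<Longrightarrow> morley_list m V (B \<union> set c') ws \<Longrightarrow> length vs = length ws \<Longrightarrow>
    tpeq B c c' \<Longrightarrow> tpeq B (c @ concat vs) (c' @ concat ws)"
proof (induction vs arbitrary: ws c c')
  case (Cons v vs)
  then obtain w ws' where ws: "ws = w # ws'" by (cases ws) auto
  have "tpeq B (c @ v) (c' @ w)"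
    using Cons.prems ws by (intro realises_tpeq[OF assms]) auto
  then have "tpeq B ((c @ v) @ concat vs) ((c' @ w) @ concat ws')"
    using Cons.prems ws by (intro Cons.IH) (auto simp: Un_assoc)
  then show ?case using ws by simp
qed simp

lemma morley_indiscernible:
  assumes "ultra_on M m V" "M \<subseteq> B" "morley m V B e" shows "indiscernible L U B e"
proof (rule indiscernibleI[OF morley_length[OF assms(3)]])
  fix "is" js :: "nat list" and R
  assume *: "sorted_wrt (<) is" "sorted_wrt (<) js" "length is = length js" "dfn B (length is * m) R"
    "R (concat (map e is))"
  have "tpeq B ([] @ concat (map e is)) ([] @ concat (map e js))"
    using * morley_morley_list[OF assms(3)] by (intro morley_list_tpeq[OF assms(1,2)]) (auto intro: tpeq_refl)
  from tpeqD[OF this[simplified] *(4)] show "R (concat (map e js))"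
    using * length_concat_const[of "is" e m] morley_length[OF assms(3)] by simp
qed

section \<open>Mutually indiscernible sequences\<close>

lemma seq_elems_prefix:
  assumes "set p \<subseteq> seq_elems e" shows "\<exists>k. set p \<subseteq> set (concat (map e [0..<k]))"
proof -
  have "\<forall>z\<in>set p. \<exists>i. z \<in> set (e i)" using assms by (auto simp: seq_elems_def)
  then obtain f where f: "\<And>z. z \<in> set p \<Longrightarrow> z \<in> set (e (f z))" by metis
  obtain k where "f ` set p \<subseteq> {..<k}" using finite_nat_iff_bounded[of "f ` set p"] by auto
  then show ?thesis using f by (intro exI[of _ k]) fastforce
qed

text \<open>Increasing tuples of \<open>D\<close> of equal length have one type over
  \<open>M\<close>, and by invariance a Morley sequence over all of \<open>D\<close> prolongs each
  of them in the same way.\<close>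

lemma indiscernible_over_morley:
  assumes "ultra_on M m V" "indiscernible L U M D" "morley m V (M \<union> seq_elems D) e"
  shows "indiscernible L U (M \<union> seq_elems e) D"
proof -
  obtain l where l: "\<And>i. length (D i) = l" using assms(2) by (auto simp: indiscernible_iff)
  show ?thesis
  proof (unfold indiscernible_iff, intro conjI allI impI)
    show "\<exists>n. \<forall>i. length (D i) = n" using l by blast
    fix "is" js :: "nat list"
    assume *: "sorted_wrt (<) is \<and> sorted_wrt (<) js \<and> length is = length js"
    let ?x = "concat (map D is)" and ?y = "concat (map D js)"
    have xy: "tpeq M ?x ?y" using * assms(2) by (auto simp: indiscernible_iff)
    show "tpeq (M \<union> seq_elems e) ?x ?y"
    proof (rule tpeq_params)
      fix p assume "set p \<subseteq> seq_elems e"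
      then obtain k where k: "set p \<subseteq> set (concat (map e [0..<k]))" using seq_elems_prefix by blast
      let ?E = "concat (map e [0..<k])"
      have "morley_list m V (M \<union> seq_elems D) (map e [0..<k])" using morley_morley_list[OF assms(3)] by simp
      then have "tpeq M (?x @ ?E) (?y @ ?E)"
        using xy by (intro morley_list_tpeq[OF assms(1) subset_refl])
          (auto simp: seq_elems_def elim!: morley_list_mono)
      then have "tpeq M (?E @ ?x) (?E @ ?y)" using tpeq_length[OF xy] by (rule tpeq_swap)
      then show "tpeq M (p @ ?x) (p @ ?y)" using k tpeq_length[OF xy] by (rule tpeq_sub)
    qed
  qed
qed

lemma pick_concat_list:
  assumes "\<And>i. length (J i) = m" "\<And>i. i \<in> set is \<Longrightarrow> i < length l"
  shows "pick m is (concat (map J l)) = concat (map J (map ((!) l) is))"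
proof -
  have "map J l = map (\<lambda>i. J (l ! i)) [0..<length l]" by (rule nth_equalityI) auto
  then show ?thesis using pick_concat[of "\<lambda>i. J (l ! i)" m "is" "length l"] assms by (simp add: comp_def)
qed

lemma mutually_indiscernible:
  assumes l: "\<And>i. length (I i) = m" "\<And>i. length (J i) = m'"
    and *: "\<And>is js is' js'. sorted_wrt (<) is \<Longrightarrow> sorted_wrt (<) js \<Longrightarrow> sorted_wrt (<) is' \<Longrightarrow>
      sorted_wrt (<) js' \<Longrightarrow> length is = length is' \<Longrightarrow> length js = length js' \<Longrightarrow>
      tpeq A (concat (map I is) @ concat (map J js)) (concat (map I is') @ concat (map J js'))"
  shows "indiscernible L U (A \<union> seq_elems J) I" "indiscernible L U (A \<union> seq_elems I) J"
proof -
  show "indiscernible L U (A \<union> seq_elems J) I"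
  proof (unfold indiscernible_iff, intro conjI allI impI)
    show "\<exists>n. \<forall>i. length (I i) = n" using l by blast
    fix "is" js :: "nat list"
    assume s: "sorted_wrt (<) is \<and> sorted_wrt (<) js \<and> length is = length js"
    let ?x = "concat (map I is)" and ?y = "concat (map I js)"
    have xy: "length ?x = length ?y" using s l by (simp add: length_concat_const[of _ I m])
    show "tpeq (A \<union> seq_elems J) ?x ?y"
    proof (rule tpeq_params)
      fix p assume "set p \<subseteq> seq_elems J"
      then obtain k where k: "set p \<subseteq> set (concat (map J [0..<k]))" using seq_elems_prefix by blast
      have "tpeq A (?x @ concat (map J [0..<k])) (?y @ concat (map J [0..<k]))"
        using s by (intro *) auto
      from tpeq_swap[OF this xy] show "tpeq A (p @ ?x) (p @ ?y)" using k xy by (rule tpeq_sub)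
    qed
  qed
  show "indiscernible L U (A \<union> seq_elems I) J"
  proof (unfold indiscernible_iff, intro conjI allI impI)
    show "\<exists>n. \<forall>i. length (J i) = n" using l by blast
    fix "is" js :: "nat list"
    assume s: "sorted_wrt (<) is \<and> sorted_wrt (<) js \<and> length is = length js"
    let ?x = "concat (map J is)" and ?y = "concat (map J js)"
    have xy: "length ?x = length ?y" using s l by (simp add: length_concat_const[of _ J m'])
    show "tpeq (A \<union> seq_elems I) ?x ?y"
    proof (rule tpeq_params)
      fix p assume "set p \<subseteq> seq_elems I"
      then obtain k where k: "set p \<subseteq> set (concat (map I [0..<k]))" using seq_elems_prefix by blast
      have "tpeq A (concat (map I [0..<k]) @ ?x) (concat (map I [0..<k]) @ ?y)"
        using s by (intro *) auto
      then show "tpeq A (p @ ?x) (p @ ?y)" using k xy by (rule tpeq_sub)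
    qed
  qed
qed

lemma dfn_pick:
  assumes "dfn A (length is * m) R" "\<And>i. i \<in> set is \<Longrightarrow> i < N"
  shows "dfn A (N * m) (\<lambda>a. R (pick m is a))"
  using assms(2) by (intro dfn_slc[OF assms(1)] slc_pick)

text \<open>By compactness \<open>w\<close> can be prolonged to order type \<open>\<omega> + \<omega>\<close>, still alternating in \<open>R\<close>; \<open>I\<close> and \<open>J\<close> come
  from the two halves, which are interleaved into one sequence \<open>K\<close>.\<close>

lemma split_alternating:
  assumes A: "small \<kappa> A" and w: "\<And>i. length (w i) = m" "indiscernible L U A w"
    and R: "dfn (insert u A) m R" "\<And>i. R (w i) \<longleftrightarrow> even i"
  obtains I J where "\<And>i. length (I i) = m" "\<And>i. length (J i) = m"
    "indiscernible L U (A \<union> seq_elems J) I" "indiscernible L U (A \<union> seq_elems I) J"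
    "R (I 0)" "\<not> R (I 1)" "R (J 0)" "\<not> R (J 1)"
proof -
  \<comment> \<open>\<open>K\<close> carries \<open>I\<close> at its even places and
    \<open>J\<close> at its odd places.\<close>
  let ?ix = "\<lambda>is js. map (\<lambda>i. 2 * i) is @ map (\<lambda>i. 2 * i + 1) js"
  define \<Gamma>1 where "\<Gamma>1 = {(N, \<lambda>a. S (pick m (?ix is js) a) \<longleftrightarrow> S (pick m (?ix is' js') a)) |
     N S is js is' js'. dfn A ((length is + length js) * m) S \<and> sorted_wrt (<) is \<and> sorted_wrt (<) js \<and>
     sorted_wrt (<) is' \<and> sorted_wrt (<) js' \<and> length is = length is' \<and> length js = length js' \<and>
     set (?ix is js) \<subseteq> {..<N} \<and> set (?ix is' js') \<subseteq> {..<N}}"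
  \<comment> \<open>Since \<open>K (2 * i)\<close> is \<open>I i\<close> and
    \<open>K (2 * i + 1)\<close> is \<open>J i\<close>, the parity of \<open>i div 2\<close> makes
    both sequences alternate.\<close>
  define \<Gamma>2 where "\<Gamma>2 = {(Suc i, \<lambda>a. R (pick m [i] a) \<longleftrightarrow> even (i div 2)) | i. True}"
  have dS: "dfn (insert u A) (N * m) (\<lambda>a. S (pick m l a))"
    if "dfn A (length l * m) S" "set l \<subseteq> {..<N}" for N S l
    using that by (intro dfn_pick dfn_mono[OF that(1)]) auto
  have A': "small \<kappa> (insert u A)" using small_Un_countable[OF A, of "{u}"] by simp
  obtain K where K: "\<And>i. length (K i) = m" "\<And>N R. (N, R) \<in> \<Gamma>1 \<union> \<Gamma>2 \<Longrightarrow> R (concat (map K [0..<N]))"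
  proof (rule compact_seq[OF A', of "\<Gamma>1 \<union> \<Gamma>2" m])
    fix N Q assume "(N, Q) \<in> \<Gamma>1 \<union> \<Gamma>2"
    then show "dfn (insert u A) (N * m) Q"
    proof
      assume "(N, Q) \<in> \<Gamma>1"
      then obtain S l l' where *: "Q = (\<lambda>a. S (pick m l a) \<longleftrightarrow> S (pick m l' a))"
        "dfn A (length l * m) S" "length l = length l'" "set l \<subseteq> {..<N}" "set l' \<subseteq> {..<N}"
        unfolding \<Gamma>1_def by fastforce
      show ?thesis unfolding *(1) using * by (intro dfn_iff dS) auto
    next
      assume "(N, Q) \<in> \<Gamma>2"
      then obtain i where i: "N = Suc i" "Q = (\<lambda>a. R (pick m [i] a) \<longleftrightarrow> even (i div 2))"
        unfolding \<Gamma>2_def by blast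
      show ?thesis unfolding i using R(1) by (intro dfn_iff dfn_Const dfn_pick) auto
    qed
  next
    fix \<Delta> assume \<Delta>: "finite \<Delta>" "\<Delta> \<subseteq> \<Gamma>1 \<union> \<Gamma>2"
    obtain P where P: "fst ` \<Delta> \<subseteq> {..<P}" using finite_nat_iff_bounded[of "fst ` \<Delta>"] \<Delta>(1) by auto
    \<comment> \<open>Only finitely many places, all bounded by \<open>P\<close>, are tested. The
      part of \<open>w\<close> from \<open>2 * P\<close> on lies after all terms that
      \<open>I\<close> uses there, and the displacement is even, so the alternation keeps its
      phase.\<close>
    define K where "K i = (if even i then w (i div 2) else w (2 * P + i div 2))" for i
    have K: "length (K i) = m" for i by (simp add: K_def w)
    have Kix: "concat (map K (?ix is js)) = concat (map w (is @ map ((+) (2 * P)) js))" for "is" js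
      by (simp add: K_def comp_def)
    have "Q (concat (map K [0..<N]))" if x: "(N, Q) \<in> \<Delta>" for N Q
    proof -
      have NP: "N < P" using P x by force
      consider "(N, Q) \<in> \<Gamma>1" | "(N, Q) \<in> \<Gamma>2" using x \<Delta> by blast
      then show ?thesis
      proof cases
        case 1
        then obtain S "is" js is' js' where *:
          "Q = (\<lambda>a. S (pick m (?ix is js) a) \<longleftrightarrow> S (pick m (?ix is' js') a))"
          "dfn A ((length is + length js) * m) S" "sorted_wrt (<) is" "sorted_wrt (<) js"
          "sorted_wrt (<) is'" "sorted_wrt (<) js'" "length is = length is'" "length js = length js'"
          "set (?ix is js) \<subseteq> {..<N}" "set (?ix is' js') \<subseteq> {..<N}"
          unfolding \<Gamma>1_def by auto
        have s: "sorted_wrt (<) (k @ map ((+) (2 * P)) k')"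
          if "sorted_wrt (<) k" "sorted_wrt (<) k'" "set (?ix k k') \<subseteq> {..<N}" for k k'
          using that NP by (fastforce simp: sorted_wrt_append sorted_wrt_map)
        have "tpeq A (concat (map w (is @ map ((+) (2 * P)) js))) (concat (map w (is' @ map ((+) (2 * P)) js')))"
          using * by (intro indiscernibleD[OF w(2)] s) auto
        moreover have "length (concat (map w (is @ map ((+) (2 * P)) js))) = (length is + length js) * m"
          using length_concat_const[of "is @ map ((+) (2 * P)) js" w m] w(1) by simp
        ultimately have "S (concat (map K (?ix is js))) \<longleftrightarrow> S (concat (map K (?ix is' js')))"
          unfolding Kix using tpeqD *(2) by blast
        moreover have "pick m (?ix is js) (concat (map K [0..<N])) = concat (map K (?ix is js))"
          "pick m (?ix is' js') (concat (map K [0..<N])) = concat (map K (?ix is' js'))"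
          using K *(9,10) by (intro pick_concat; force)+
        ultimately show ?thesis unfolding *(1) by simp
      next
        case 2
        then obtain i where i: "N = Suc i" "Q = (\<lambda>a. R (pick m [i] a) \<longleftrightarrow> even (i div 2))"
          unfolding \<Gamma>2_def by blast
        have "pick m [i] (concat (map K [0..<N])) = concat (map K [i])"
          using K i by (intro pick_concat) auto
        then show ?thesis unfolding i using R(2) by (simp add: K_def i)
      qed
    qed
    then show "\<exists>K. (\<forall>i. length (K i) = m) \<and> (\<forall>(N, R)\<in>\<Delta>. R (concat (map K [0..<N])))"
      using K by (intro exI[of _ K]) auto
  qed blast
  define I where "I i = K (2 * i)" for i
  define J where "J i = K (2 * i + 1)" for i
  have KI: "concat (map K (?ix is js)) = concat (map I is) @ concat (map J js)" for "is" js
    by (simp add: I_def[abs_def] J_def[abs_def] comp_def)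
  have lI: "\<And>i. length (I i) = m" "\<And>i. length (J i) = m" by (simp_all add: I_def J_def K)
  have mut: "tpeq A (concat (map I is) @ concat (map J js)) (concat (map I is') @ concat (map J js'))"
    if s: "sorted_wrt (<) is" "sorted_wrt (<) js" "sorted_wrt (<) is'" "sorted_wrt (<) js'"
      "length is = length is'" "length js = length js'" for "is" js is' js'
  proof (rule tpeqI[of _ "(length is + length js) * m"])
    fix S assume S: "dfn A ((length is + length js) * m) S" "S (concat (map I is) @ concat (map J js))"
    obtain N where N: "set (?ix is js @ ?ix is' js') \<subseteq> {..<N}"
      using finite_nat_iff_bounded[of "set (?ix is js @ ?ix is' js')"] by auto
    have "(N, \<lambda>a. S (pick m (?ix is js) a) \<longleftrightarrow> S (pick m (?ix is' js') a)) \<in> \<Gamma>1"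
      unfolding \<Gamma>1_def
      by (rule CollectI, rule exI[of _ N], rule exI[of _ S], rule exI[of _ "is"], rule exI[of _ js],
          rule exI[of _ is'], rule exI[of _ js']) (use s S N in auto)
    then have "S (pick m (?ix is js) (concat (map K [0..<N]))) \<longleftrightarrow> S (pick m (?ix is' js') (concat (map K [0..<N])))"
      using K(2) by blast
    moreover have "pick m (?ix is js) (concat (map K [0..<N])) = concat (map K (?ix is js))"
      "pick m (?ix is' js') (concat (map K [0..<N])) = concat (map K (?ix is' js'))"
      using K(1) N by (intro pick_concat; force)+
    ultimately show "S (concat (map I is') @ concat (map J js'))" using S(2) KI by simp
  qed (use s lI in \<open>simp_all add: length_concat_const[of _ I m] length_concat_const[of _ J m] algebra_simps\<close>)
  have Ri: "R (K i) \<longleftrightarrow> even (i div 2)" for i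
  proof -
    have "(Suc i, \<lambda>a. R (pick m [i] a) \<longleftrightarrow> even (i div 2)) \<in> \<Gamma>2" unfolding \<Gamma>2_def by blast
    then have "R (pick m [i] (concat (map K [0..<Suc i]))) \<longleftrightarrow> even (i div 2)" using K(2) by blast
    moreover have "pick m [i] (concat (map K [0..<Suc i])) = concat (map K [i])"
      using K(1) by (intro pick_concat) auto
    ultimately show ?thesis by simp
  qed
  show thesis
  proof (rule that[OF lI])
    show "indiscernible L U (A \<union> seq_elems J) I" "indiscernible L U (A \<union> seq_elems I) J"
      using mutually_indiscernible[OF lI mut] by blast+
  qed (simp_all add: I_def J_def Ri)
qed

section \<open>Dividing along an indiscernible sequence\<close>

lemma pick_single: "(\<And>i. length (J i) = m) \<Longrightarrow> j < N \<Longrightarrow> pick m [j] (concat (map J [0..<N])) = J j"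
  by (subst pick_concat) auto

text \<open>Consistency of \<open>k\<close> instances is a definable property of their parameters,
  hence decided by the type of the concatenated parameters.\<close>

lemma dfn_ex_pick:
  assumes "dfn A (n + l) S"
  shows "dfn A (k * l) (\<lambda>a. \<exists>x. length x = n \<and> (\<forall>j<k. S (x @ pick l [j] a)))"
proof -
  have "dfn A (n + k * l) (\<lambda>b. \<forall>j\<in>{..<k}. S (take n b @ pick l [j] (drop n b)))"
  proof (intro dfn_ball)
    fix j assume j: "j \<in> {..<k}"
    have sp: "slc A (k * l) l (pick l [j])" using slc_pick[of "[j]" k A l] j by simp
    show "dfn A (n + k * l) (\<lambda>b. S (take n b @ pick l [j] (drop n b)))"
      by (intro dfn_slc[OF assms] slc_append slc_take slc_comp[OF slc_drop sp]) auto
  qed simp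
  from dfn_exs[OF this] show ?thesis by (simp add: Ball_def cong: conj_cong)
qed

lemma indiscernible_pairs:
  assumes "\<And>i. length (e i) = m" "indiscernible L U A e"
  shows "indiscernible L U A (\<lambda>i. e (2 * i) @ e (Suc (2 * i)))"
  unfolding indiscernible_iff
proof (intro conjI allI impI)
  show "\<exists>n. \<forall>i. length (e (2 * i) @ e (Suc (2 * i))) = n" using assms(1) by simp
  fix "is" js :: "nat list"
  assume *: "sorted_wrt (<) is \<and> sorted_wrt (<) js \<and> length is = length js"
  let ?d = "\<lambda>js :: nat list. concat (map (\<lambda>q. map ((+) (2 * q)) [0, 1]) js)"
  have e: "concat (map (\<lambda>i. e (2 * i) @ e (Suc (2 * i))) js) = concat (map e (?d js))" for js
    by (induction js) auto
  have l: "length (?d js) = 2 * length js" for js by (induction js) auto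
  have "sorted_wrt (<) (?d js)" if "sorted_wrt (<) js" for js using that by (intro sorted_blocks) auto
  then show "tpeq A (concat (map (\<lambda>i. e (2 * i) @ e (Suc (2 * i))) is))
     (concat (map (\<lambda>i. e (2 * i) @ e (Suc (2 * i))) js))"
    unfolding e using * l by (intro indiscernibleD[OF assms(2)]) auto
qed

text \<open>If no \<open>x\<close> satisfies all instances, compactness gives a \<open>k\<close>
  such that the first \<open>k\<close> of them are inconsistent, and indiscernibility transfers this
  to any \<open>k\<close> of them.\<close>

lemma divides_if_inconsistent_seq:
  assumes A: "small \<kappa> A" and c: "\<And>i. length (c i) = l" "indiscernible L U A c"
    and p: "tpeq A p (c 0)" and \<psi>: "fm_in L (n + l) \<psi>"
    and no: "\<And>x. length x = n \<Longrightarrow> \<exists>i. \<not> sat U (x @ c i) \<psi>"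
  shows "divides L U A n (\<psi>, p)"
proof -
  let ?R = "\<lambda>k a. \<exists>x. length x = n \<and> (\<forall>j<k. sat U (x @ pick l [j] a) \<psi>)"
  have dR: "dfn A (k * l) (?R k)" for k
    using dfn_ex_pick[OF dfn_fm[OF \<psi>], of A k] .
  obtain k where k: "\<not> ?R k (concat (map c [0..<k]))"
  proof (rule ccontr)
    assume "\<not> thesis"
    then have all: "?R k (concat (map c [0..<k]))" for k using that by metis
    have "\<exists>x. length x = n \<and> (\<forall>Q\<in>range (\<lambda>i x. sat U (x @ c i) \<psi>). Q x)"
    proof (rule realize)
      show "small \<kappa> (A \<union> seq_elems c)"
        using A by (intro small_Un_countable) (auto simp: seq_elems_def intro: countable_finite)
      fix Q assume "Q \<in> range (\<lambda>i x. sat U (x @ c i) \<psi>)"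
      then obtain i where "Q = (\<lambda>x. sat U (x @ c i) \<psi>)" by blast
      moreover have "dfn (A \<union> seq_elems c) n (\<lambda>x. sat U (x @ c i) \<psi>)"
        by (rule dfn_inst[OF dfn_fm[OF \<psi>]]) (auto simp: seq_elems_def c(1))
      ultimately show "dfn (A \<union> seq_elems c) n Q" by simp
    next
      fix G assume "finite G" "G \<subseteq> range (\<lambda>i x. sat U (x @ c i) \<psi>)"
      from finite_subset_image[OF this] obtain F where F: "finite F" "G = (\<lambda>i x. sat U (x @ c i) \<psi>) ` F"
        by auto
      obtain k where "F \<subseteq> {..<k}" using finite_nat_iff_bounded[of F] F(1) by auto
      obtain x where x: "length x = n" "\<And>j. j < k \<Longrightarrow> sat U (x @ pick l [j] (concat (map c [0..<k]))) \<psi>"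
        using all[of k] by blast
      have "sat U (x @ c j) \<psi>" if "j \<in> F" for j
        using x(2)[of j] pick_single[OF c(1), of j k] that \<open>F \<subseteq> {..<k}\<close> by auto
      then show "\<exists>a. length a = n \<and> (\<forall>Q\<in>G. Q a)" using x(1) F(2) by (intro exI[of _ x]) simp
    qed
    then show False using no by auto
  qed
  have "\<not> (\<exists>a. length a = n \<and> (\<forall>i\<in>S. sat U (a @ c i) \<psi>))" if S: "finite S" "card S = k" for S
  proof
    assume "\<exists>a. length a = n \<and> (\<forall>i\<in>S. sat U (a @ c i) \<psi>)"
    then obtain a where a: "length a = n" "\<And>i. i \<in> S \<Longrightarrow> sat U (a @ c i) \<psi>" by blast
    let ?s = "sorted_list_of_set S"
    have ls: "length ?s = k" using S by simp
    have "pick l [j] (concat (map c ?s)) = c (?s ! j)" if "j < k" for j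
      using that ls by (subst pick_concat_list[OF c(1)]) auto
    then have "?R k (concat (map c ?s))"
      using a ls S by (intro exI[of _ a]) (metis nth_mem set_sorted_list_of_set)
    moreover have "tpeq A (concat (map c ?s)) (concat (map c [0..<k]))"
      using ls by (intro indiscernibleD[OF c(2)]) auto
    moreover have "length (concat (map c ?s)) = k * l" using length_concat_const[of ?s c l] c(1) ls by simp
    ultimately show False using k tpeqD dR by blast
  qed
  moreover have "tpeq A p (c i)" for i
    using tpeq_trans[OF p] indiscernibleD[OF c(2), of "[0]" "[i]"] by simp
  ultimately show ?thesis unfolding divides_def by (auto simp: same_type_iff)
qed

end

section \<open>Dp-minimality implies NIP\<close>

locale dp_struct = saturated_struct L U \<kappa>
  for L :: "('f, 'r) lang" and U :: "('f, 'r, 'u) interp" and \<kappa> :: "'k rel" +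
  assumes dp: "dp_minimal L \<kappa> U" and property_D: "property_D L \<kappa> U"
begin

text \<open>The case of a single new element \<open>u\<close>. Both sequences obtained from
  \<open>w\<close> change the truth value of \<open>R\<close>, a formula over \<open>A\<close> and
  \<open>u\<close>, so neither is indiscernible over \<open>insert u A\<close>; this contradicts
  dp-minimality.\<close>

lemma no_alternation1:
  assumes "small \<kappa> A" "\<And>i. length (w i) = m" "indiscernible L U A w"
    "dfn (insert u A) m R" "\<And>i. R (w i) \<longleftrightarrow> even i"
  shows False
proof -
  obtain I J where l: "\<And>i. length (I i) = m" "\<And>i. length (J i) = m"
    and IJ: "indiscernible L U (A \<union> seq_elems J) I" "indiscernible L U (A \<union> seq_elems I) J"
    "R (I 0)" "\<not> R (I 1)" "R (J 0)" "\<not> R (J 1)"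
    using split_alternating[OF assms] by blast
  have "\<not> indiscernible L U (insert u A) H" if "R (H 0)" "\<not> R (H 1)" "length (H 0) = m" for H
    using indiscernibleD[of "insert u A" H "[0]" "[1]"] that tpeqD[OF _ assms(4)] by fastforce
  then show False using dp assms(1) IJ l unfolding dp_minimal_def by metis
qed

lemma concat_pairs:
  assumes "\<And>j. e (2 * j) @ e (Suc (2 * j)) = f j"
  shows "concat (map f [a..<a + N]) = concat (map e [2 * a..<2 * a + 2 * N])"
  by (induction N) (auto simp: assms[symmetric] algebra_simps)

text \<open>Extracting from the pairs makes the pairs \<open>(e (2j), e (2j+1))\<close> indiscernible over the first entry
  \<open>u\<close> of an alternating tuple. If the sequence of singles is not indiscernible over \<open>u\<close>, then blocks of it
  alternate over \<open>u\<close>; otherwise \<open>u\<close> becomes a parameter.\<close>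

lemma no_alternation:
  "small \<kappa> A \<Longrightarrow> (\<And>i. length (e i) = m) \<Longrightarrow> indiscernible L U A e \<Longrightarrow> dfn A (n + m) R \<Longrightarrow>
    length x = n \<Longrightarrow> (\<And>i. R (x @ e i) \<longleftrightarrow> even i) \<Longrightarrow> False"
proof (induction n arbitrary: A e R x)
  case 0
  then have R: "dfn A m R" "R (e 0)" "\<not> R (e 1)" by (auto dest: meta_spec[of _ 0] meta_spec[of _ 1])
  have "tpeq A (e 0) (e 1)" using indiscernibleD[OF 0(3), of "[0]" "[1]"] by simp
  then show False using R tpeqD 0(2) by blast
next
  case (Suc n)
  obtain u x' where x: "x = u # x'" "length x' = n" using Suc.prems(5) by (cases x) auto
  let ?B = "insert u A"
  have B: "small \<kappa> ?B" using small_Un_countable[OF Suc.prems(1), of "{u}"] by simp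
  \<comment> \<open>Extraction from single terms would lose the alternation, because an increasing
    tuple of terms may have any parities. Pairs retain it.\<close>
  define f where "f j = e (2 * j) @ e (Suc (2 * j))" for j
  obtain g where g: "\<And>i. length (g i) = 2 * m" "indiscernible L U ?B g"
    and EM: "\<And>k R is. dfn ?B (k * (2 * m)) R \<Longrightarrow>
       (\<And>js. sorted_wrt (<) js \<Longrightarrow> length js = k \<Longrightarrow> R (concat (map f js))) \<Longrightarrow>
       sorted_wrt (<) is \<Longrightarrow> length is = k \<Longrightarrow> R (concat (map g is))"
    by (rule extract_indiscernible[OF B, of f "2 * m"]) (auto simp: f_def Suc.prems(2))
  define e' where "e' i = (if even i then take m (g (i div 2)) else drop m (g (i div 2)))" for i
  have e': "length (e' i) = m" for i by (simp add: e'_def g(1))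
  have ge: "concat (map g [a..<a + N]) = concat (map e' [2 * a..<2 * a + 2 * N])" for a N
    by (rule concat_pairs) (simp add: e'_def)
  define dbl where "dbl js = concat (map (\<lambda>q. map ((+) (2 * q)) [0, 1]) js)" for js :: "nat list"
  have dbl: "sorted_wrt (<) (dbl js)" if "sorted_wrt (<) js" for js
    unfolding dbl_def using that by (intro sorted_blocks) auto
  have ldbl: "length (dbl js) = 2 * length js" for js by (induction js) (auto simp: dbl_def)
  have pdbl: "even (dbl js ! i) \<longleftrightarrow> even i" if "i < 2 * length js" for js i
    using that
  proof (induction js arbitrary: i)
    case (Cons q js)
    consider "i = 0" | "i = 1" | j where "i = Suc (Suc j)" by (metis One_nat_def not0_implies_Suc)
    then show ?case using Cons by cases (auto simp: dbl_def)
  qed simp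
  have fe: "concat (map f js) = concat (map e (dbl js))" for js
    by (induction js) (auto simp: dbl_def f_def)
  have pick_e: "pick m is (concat (map f js)) = concat (map e (map ((!) (dbl js)) is))"
    if "set is \<subseteq> {..<2 * length js}" for "is" js
    unfolding fe using that by (intro pick_concat_list Suc.prems(2)) (auto simp: ldbl)
  have pick_g: "pick m is (concat (map g [a..<a + N])) = concat (map e' (map ((+) (2 * a)) is))"
    if "set is \<subseteq> {..<2 * N}" for "is" a N
  proof -
    have "pick m is (concat (map g [a..<a + N])) = concat (map e' (map ((!) [2 * a..<2 * a + 2 * N]) is))"
      unfolding ge using that by (intro pick_concat_list e') auto
    moreover have "map ((!) [2 * a..<2 * a + 2 * N]) is = map ((+) (2 * a)) is" using that by auto
    ultimately show ?thesis by simp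
  qed
  have pick_g0: "pick m is (concat (map g [0..<N])) = concat (map e' is)" if "set is \<subseteq> {..<2 * N}" for "is" N
  proof -
    have "map ((+) (2 * 0)) is = is" by (rule map_idI) simp
    then show ?thesis using pick_g[OF that, of 0] by (simp del: map_map)
  qed
  have bound: "\<exists>N. set is \<subseteq> {..<2 * N}" for "is" :: "nat list"
  proof -
    obtain N where "set is \<subseteq> {..<N}" using finite_nat_iff_bounded[of "set is"] by auto
    then have "set is \<subseteq> {..<2 * N}" by auto
    then show ?thesis by blast
  qed
  have dp': "dfn C (N * (2 * m)) (\<lambda>a. S (pick m is a))"
    if "dfn C (length is * m) S" "set is \<subseteq> {..<2 * N}" for C N S "is"
    using dfn_pick[OF that(1), of "2 * N"] that(2) by (auto simp: ac_simps)
  \<comment> \<open>Indiscernibility over \<open>A\<close> is a statement about all increasing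
    tuples of \<open>e\<close> and so passes to \<open>e'\<close>. Over \<open>u\<close> it is only
    known for the pairs.\<close>
  have ind: "indiscernible L U A e'"
  proof (rule indiscernibleI[OF e'])
    fix "is" js :: "nat list" and S
    assume *: "sorted_wrt (<) is" "sorted_wrt (<) js" "length is = length js" "dfn A (length is * m) S"
      "S (concat (map e' is))"
    obtain N where N: "set (is @ js) \<subseteq> {..<2 * N}" using bound by blast
    let ?Q = "\<lambda>a. S (pick m is a) \<longleftrightarrow> S (pick m js a)"
    have "dfn ?B (length is * m) S" using dfn_mono[OF *(4)] by auto
    then have "dfn ?B (N * (2 * m)) ?Q" using * N by (intro dfn_iff dp') auto
    then have "?Q (concat (map g [0..<N]))"
    proof (rule EM)
      fix ks :: "nat list" assume k: "sorted_wrt (<) ks" "length ks = N"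
      have s: "sorted_wrt (<) (map ((!) (dbl ks)) l)" if "sorted_wrt (<) l" "set l \<subseteq> {..<2 * N}" for l
        using that dbl[OF k(1)] k(2) ldbl[of ks]
        by (auto simp: sorted_wrt_map sorted_wrt_iff_nth_less subset_iff)
      have "tpeq A (concat (map e (map ((!) (dbl ks)) is))) (concat (map e (map ((!) (dbl ks)) js)))"
        using * N s by (intro indiscernibleD[OF Suc.prems(3)]) auto
      moreover have "length (concat (map e (map ((!) (dbl ks)) is))) = length is * m"
        using length_concat_const[of "map ((!) (dbl ks)) is" e m] Suc.prems(2) by simp
      ultimately have "S (concat (map e (map ((!) (dbl ks)) is))) \<longleftrightarrow> S (concat (map e (map ((!) (dbl ks)) js)))"
        using tpeqD *(4) by blast
      then show "?Q (concat (map f ks))" using pick_e[of "is" ks] pick_e[of js ks] N k(2) by simp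
    qed auto
    then show "S (concat (map e' js))" using pick_g0[of "is" N] pick_g0[of js N] N *(5) by simp
  qed
  \<comment> \<open>The rest \<open>x'\<close> of the tuple is not retained. What passes through the
    extraction is the formula over \<open>A\<close> and \<open>u\<close> saying that some
    \<open>y\<close> alternates along the first \<open>N\<close> pairs.\<close>
  have "\<exists>y. length y = n \<and> (\<forall>Q\<in>range (\<lambda>i y. R (u # y @ e' i) \<longleftrightarrow> even i). Q y)"
  proof (rule realize)
    show "small \<kappa> (?B \<union> seq_elems e')" using B by (intro small_Un_countable) (auto simp: seq_elems_def intro: countable_finite)
    fix Q assume "Q \<in> range (\<lambda>i y. R (u # y @ e' i) \<longleftrightarrow> even i)"
    then obtain i where i: "Q = (\<lambda>y. R (u # y @ e' i) \<longleftrightarrow> even i)" by blast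
    have "slc (?B \<union> seq_elems e') n (length [u] + (n + length (e' i))) (\<lambda>y. [u] @ y @ e' i)"
      by (intro slc_append slc_const slc_id) (auto simp: seq_elems_def)
    then have "dfn (?B \<union> seq_elems e') n (\<lambda>y. R ([u] @ y @ e' i))"
      using e' by (intro dfn_slc[OF dfn_mono[OF Suc.prems(4)]]) auto
    then show "dfn (?B \<union> seq_elems e') n Q" unfolding i by (intro dfn_iff dfn_Const) simp
  next
    fix G assume "finite G" "G \<subseteq> range (\<lambda>i y. R (u # y @ e' i) \<longleftrightarrow> even i)"
    from finite_subset_image[OF this]
    obtain F where F: "finite F" "G = (\<lambda>i y. R (u # y @ e' i) \<longleftrightarrow> even i) ` F" by auto
    obtain N where "F \<subseteq> {..<N}" using finite_nat_iff_bounded[of F] F(1) by auto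
    then have N: "F \<subseteq> {..<2 * N}" by auto
    let ?Q = "\<lambda>a. \<exists>y. length y = n \<and> (\<forall>i\<in>{..<2 * N}. R (u # y @ pick m [i] a) \<longleftrightarrow> even i)"
    have "dfn ?B (n + N * (2 * m)) (\<lambda>b. \<forall>i\<in>{..<2 * N}. R (u # take n b @ pick m [i] (drop n b)) \<longleftrightarrow> even i)"
    proof (intro dfn_ball dfn_iff dfn_Const)
      fix i assume i: "i \<in> {..<2 * N}"
      have sp: "slc ?B (N * (2 * m)) (length [i] * m) (pick m [i])"
        using slc_pick[of "[i]" "2 * N" ?B m] i by (simp add: ac_simps)
      have "slc ?B (n + N * (2 * m)) (length [u] + (n + length [i] * m))
        (\<lambda>b. [u] @ take n b @ pick m [i] (drop n b))"
        by (intro slc_append slc_const slc_take slc_comp[OF slc_drop sp]) auto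
      then have "slc ?B (n + N * (2 * m)) (Suc n + m) (\<lambda>b. [u] @ take n b @ pick m [i] (drop n b))" by simp
      from dfn_slc[OF dfn_mono[OF Suc.prems(4)] this]
      show "dfn ?B (n + N * (2 * m)) (\<lambda>b. R (u # take n b @ pick m [i] (drop n b)))" by auto
    qed simp
    from dfn_exs[OF this] have "dfn ?B (N * (2 * m)) ?Q" by (simp cong: conj_cong)
    then have "?Q (concat (map g [0..<N]))"
    proof (rule EM)
      fix ks :: "nat list" assume k: "sorted_wrt (<) ks" "length ks = N"
      have "R (u # x' @ pick m [i] (concat (map f ks))) \<longleftrightarrow> even i" if "i < 2 * N" for i
        using pick_e[of "[i]" ks] that k(2) Suc.prems(6)[of "dbl ks ! i"] pdbl[of i ks] x by simp
      then show "?Q (concat (map f ks))" using x(2) by auto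
    qed auto
    then obtain y where y: "length y = n" "\<And>i. i < 2 * N \<Longrightarrow> R (u # y @ pick m [i] (concat (map g [0..<N]))) \<longleftrightarrow> even i"
      by auto
    have "R (u # y @ e' i) \<longleftrightarrow> even i" if "i \<in> F" for i
      using y(2)[of i] pick_g0[of "[i]" N] that N by auto
    then show "\<exists>y. length y = n \<and> (\<forall>Q\<in>G. Q y)" using y(1) F(2) by auto
  qed
  then obtain y where y: "length y = n" "\<And>i. R (u # y @ e' i) \<longleftrightarrow> even i" by auto
  show False
  proof (cases "indiscernible L U ?B e'")
    case True
    have "dfn ?B (n + m) (\<lambda>a. R ([u] @ a))"
      using dfn_mono[OF Suc.prems(4), of ?B] by (intro dfn_inst1[of _ 1]) auto
    from Suc.IH[OF B e' True this y(1)] show False using y(2) by simp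
  next
    case False
    have "\<exists>is js S. sorted_wrt (<) is \<and> sorted_wrt (<) js \<and> length is = length js \<and>
      dfn ?B (length is * m) S \<and> S (concat (map e' is)) \<and> \<not> S (concat (map e' js))"
    proof (rule ccontr)
      assume c: "\<not> ?thesis"
      have "indiscernible L U ?B e'"
      proof (rule indiscernibleI[OF e'], rule ccontr)
        fix "is" js :: "nat list" and S
        assume "sorted_wrt (<) is" "sorted_wrt (<) js" "length is = length js"
          "dfn ?B (length is * m) S" "S (concat (map e' is))" "\<not> S (concat (map e' js))"
        then show False
          by - (rule notE[OF c], rule exI[of _ "is"], rule exI[of _ js], rule exI[of _ S], intro conjI)
      qed
      with False show False ..
    qed
    then obtain "is" js S where *: "sorted_wrt (<) is" "sorted_wrt (<) js" "length is = length js"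
      "dfn ?B (length is * m) S" "S (concat (map e' is))" "\<not> S (concat (map e' js))"
      by (elim exE conjE) (rule that)
    obtain N where N: "set (is @ js) \<subseteq> {..<2 * N}" using bound by blast
    let ?h = "\<lambda>q. if even q then is else js"
    \<comment> \<open>\<open>N\<close> pairs are enough to contain both index lists. Block
      \<open>q\<close> is displaced by \<open>N * q\<close> pairs, so the blocks follow one another
      without overlap, and the parity of \<open>q\<close> selects the list on which \<open>S\<close>
      holds or fails.\<close>
    define w where "w q = concat (map e' (map ((+) (2 * (N * q))) (?h q)))" for q
    have lw: "length (w q) = length is * m" for q
      using length_concat_const[of "map ((+) (2 * (N * q))) (?h q)" e' m] e' *(3)
      by (cases "even q") (simp_all add: w_def del: map_map)
    \<comment> \<open>A displacement by whole pairs does not change \<open>S\<close>, since the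
      pairs are indiscernible over \<open>A\<close> and \<open>u\<close>.\<close>
    have S_shift: "S (concat (map e' (map ((+) (2 * (N * q))) l))) \<longleftrightarrow> S (concat (map e' l))"
      if "length l = length is" "set l \<subseteq> {..<2 * N}" for l q
    proof -
      have "tpeq ?B (concat (map g [N * q..<N * q + N])) (concat (map g [0..<0 + N]))"
        by (intro indiscernibleD[OF g(2)]) auto
      moreover have "length (concat (map g [N * q..<N * q + N])) = N * (2 * m)"
        using length_concat_const[of "[N * q..<N * q + N]" g "2 * m"] g(1) by simp
      moreover have "dfn ?B (N * (2 * m)) (\<lambda>a. S (pick m l a))" using dp' *(4) that by simp
      ultimately have "S (pick m l (concat (map g [N * q..<N * q + N]))) \<longleftrightarrow>
          S (pick m l (concat (map g [0..<0 + N])))" using tpeqD by blast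
      then show ?thesis using pick_g[OF that(2), of "N * q"] pick_g0[OF that(2)] by simp
    qed
    have ind_w: "indiscernible L U A w"
    proof (rule indiscernibleI[OF lw])
      fix ps qs :: "nat list" and Q
      assume **: "sorted_wrt (<) ps" "sorted_wrt (<) qs" "length ps = length qs"
        "dfn A (length ps * (length is * m)) Q" "Q (concat (map w ps))"
      let ?ix = "\<lambda>ps. concat (map (\<lambda>q. map ((+) (2 * N * q)) (?h q)) ps)"
      have ix: "concat (map w ps) = concat (map e' (?ix ps))" for ps
        by (induction ps) (auto simp: w_def mult.assoc)
      have "sorted_wrt (<) (?ix ps)" if "sorted_wrt (<) ps" for ps
        using that * N by (intro sorted_blocks) (auto split: if_splits)
      moreover have "length (?ix ps) = length ps * length is" for ps
        using *(3) by (induction ps) auto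
      ultimately have "tpeq A (concat (map w ps)) (concat (map w qs))"
        unfolding ix using ** by (intro indiscernibleD[OF ind]) auto
      moreover have "length (concat (map w ps)) = length ps * (length is * m)"
        using length_concat_const[of ps w "length is * m"] lw by simp
      ultimately show "Q (concat (map w qs))" using tpeqD **(4,5) by blast
    qed
    have "S (w q) \<longleftrightarrow> even q" for q
      using S_shift[of "?h q" q] * N by (simp add: w_def)
    from no_alternation1[where w = w and R = S, OF Suc.prems(1) lw ind_w *(4) this] show False .
  qed
qed

end

section \<open>Non-forking formulas\<close>

locale dp_model = dp_struct L U \<kappa>
  for L :: "('f, 'r) lang" and U :: "('f, 'r, 'u) interp" and \<kappa> :: "'k rel" +
  fixes M :: "'u set"
  assumes elem: "elementary_submodel L U M" and small_M: "small \<kappa> M"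
begin

section \<open>Elementarity and the existence of coheirs\<close>

lemma small_M_Un: "countable C \<Longrightarrow> small \<kappa> (M \<union> C)"
  using small_Un_countable[OF small_M] .

text \<open>The first coordinate is quantified out and the others are found in \<open>M\<close> by
  induction; elementarity then supplies the first one.\<close>

lemma witness_in_M:
  "dfn M n R \<Longrightarrow> length a = n \<Longrightarrow> R a \<Longrightarrow> \<exists>c. set c \<subseteq> M \<and> length c = n \<and> R c"
proof (induction n arbitrary: R a)
  case 0
  then show ?case by auto
next
  case (Suc n)
  obtain u a' where a: "a = u # a'" "length a' = n" using Suc.prems(2) by (cases a) auto
  have "\<exists>u. R (u # a')" using Suc.prems(3) a(1) by blast
  from Suc.IH[OF dfn_ex[OF Suc.prems(1)] a(2) this]
  obtain c u where c: "set c \<subseteq> M" "length c = n" "R (u # c)" by blast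
  have "dfn M 1 (\<lambda>l. R (l @ c))" using Suc.prems(1) c by (intro dfn_inst) auto
  then obtain \<psi> b where \<psi>: "b \<in> lists M" "fm_in L (1 + length b) \<psi>"
    "\<And>a. length a = 1 \<Longrightarrow> R (a @ c) \<longleftrightarrow> sat U (a @ b) \<psi>" unfolding dfn_def by blast
  have "sat U b (Ex \<psi>)" using \<psi>(3)[of "[u]"] c(3) by auto
  moreover have "fm_in L (length b) (Ex \<psi>)" using \<psi>(2) by simp
  ultimately have "sat_in U M b (Ex \<psi>)" using elem \<psi>(1) unfolding elementary_submodel_def by blast
  then obtain v where v: "v \<in> M" "sat_in U M (v # b) \<psi>" by auto
  then have "sat U (v # b) \<psi>"
    using elem \<psi>(1,2) unfolding elementary_submodel_def by auto
  then show ?case using \<psi>(3)[of "[v]"] c v by (intro exI[of _ "v # c"]) auto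
qed

lemma all_in_M:
  assumes "dfn M n R" "\<And>c. set c \<subseteq> M \<Longrightarrow> length c = n \<Longrightarrow> R c" "length a = n" shows "R a"
  using witness_in_M[OF dfn_not[OF assms(1)] assms(3)] assms(2) by blast

definition coheir :: "'u list \<Rightarrow> 'u list filter \<Rightarrow> bool" where
  "coheir d V \<longleftrightarrow> ultra_on M (length d) V \<and> (\<forall>\<theta>. dfn M (length d) \<theta> \<longrightarrow> (eventually \<theta> V \<longleftrightarrow> \<theta> d))"

text \<open>The members of \<open>F\<close> may have parameters outside \<open>M\<close>. A coheir
  can be made to contain all of them as soon as any finitely many are satisfiable in
  \<open>M\<close> together with each formula of the type of \<open>d\<close>.\<close>

lemma coheir_ex_family:
  assumes "\<And>\<theta> G. dfn M (length d) \<theta> \<Longrightarrow> \<theta> d \<Longrightarrow> finite G \<Longrightarrow> G \<subseteq> F \<Longrightarrow>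
    \<exists>c. set c \<subseteq> M \<and> length c = length d \<and> \<theta> c \<and> (\<forall>P\<in>G. P c)"
  shows "\<exists>V. coheir d V \<and> (\<forall>P\<in>F. eventually P V)"
proof -
  let ?D = "{\<theta>. dfn M (length d) \<theta> \<and> \<theta> d}"
  define g where "g \<theta> c \<longleftrightarrow> set c \<subseteq> M \<and> length c = length d \<and> \<theta> c" for \<theta> :: "'u list \<Rightarrow> bool" and c
  have fip: "\<exists>c. \<forall>Q\<in>G. Q c" if G: "finite G" "G \<subseteq> g ` ?D \<union> F" for G
  proof -
    have "finite (G \<inter> g ` ?D)" "G \<inter> g ` ?D \<subseteq> g ` ?D" using G(1) by auto
    from finite_subset_image[OF this] obtain H where H: "H \<subseteq> ?D" "finite H" "G \<inter> g ` ?D = g ` H" by auto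
    have "dfn M (length d) (\<lambda>c. \<forall>\<theta>\<in>H. \<theta> c)" using H by (intro dfn_ball) auto
    moreover have "\<forall>\<theta>\<in>H. \<theta> d" using H(1) by auto
    moreover have "finite (G \<inter> F)" "G \<inter> F \<subseteq> F" using G(1) by auto
    ultimately obtain c where c: "set c \<subseteq> M" "length c = length d" "\<forall>\<theta>\<in>H. \<theta> c" "\<forall>P\<in>G \<inter> F. P c"
      using assms[of "\<lambda>c. \<forall>\<theta>\<in>H. \<theta> c" "G \<inter> F"] by auto
    have "g \<theta> c" if "\<theta> \<in> H" for \<theta> using c(1,2) bspec[OF c(3) that] by (simp add: g_def)
    then have "\<forall>Q\<in>G \<inter> g ` ?D. Q c" unfolding H(3) by simp
    then have "\<forall>Q\<in>G. Q c" using c(4) G(2) by blast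
    then show ?thesis ..
  qed
  have "\<exists>V. ultra V \<and> (\<forall>Q\<in>g ` ?D \<union> F. eventually Q V)" by (rule ultra_filter_ex) (rule fip)
  then obtain V where V: "ultra V" "\<forall>Q\<in>g ` ?D \<union> F. eventually Q V" by (elim exE conjE) (rule that)
  have *: "eventually (g \<theta>) V" if "dfn M (length d) \<theta>" "\<theta> d" for \<theta> using that by (intro bspec[OF V(2)]) simp
  have "eventually \<theta> V" if "dfn M (length d) \<theta>" "\<theta> d" for \<theta>
    by (rule eventually_mono[OF *[OF that]]) (auto simp: g_def)
  then have "eventually \<theta> V \<longleftrightarrow> \<theta> d" if "dfn M (length d) \<theta>" for \<theta>
    using that dfn_not[OF that] ultra_not[OF V(1), of \<theta>] by blast
  moreover have "eventually (\<lambda>c. set c \<subseteq> M \<and> length c = length d) V"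
    using *[OF dfn_True] by (auto simp: g_def elim!: eventually_mono)
  moreover have "\<forall>P\<in>F. eventually P V" using V(2) by simp
  ultimately show ?thesis using V(1) by (intro exI[of _ V]) (simp add: coheir_def ultra_on_def)
qed

lemma coheir_ex:
  assumes "\<And>\<theta>. dfn M (length d) \<theta> \<Longrightarrow> \<theta> d \<Longrightarrow> \<exists>c. set c \<subseteq> M \<and> length c = length d \<and> \<theta> c \<and> P c"
  shows "\<exists>V. coheir d V \<and> eventually P V"
proof -
  have "\<exists>V. coheir d V \<and> (\<forall>Q\<in>{P}. eventually Q V)"
  proof (rule coheir_ex_family)
    fix \<theta> G assume "dfn M (length d) \<theta>" "\<theta> d" "G \<subseteq> {P}"
    with assms show "\<exists>c. set c \<subseteq> M \<and> length c = length d \<and> \<theta> c \<and> (\<forall>P\<in>G. P c)" by fast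
  qed
  then show ?thesis by simp
qed

lemma coheir_ex': obtains V where "coheir d V"
proof -
  have "\<exists>V. coheir d V \<and> (\<forall>Q\<in>{}. eventually Q V)"
  proof (rule coheir_ex_family)
    fix \<theta> and G :: "('u list \<Rightarrow> bool) set" assume "dfn M (length d) \<theta>" "\<theta> d" "G \<subseteq> {}"
    from witness_in_M[OF this(1) refl this(2)] this(3)
    show "\<exists>c. set c \<subseteq> M \<and> length c = length d \<and> \<theta> c \<and> (\<forall>P\<in>G. P c)" by simp
  qed
  then show thesis using that by blast
qed

lemma coheir_realises: "coheir d V \<Longrightarrow> realises M V b \<Longrightarrow> length b = length d \<Longrightarrow> tpeq M d b"
  unfolding coheir_def realises_def tpeq_def by metis

lemma coheir_tpeq:
  assumes "coheir d V" "tpeq M d d'" shows "coheir d' V"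
  using assms tpeq_length[OF assms(2)] unfolding coheir_def tpeq_def by metis

section \<open>From non-forking to consistency of the conjugates\<close>

definition conjugates_consistent :: "nat \<Rightarrow> ('u list \<Rightarrow> bool) \<Rightarrow> 'u list \<Rightarrow> bool" where
  "conjugates_consistent n R d \<longleftrightarrow>
     (\<forall>D. finite D \<longrightarrow> (\<forall>e\<in>D. tpeq M d e) \<longrightarrow> (\<exists>x. length x = n \<and> (\<forall>e\<in>D. R (x @ e))))"

text \<open>If the conjugates \<open>\<phi>(x;e)\<close>, \<open>e \<in> D\<close>, are inconsistent, then \<open>\<phi>(x;d)\<close> implies one of
  \<open>\<phi>(x;d) \<and> \<not> \<phi>(x;c)\<close> and \<open>\<phi>(x;c) \<and> \<not> \<phi>(x;e)\<close>. For \<open>c\<close> realising a coheir of the type of \<open>d\<close> over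
  everything, both \<open>(d,c)\<close> and \<open>(e,c)\<close> start an indiscernible sequence, so these divide.\<close>

lemma conjugates_consistent_if_not_forks:
  assumes nf: "\<not> forks L U M n (\<phi>, d)" and \<phi>: "fm_in L (n + length d) \<phi>"
  shows "conjugates_consistent n (\<lambda>a. sat U a \<phi>) d"
proof (rule ccontr)
  assume "\<not> ?thesis"
  then obtain D where D: "finite D" "\<And>e. e \<in> D \<Longrightarrow> tpeq M d e"
    "\<And>x. length x = n \<Longrightarrow> \<exists>e\<in>D. \<not> sat U (x @ e) \<phi>"
    unfolding conjugates_consistent_def by blast
  let ?m = "length d"
  obtain V where V: "coheir d V" by (rule coheir_ex')
  have ultra_on: "ultra_on M ?m V" using V by (simp add: coheir_def)
  \<comment> \<open>Taking \<open>c\<close> over all the conjugates together makes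
    \<open>d' @ c\<close> have the same type over \<open>M\<close> for \<open>d' = d\<close> and for
    every \<open>d' \<in> D\<close>.\<close>
  let ?B = "M \<union> (set d \<union> (\<Union>e\<in>D. set e))"
  have "small \<kappa> ?B" using D(1) by (intro small_M_Un countable_finite) auto
  from realises_ex[OF this ultra_on] obtain c where c: "length c = ?m" "realises ?B V c" by blast
  obtain e where e: "morley ?m V M e" using morley_ex[OF small_M ultra_on] by blast
  have le: "length (e i) = ?m" for i using morley_length[OF e] .
  have ind: "indiscernible L U M e" using morley_indiscernible[OF ultra_on subset_refl e] .
  have pair: "tpeq M (d' @ c) (e 0 @ e 1)" if "d' \<in> insert d D" for d'
  proof (rule realises_tpeq[OF ultra_on subset_refl])
    have "tpeq M d (e 0)" using coheir_realises[OF V morley_realises[OF e]] le by blast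
    then show "tpeq M d' (e 0)" using that D(2) tpeq_refl tpeq_sym tpeq_trans by blast
    show "realises (M \<union> set d') V c" using that by (intro realises_mono[OF c(2)]) auto
    show "realises (M \<union> set (e 0)) V (e 1)" by (rule morley_realises[OF e]) auto
  qed (use c le in auto)
  have d1: "dfn {} (n + (?m + ?m)) (\<lambda>a. sat U (take (n + ?m) a) \<phi>)"
    by (intro dfn_slc[OF dfn_fm[OF \<phi>]] slc_take) simp
  have d2: "dfn {} (n + (?m + ?m)) (\<lambda>a. sat U (take n a @ drop (n + ?m) a) \<phi>)"
    by (intro dfn_slc[OF dfn_fm[OF \<phi>]] slc_append slc_take slc_drop) simp_all
  obtain \<psi>1 where \<psi>1: "fm_in L (n + (?m + ?m)) \<psi>1" "\<And>a. length a = n + (?m + ?m) \<Longrightarrow>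
     (sat U (take (n + ?m) a) \<phi> \<and> \<not> sat U (take n a @ drop (n + ?m) a) \<phi>) \<longleftrightarrow> sat U a \<psi>1"
    using dfn_empty_fm[OF dfn_conj[OF d1 dfn_not[OF d2]]] by blast
  obtain \<psi>2 where \<psi>2: "fm_in L (n + (?m + ?m)) \<psi>2" "\<And>a. length a = n + (?m + ?m) \<Longrightarrow>
     (\<not> sat U (take (n + ?m) a) \<phi> \<and> sat U (take n a @ drop (n + ?m) a) \<phi>) \<longleftrightarrow> sat U a \<psi>2"
    using dfn_empty_fm[OF dfn_conj[OF dfn_not[OF d1] d2]] by blast
  have s1: "sat U (x @ y @ z) \<psi>1 \<longleftrightarrow> sat U (x @ y) \<phi> \<and> \<not> sat U (x @ z) \<phi>"
    and s2: "sat U (x @ y @ z) \<psi>2 \<longleftrightarrow> \<not> sat U (x @ y) \<phi> \<and> sat U (x @ z) \<phi>"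
    if "length x = n" "length y = ?m" "length z = ?m" for x y z
    using \<psi>1(2)[of "x @ y @ z"] \<psi>2(2)[of "x @ y @ z"] that by auto
  \<comment> \<open>If \<open>\<psi>1\<close> held along all these consecutive pairs,
    \<open>\<phi>\<close> would alternate along \<open>e\<close>; if \<open>\<psi>2\<close> did, its
    negation would.\<close>
  define f where "f i = e (2 * i) @ e (Suc (2 * i))" for i
  have f: "length (f i) = ?m + ?m" for i by (simp add: f_def le)
  have fi: "indiscernible L U M f"
    unfolding f_def[abs_def] by (rule indiscernible_pairs[OF le ind])
  have step: "P i \<longleftrightarrow> even i" if "\<And>i. P (2 * i) \<and> \<not> P (Suc (2 * i))" for P :: "nat \<Rightarrow> bool" and i
    using that[of "i div 2"] by (cases "even i") (auto elim: oddE)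
  have dphi: "dfn M (n + ?m) (\<lambda>a. sat U a \<phi>)" using dfn_fm[OF \<phi>] .
  have no1: "\<exists>i. \<not> sat U (x @ f i) \<psi>1" if x: "length x = n" for x
  proof (rule ccontr)
    assume "\<not> ?thesis"
    then have "sat U (x @ e i) \<phi> \<longleftrightarrow> even i" for i
      using s1[OF x le le] by (intro step) (simp add: f_def)
    from no_alternation[OF small_M le ind dphi x this] show False .
  qed
  have no2: "\<exists>i. \<not> sat U (x @ f i) \<psi>2" if x: "length x = n" for x
  proof (rule ccontr)
    assume "\<not> ?thesis"
    then have "\<not> sat U (x @ e i) \<phi> \<longleftrightarrow> even i" for i
      using s2[OF x le le] by (intro step) (simp add: f_def)
    from no_alternation[OF small_M le ind dfn_not[OF dphi] x this] show False .
  qed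
  have div: "divides L U M n (\<psi>, d' @ c)"
    if "d' \<in> insert d D" "fm_in L (n + (?m + ?m)) \<psi>" "\<And>x. length x = n \<Longrightarrow> \<exists>i. \<not> sat U (x @ f i) \<psi>" for \<psi> d'
    using pair[OF that(1)] that(2,3) by (intro divides_if_inconsistent_seq[OF small_M f fi]) (auto simp: f_def)
  define \<Delta> where "\<Delta> = insert (\<psi>1, d @ c) ((\<lambda>e. (\<psi>2, e @ c)) ` D)"
  have lD: "length e = ?m" if "e \<in> D" for e using tpeq_length[OF D(2)[OF that]] by simp
  have "forks L U M n (\<phi>, d)" unfolding forks_def split
  proof (intro exI[of _ \<Delta>] conjI ballI allI impI)
    show "finite \<Delta>" using D(1) by (simp add: \<Delta>_def)
    show "\<Delta> \<subseteq> param_fms L n UNIV" using \<psi>1(1) \<psi>2(1) c(1) lD by (auto simp: \<Delta>_def param_fms_def)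
    show "divides L U M n \<delta>" if "\<delta> \<in> \<Delta>" for \<delta>
      using that div[OF _ \<psi>1(1) no1] div[OF _ \<psi>2(1) no2] by (auto simp: \<Delta>_def)
    fix a assume a: "length a = n \<and> sat U (a @ d) \<phi>"
    show "\<exists>(\<psi>, c)\<in>\<Delta>. sat U (a @ c) \<psi>"
    proof (cases "sat U (a @ c) \<phi>")
      case False
      then have "sat U (a @ d @ c) \<psi>1" using a s1 c(1) by blast
      then show ?thesis by (auto simp: \<Delta>_def)
    next
      case True
      obtain e where e: "e \<in> D" "\<not> sat U (a @ e) \<phi>" using D(3) a by blast
      then have "sat U (a @ e @ c) \<psi>2" using True a s2 c(1) lD by blast
      then show ?thesis using e(1) by (auto simp: \<Delta>_def)
    qed
  qed
  then show False using nf by blast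
qed

lemma morley_list_inv:
  assumes "ultra_on M m V"
  shows "morley_list m V (M \<union> set c) vs \<Longrightarrow> tpeq M (c @ concat vs) (c' @ concat ws) \<Longrightarrow> length c = length c' \<Longrightarrow>
    length vs = length ws \<Longrightarrow> (\<And>w. w \<in> set ws \<Longrightarrow> length w = m) \<Longrightarrow> morley_list m V (M \<union> set c') ws"
proof (induction vs arbitrary: ws c c')
  case (Cons v vs)
  then obtain w ws' where ws: "ws = w # ws'" by (cases ws) auto
  have l: "length v = m" "length w = m" using Cons.prems(1,5) ws by auto
  have t: "tpeq M ((c @ v) @ concat vs) ((c' @ w) @ concat ws')" using Cons.prems(2) ws by simp
  have "morley_list m V (M \<union> set (c' @ w)) ws'"
  proof (rule Cons.IH[OF _ t])
    show "morley_list m V (M \<union> set (c @ v)) vs" using Cons.prems(1) by (simp add: Un_assoc)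
  qed (use Cons.prems(3-5) ws l in auto)
  moreover have "realises (M \<union> set c') V w"
  proof (rule realises_inv[OF assms])
    show "tpeq M (c @ v) (c' @ w)" using tpeq_append1[OF t] Cons.prems(3) l by simp
  qed (use Cons.prems(1,3) l in auto)
  ultimately show ?case using ws l by (simp add: Un_assoc)
qed simp

lemma morley_list_length: "morley_list m V B vs \<Longrightarrow> v \<in> set vs \<Longrightarrow> length v = m"
  by (induction vs arbitrary: B) auto

section \<open>Independent conjugates\<close>

text \<open>\<open>\<chi>(x;d)\<close> divides over \<open>M\<close> along the Morley sequences of
  some coheir of the type of \<open>d\<close>. Morley lists of \<open>V\<close> over
  \<open>M\<close> of the same length have the same type over \<open>M\<close>, so inconsistency
  along one is inconsistency along all.\<close>

definition coheir_divides :: "'u list \<Rightarrow> nat \<Rightarrow> ('u list \<Rightarrow> bool) \<Rightarrow> bool" where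
  "coheir_divides d l \<chi> \<longleftrightarrow> dfn M (l + length d) \<chi> \<and> (\<exists>V k. coheir d V \<and> (\<forall>vs. morley_list (length d) V M vs \<and> length vs = k \<longrightarrow>
     \<not> (\<exists>x. length x = l \<and> (\<forall>v\<in>set vs. \<chi> (x @ v)))))"

lemma dfn_cover:
  assumes "\<And>\<chi>. \<chi> \<in> set \<chi>s \<Longrightarrow> dfn M (l + m) \<chi>"
  shows "dfn M (k * m) (\<lambda>a. \<exists>x. length x = l \<and> (\<forall>j<k. \<exists>\<chi>\<in>set \<chi>s. \<chi> (x @ pick m [j] a)))"
  using assms by (intro dfn_ex_pick dfn_bex) auto

lemma pick_list:
  assumes "\<And>w. w \<in> set ws \<Longrightarrow> length w = m" "j < length ws"
  shows "pick m [j] (concat ws) = ws ! j"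
proof -
  have "concat (map (\<lambda>i. if i < length ws then ws ! i else replicate m undefined) [0..<length ws]) = concat ws"
    by (intro arg_cong[of _ _ concat] nth_equalityI) auto
  moreover have "pick m [j] (concat (map (\<lambda>i. if i < length ws then ws ! i else replicate m undefined) [0..<length ws]))
     = ws ! j" using assms by (subst pick_single) auto
  ultimately show ?thesis by simp
qed

text \<open>If \<open>e\<^sub>2, \<dots>, e\<^sub>k\<close> is a Morley sequence over \<open>M D\<close>, then every \<open>e\<in>D\<close> can be put in front of it. So if \<open>\<chi>\<close> holds
  along no Morley sequence of length \<open>k\<close> and holds at \<open>e\<^sub>2, \<dots>, e\<^sub>k\<close>, it fails on \<open>D\<close>; this lowers the number of
  formulas needed to cover \<open>D\<close>.\<close>

lemma uncoverable:
  assumes "\<And>\<chi>. \<chi> \<in> set \<chi>s \<Longrightarrow> coheir_divides d l \<chi>"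
  shows "\<exists>H. (\<forall>h\<in>set H. tpeq M d h) \<and> \<not> (\<exists>x. length x = l \<and> (\<forall>h\<in>set H. \<exists>\<chi>\<in>set \<chi>s. \<chi> (x @ h)))"
  using assms
proof (induction \<chi>s)
  case Nil
  then show ?case by (intro exI[of _ "[d]"]) (auto simp: tpeq_refl)
next
  case (Cons \<chi> \<chi>s)
  let ?m = "length d"
  let ?cov = "\<lambda>x h. \<exists>\<chi>'\<in>set (\<chi> # \<chi>s). \<chi>' (x @ h)"
  obtain D where D: "\<And>h. h \<in> set D \<Longrightarrow> tpeq M d h"
    "\<not> (\<exists>x. length x = l \<and> (\<forall>h\<in>set D. \<exists>\<chi>\<in>set \<chi>s. \<chi> (x @ h)))"
    using Cons.IH Cons.prems by auto
  obtain V k where V: "coheir d V" and k: "\<And>vs. morley_list ?m V M vs \<Longrightarrow> length vs = k \<Longrightarrow>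
     \<not> (\<exists>x. length x = l \<and> (\<forall>v\<in>set vs. \<chi> (x @ v)))"
    using Cons.prems[of \<chi>] unfolding coheir_divides_def by auto
  have ultra_on: "ultra_on M ?m V" using V by (simp add: coheir_def)
  have lD: "length h = ?m" if "h \<in> set D" for h using tpeq_length[OF D(1)[OF that]] by simp
  \<comment> \<open>The number of terms at which \<open>\<chi>\<close> is assumed to hold goes down
    from \<open>k\<close> to 0: with \<open>k\<close> terms the assumption is contradictory, with
    none the claim is reached.\<close>
  have "\<exists>H. (\<forall>h\<in>set H. tpeq M d h) \<and> \<not> (\<exists>x. length x = l \<and> (\<forall>h\<in>set H. ?cov x h) \<and> (\<forall>v\<in>set vs. \<chi> (x @ v)))"
    if "j \<le> k" "morley_list ?m V M vs" "length vs = k - j" for j vs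
    using that
  proof (induction j arbitrary: vs)
    case 0
    then show ?case using k by (intro exI[of _ "[]"]) auto
  next
    case (Suc j)
    let ?E = "concat D" and ?N = "length D"
    have "small \<kappa> (M \<union> set ?E)" by (intro small_M_Un countable_finite) simp
    from morley_ex[OF this ultra_on] obtain e where e: "morley ?m V (M \<union> set ?E) e" by blast
    \<comment> \<open>The given \<open>vs\<close> need not be Morley over \<open>D\<close>. A list
      \<open>vs'\<close> that is Morley over \<open>D\<close> has the type of \<open>vs\<close>, and
      moving \<open>vs'\<close> to \<open>vs\<close> carries \<open>D\<close> to a copy
      \<open>E'\<close> over which \<open>vs\<close> is Morley.\<close>
    define vs' where "vs' = map e [0..<length vs]"
    have vs': "morley_list ?m V (M \<union> set ?E) vs'" unfolding vs'_def by (rule morley_morley_list[OF e]) simp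
    have "tpeq M ([] @ concat vs') ([] @ concat vs)"
    proof (rule morley_list_tpeq[OF ultra_on subset_refl])
      show "morley_list ?m V (M \<union> set []) vs'" using vs' by (rule morley_list_mono) auto
    qed (use Suc.prems(2) in \<open>auto simp: vs'_def tpeq_refl\<close>)
    then have vv: "tpeq M (concat vs') (concat vs)" by simp
    from tpeq_extend[OF small_M vv] obtain E' where E': "length E' = length ?E"
      "tpeq M (concat vs' @ ?E) (concat vs @ E')" by blast
    have sw: "tpeq M (?E @ concat vs') (E' @ concat vs)"
      using E'(2) tpeq_length[OF vv] by (rule tpeq_swap)
    have EE: "tpeq M ?E E'" using tpeq_append1[OF sw E'(1)[symmetric]] .
    have lE: "length ?E = ?N * ?m" using length_concat_const[of D "\<lambda>x. x" ?m] lD by simp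
    have mv: "morley_list ?m V (M \<union> set E') vs"
      using vs' sw E'(1) morley_list_length[OF Suc.prems(2)]
      by (intro morley_list_inv[OF ultra_on vs' sw]) (auto simp: vs'_def)
    define h where "h i = pick ?m [i] E'" for i
    have h: "tpeq M (D ! i) (h i)" "set (h i) \<subseteq> set E'" if "i < ?N" for i
    proof -
      have "slc M (length ?E) ?m (pick ?m [i])" unfolding lE using slc_pick[of "[i]" ?N M ?m] that by simp
      from tpeq_slc[OF EE this] show "tpeq M (D ! i) (h i)"
        using pick_list[OF lD that] by (simp add: h_def)
      show "set (h i) \<subseteq> set E'" unfolding h_def pick_def by (auto dest: in_set_takeD in_set_dropD)
    qed
    have hd: "tpeq M d (h i)" if "i < ?N" for i
      using D(1) that h(1)[OF that] tpeq_trans nth_mem by blast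
    define ok where "ok i H \<longleftrightarrow> (\<forall>g\<in>set H. tpeq M d g) \<and>
      \<not> (\<exists>x. length x = l \<and> (\<forall>g\<in>set H. ?cov x g) \<and> (\<forall>v\<in>set (h i # vs). \<chi> (x @ v)))" for i H
    have "\<exists>H. ok i H" if i: "i < ?N" for i
      unfolding ok_def
    proof (rule Suc.IH)
      have "coheir (h i) V" using coheir_tpeq[OF V hd[OF i]] .
      then have "realises M V (h i)" unfolding coheir_def realises_def by blast
      moreover have "morley_list ?m V (M \<union> set (h i)) vs" using h(2)[OF i] by (intro morley_list_mono[OF mv]) auto
      ultimately show "morley_list ?m V M (h i # vs)" using tpeq_length[OF hd[OF i]] by simp
    qed (use Suc.prems in auto)
    then obtain H where ok: "\<And>i. i < ?N \<Longrightarrow> ok i (H i)" by metis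
    have H: "tpeq M d g" if "i < ?N" "g \<in> set (H i)" for i g
    proof -
      from ok[OF that(1)] have "\<forall>g\<in>set (H i). tpeq M d g" unfolding ok_def by (rule conjunct1)
      from bspec[OF this that(2)] show ?thesis .
    qed
    have H': "\<not> (\<exists>x. length x = l \<and> (\<forall>g\<in>set (H i). ?cov x g) \<and> (\<forall>v\<in>set (h i # vs). \<chi> (x @ v)))"
      if "i < ?N" for i
      using ok[OF that] unfolding ok_def by (rule conjunct2)
    \<comment> \<open>An \<open>x\<close> that covers \<open>H i\<close> and satisfies
      \<open>\<chi>\<close> along \<open>vs\<close> cannot satisfy \<open>\<chi>\<close> at
      \<open>h i\<close>. Hence all the \<open>h i\<close> would be covered by
      \<open>\<chi>s\<close> alone, which is excluded for \<open>D\<close> and so for its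
      copy.\<close>
    let ?H = "map h [0..<?N] @ concat (map H [0..<?N])"
    show ?case
    proof (intro exI[of _ ?H] conjI ballI notI)
      show "tpeq M d g" if "g \<in> set ?H" for g using that hd H by auto
      assume "\<exists>x. length x = l \<and> (\<forall>h\<in>set ?H. ?cov x h) \<and> (\<forall>v\<in>set vs. \<chi> (x @ v))"
      then obtain x where x: "length x = l" "\<forall>g\<in>set ?H. ?cov x g" "\<forall>v\<in>set vs. \<chi> (x @ v)"
        by (elim exE conjE) (rule that)
      have "\<exists>\<chi>\<in>set \<chi>s. \<chi> (x @ h i)" if i: "i < ?N" for i
      proof -
        have g: "\<forall>g\<in>set (H i). ?cov x g"
        proof
          fix g assume "g \<in> set (H i)"
          then have "g \<in> set ?H" using i by auto
          then show "?cov x g" by (rule bspec[OF x(2)])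
        qed
        have "\<not> \<chi> (x @ h i)"
        proof
          assume "\<chi> (x @ h i)"
          then have "\<forall>v\<in>set (h i # vs). \<chi> (x @ v)" using x(3) by simp
          with x(1) g show False by - (rule notE[OF H'[OF i]], rule exI[of _ x], intro conjI)
        qed
        moreover have "?cov x (h i)" using i by (intro bspec[OF x(2)]) simp
        ultimately show ?thesis by simp
      qed
      then have 1: "\<exists>x. length x = l \<and> (\<forall>j<?N. \<exists>\<chi>\<in>set \<chi>s. \<chi> (x @ pick ?m [j] E'))"
        using x(1) unfolding h_def by (intro exI[of _ x]) simp
      have "dfn M (?N * ?m) (\<lambda>a. \<exists>x. length x = l \<and> (\<forall>j<?N. \<exists>\<chi>\<in>set \<chi>s. \<chi> (x @ pick ?m [j] a)))"
        using Cons.prems by (intro dfn_cover) (auto simp: coheir_divides_def)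
      from tpeqD[OF EE this lE] 1
      have "\<exists>x. length x = l \<and> (\<forall>j<?N. \<exists>\<chi>\<in>set \<chi>s. \<chi> (x @ pick ?m [j] ?E))" by (rule iffD2)
      then obtain x where x: "length x = l" "\<forall>j<?N. \<exists>\<chi>\<in>set \<chi>s. \<chi> (x @ pick ?m [j] ?E)"
        by (elim exE conjE) (rule that)
      have "\<forall>g\<in>set D. \<exists>\<chi>\<in>set \<chi>s. \<chi> (x @ g)"
        using x(2) pick_list[OF lD] by (simp add: all_set_conv_all_nth)
      with x(1) show False by - (rule notE[OF D(2)], rule exI[of _ x], intro conjI)
    qed
  qed
  from this[of k "[]"] show ?case by auto
qed

lemma coheir_divides_pad1:
  assumes "coheir_divides d l \<chi>" shows "coheir_divides d (l + s) (\<lambda>a. \<chi> (take l a @ drop (l + s) a))"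
proof -
  have \<chi>: "dfn M (l + length d) \<chi>" using assms by (simp add: coheir_divides_def)
  have "dfn M (l + s + length d) (\<lambda>a. \<chi> (take l a @ drop (l + s) a))"
    by (intro dfn_slc[OF \<chi>] slc_append slc_take slc_drop) auto
  moreover obtain V k where V: "coheir d V" "\<And>vs. morley_list (length d) V M vs \<Longrightarrow> length vs = k \<Longrightarrow>
     \<not> (\<exists>x. length x = l \<and> (\<forall>v\<in>set vs. \<chi> (x @ v)))"
    using assms unfolding coheir_divides_def by blast
  moreover have "\<not> (\<exists>x. length x = l + s \<and> (\<forall>v\<in>set vs. \<chi> (take l (x @ v) @ drop (l + s) (x @ v))))"
    if vs: "morley_list (length d) V M vs" "length vs = k" for vs
  proof
    assume "\<exists>x. length x = l + s \<and> (\<forall>v\<in>set vs. \<chi> (take l (x @ v) @ drop (l + s) (x @ v)))"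
    then obtain x where "length x = l + s" "\<forall>v\<in>set vs. \<chi> (take l x @ v)" by auto
    then show False using V(2)[OF vs] by (auto dest: spec[of _ "take l x"])
  qed
  ultimately show ?thesis unfolding coheir_divides_def by blast
qed

lemma coheir_divides_pad2:
  assumes "coheir_divides d l \<chi>" shows "coheir_divides d (s + l) (\<lambda>a. \<chi> (drop s a))"
proof -
  have \<chi>: "dfn M (l + length d) \<chi>" using assms by (simp add: coheir_divides_def)
  have "dfn M (s + l + length d) (\<lambda>a. \<chi> (drop s a))"
    by (intro dfn_slc[OF \<chi>] slc_drop) auto
  moreover obtain V k where V: "coheir d V" "\<And>vs. morley_list (length d) V M vs \<Longrightarrow> length vs = k \<Longrightarrow>
     \<not> (\<exists>x. length x = l \<and> (\<forall>v\<in>set vs. \<chi> (x @ v)))"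
    using assms unfolding coheir_divides_def by blast
  moreover have "\<not> (\<exists>x. length x = s + l \<and> (\<forall>v\<in>set vs. \<chi> (drop s (x @ v))))"
    if vs: "morley_list (length d) V M vs" "length vs = k" for vs
  proof
    assume "\<exists>x. length x = s + l \<and> (\<forall>v\<in>set vs. \<chi> (drop s (x @ v)))"
    then obtain x where "length x = s + l" "\<forall>v\<in>set vs. \<chi> (drop s x @ v)" by auto
    then show False using V(2)[OF vs] by (auto dest: spec[of _ "drop s x"])
  qed
  ultimately show ?thesis unfolding coheir_divides_def by blast
qed

text \<open>The formulas speak about tuples \<open>x\<close> of different lengths. Dummy variables
  bring them to one length, so that the concatenation of all the given tuples serves every
  formula.\<close>

lemma coheir_divides_common:
  assumes "finite F" "\<And>P. P \<in> F \<Longrightarrow> \<exists>l \<chi> c. coheir_divides d l \<chi> \<and> length c = l \<and> P = (\<lambda>y. \<not> \<chi> (c @ y))"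
  shows "\<exists>l \<chi>s c. length c = l \<and> (\<forall>\<chi>\<in>set \<chi>s. coheir_divides d l \<chi>) \<and> (\<forall>P\<in>F. \<exists>\<chi>\<in>set \<chi>s. \<forall>y. P y \<longleftrightarrow> \<not> \<chi> (c @ y))"
  using assms
proof (induction F rule: finite_induct)
  case empty
  show ?case by (intro exI[of _ 0] exI[of _ "[]"]) auto
next
  case (insert P F)
  have "\<exists>l \<chi>s c. length c = l \<and> (\<forall>\<chi>\<in>set \<chi>s. coheir_divides d l \<chi>) \<and>
     (\<forall>P\<in>F. \<exists>\<chi>\<in>set \<chi>s. \<forall>y. P y \<longleftrightarrow> \<not> \<chi> (c @ y))"
    by (rule insert.IH) (rule insert.prems, simp)
  then obtain l \<chi>s c where 1: "length c = l" "\<forall>\<chi>\<in>set \<chi>s. coheir_divides d l \<chi>"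
    "\<forall>P\<in>F. \<exists>\<chi>\<in>set \<chi>s. \<forall>y. P y \<longleftrightarrow> \<not> \<chi> (c @ y)"
    by (elim exE conjE) (rule that)
  obtain l' \<chi>' c' where 2: "coheir_divides d l' \<chi>'" "length c' = l'" "P = (\<lambda>y. \<not> \<chi>' (c' @ y))"
    using insert.prems[of P] by auto
  let ?p = "\<lambda>\<chi> a. \<chi> (take l a @ drop (l + l') a)" and ?q = "\<lambda>a. \<chi>' (drop l a)"
  show ?case
  proof (intro exI[of _ "l + l'"] exI[of _ "?q # map ?p \<chi>s"] exI[of _ "c @ c'"] conjI ballI)
    show "length (c @ c') = l + l'" using 1 2 by simp
    show "coheir_divides d (l + l') \<chi>" if "\<chi> \<in> set (?q # map ?p \<chi>s)" for \<chi>
      using that coheir_divides_pad1[OF bspec[OF 1(2)]] coheir_divides_pad2[OF 2(1)] by auto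
    fix Q assume "Q \<in> insert P F"
    then consider "Q = P" | "Q \<in> F" by blast
    then show "\<exists>\<chi>\<in>set (?q # map ?p \<chi>s). \<forall>y. Q y \<longleftrightarrow> \<not> \<chi> ((c @ c') @ y)"
    proof cases
      case 1
      then show ?thesis using 2 \<open>length c = l\<close> by simp
    next
      case 2
      from bspec[OF 1(3) this] obtain \<chi> where \<chi>: "\<chi> \<in> set \<chi>s" "\<And>y. Q y \<longleftrightarrow> \<not> \<chi> (c @ y)" by blast
      then show ?thesis using 1(1) \<open>length c' = l'\<close> by (intro bexI[of _ "?p \<chi>"]) auto
    qed
  qed
qed

text \<open>A weak form of the strict non-forking extensions of Chernikov and Kaplan.\<close>

lemma strict_coheir:
  "\<exists>Q. coheir d Q \<and> (\<forall>l \<chi> c. coheir_divides d l \<chi> \<longrightarrow> length c = l \<longrightarrow> eventually (\<lambda>y. \<not> \<chi> (c @ y)) Q)"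
proof -
  let ?F = "{\<lambda>y. \<not> \<chi> (c @ y) | l \<chi> c. coheir_divides d l \<chi> \<and> length c = l}"
  let ?m = "length d"
  have "\<exists>Q. coheir d Q \<and> (\<forall>P\<in>?F. eventually P Q)"
  proof (rule coheir_ex_family)
    fix \<theta> G assume \<theta>: "dfn M ?m \<theta>" "\<theta> d" and G: "finite G" "G \<subseteq> ?F"
    have bc: "\<exists>l \<chi> c. coheir_divides d l \<chi> \<and> length c = l \<and> P = (\<lambda>y. \<not> \<chi> (c @ y))" if "P \<in> G" for P
      using subsetD[OF G(2) that] by (elim CollectE exE conjE) (intro exI conjI)
    have "\<exists>l \<chi>s c. length c = l \<and> (\<forall>\<chi>\<in>set \<chi>s. coheir_divides d l \<chi>) \<and>
       (\<forall>P\<in>G. \<exists>\<chi>\<in>set \<chi>s. \<forall>y. P y \<longleftrightarrow> \<not> \<chi> (c @ y))"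
      by (rule coheir_divides_common[OF G(1)]) (rule bc)
    then obtain l \<chi>s c where c: "length c = l" "\<forall>\<chi>\<in>set \<chi>s. coheir_divides d l \<chi>"
      "\<forall>P\<in>G. \<exists>\<chi>\<in>set \<chi>s. \<forall>y. P y \<longleftrightarrow> \<not> \<chi> (c @ y)" by (elim exE conjE) (rule that)
    have "\<exists>H. (\<forall>h\<in>set H. tpeq M d h) \<and>
       \<not> (\<exists>x. length x = l \<and> (\<forall>h\<in>set H. \<exists>\<chi>\<in>set \<chi>s. \<chi> (x @ h)))"
      by (rule uncoverable) (rule bspec[OF c(2)])
    then obtain H where H0: "\<forall>h\<in>set H. tpeq M d h"
      and H2: "\<not> (\<exists>x. length x = l \<and> (\<forall>h\<in>set H. \<exists>\<chi>\<in>set \<chi>s. \<chi> (x @ h)))"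
      by (elim exE conjE) (rule that)
    have H: "tpeq M d h" if "h \<in> set H" for h using H0 that by blast
    have lH: "length h = ?m" if "h \<in> set H" for h using tpeq_length[OF H[OF that]] by simp
    let ?N = "length H"
    \<comment> \<open>\<open>?S\<close> is definable over \<open>M\<close> and holds of the
      concatenation of \<open>H\<close>, so it holds of some \<open>E\<close> in \<open>M\<close>.
      The tuple \<open>c\<close>, which may lie outside \<open>M\<close>, cannot cover every block
      of \<open>E\<close>, and a block that it misses is the required point of
      \<open>M\<close>.\<close>
    let ?S = "\<lambda>a. (\<forall>j\<in>{..<?N}. \<theta> (pick ?m [j] a)) \<and>
       \<not> (\<exists>x. length x = l \<and> (\<forall>j<?N. \<exists>\<chi>\<in>set \<chi>s. \<chi> (x @ pick ?m [j] a)))"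
    have "dfn M (?N * ?m) ?S"
      using \<theta>(1) c(2) by (intro dfn_conj dfn_ball dfn_not dfn_cover dfn_pick) (auto simp: coheir_divides_def)
    moreover have "length (concat H) = ?N * ?m" using length_concat_const[of H "\<lambda>x. x" ?m] lH by simp
    moreover have "?S (concat H)"
    proof (intro conjI ballI notI)
      show "\<theta> (pick ?m [j] (concat H))" if "j \<in> {..<?N}" for j
        using that pick_list[where j = j, OF lH] tpeqD[OF H \<theta>(1)] \<theta>(2) by auto
      assume "\<exists>x. length x = l \<and> (\<forall>j<?N. \<exists>\<chi>\<in>set \<chi>s. \<chi> (x @ pick ?m [j] (concat H)))"
      then obtain x where x: "length x = l" "\<forall>j<?N. \<exists>\<chi>\<in>set \<chi>s. \<chi> (x @ pick ?m [j] (concat H))"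
        by (elim exE conjE) (rule that)
      have "\<forall>h\<in>set H. \<exists>\<chi>\<in>set \<chi>s. \<chi> (x @ h)"
        using x(2) pick_list[OF lH] by (simp add: all_set_conv_all_nth)
      with x(1) show False by - (rule notE[OF H2], rule exI[of _ x], intro conjI)
    qed
    ultimately have "\<exists>E. set E \<subseteq> M \<and> length E = ?N * ?m \<and> ?S E" by (rule witness_in_M)
    then obtain E where E: "set E \<subseteq> M" "length E = ?N * ?m" "?S E" by (elim exE conjE) (rule that, assumption, assumption, intro conjI)
    have "\<not> (\<forall>j<?N. \<exists>\<chi>\<in>set \<chi>s. \<chi> (c @ pick ?m [j] E))"
    proof
      assume "\<forall>j<?N. \<exists>\<chi>\<in>set \<chi>s. \<chi> (c @ pick ?m [j] E)"
      with c(1) show False by - (rule notE[OF conjunct2[OF E(3)]], rule exI[of _ c], intro conjI)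
    qed
    then obtain j where j: "j < ?N" "\<forall>\<chi>\<in>set \<chi>s. \<not> \<chi> (c @ pick ?m [j] E)" by auto
    have "set (pick ?m [j] E) \<subseteq> set E" unfolding pick_def by (auto dest: in_set_takeD in_set_dropD)
    moreover have "length (pick ?m [j] E) = ?m"
      using slc_pick[of "[j]" ?N M ?m] j(1) E(2) unfolding slc_def by auto
    moreover have "\<forall>P\<in>G. P (pick ?m [j] E)" using c(3) j(2) by blast
    ultimately show "\<exists>c. set c \<subseteq> M \<and> length c = ?m \<and> \<theta> c \<and> (\<forall>P\<in>G. P c)"
      using E(1,3) j(1) by (intro exI[of _ "pick ?m [j] E"]) auto
  qed
  then obtain Q where Q: "coheir d Q" "\<forall>P\<in>?F. eventually P Q" by (elim exE conjE) (rule that)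
  have "eventually (\<lambda>y. \<not> \<chi> (c @ y)) Q" if "coheir_divides d l \<chi>" "length c = l" for l \<chi> c
    using that by (intro bspec[OF Q(2)]) auto
  then show ?thesis using Q(1) by (intro exI[of _ Q]) simp
qed

section \<open>Two mutually indiscernible rows starting at independent conjugates\<close>

lemma concat_pick:
  assumes "length x = P * m" "N \<le> P"
  shows "concat (map (\<lambda>i. pick m [i] x) [0..<N]) = take (N * m) x"
  using assms(2)
proof (induction N)
  case (Suc N)
  then show ?case using take_add[of "N * m" m x] by (simp add: pick_def add.commute)
qed simp

text \<open>The existence of \<open>d1\<close> independent of the ultrafilter \<open>V\<close> is the point: the ultrafilter to
  which this is applied depends on choices made after \<open>d1\<close>.\<close>

lemma independent_conjugate:
  obtains d1 where "tpeq M d d1"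
    "\<And>V. coheir d V \<Longrightarrow> \<exists>I J. (\<forall>i. length (I i) = length d) \<and> (\<forall>i. length (J i) = length d) \<and>
       indiscernible L U (M \<union> seq_elems J) I \<and> indiscernible L U (M \<union> seq_elems I) J \<and>
       tpeq M (d @ d1) (I 0 @ J 0) \<and> realises (M \<union> set (I 0)) V (I 1) \<and> realises (M \<union> set (J 0)) V (J 1)"
proof -
  let ?m = "length d"
  obtain Q where Q: "coheir d Q"
    "\<forall>l \<chi> c. coheir_divides d l \<chi> \<longrightarrow> length c = l \<longrightarrow> eventually (\<lambda>y. \<not> \<chi> (c @ y)) Q"
    using strict_coheir[of d] by (elim exE conjE) (rule that)
  have onQ: "ultra_on M ?m Q" using Q(1) by (simp add: coheir_def)
  have "small \<kappa> (M \<union> set d)" by (intro small_M_Un countable_finite) simp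
  from realises_ex[OF this onQ] obtain d1 where d1: "length d1 = ?m" "realises (M \<union> set d) Q d1" by blast
  have seq_cd: "countable (seq_elems e)" for e :: "nat \<Rightarrow> 'u list"
    by (auto simp: seq_elems_def intro: countable_finite)
  show thesis
  proof (rule that)
    show "tpeq M d d1" by (rule coheir_realises[OF Q(1) realises_mono[OF d1(2)] d1(1)]) auto
    fix V assume V: "coheir d V"
    then have ultra_on: "ultra_on M ?m V" by (simp add: coheir_def)
    obtain u where u: "morley ?m V M u" using morley_ex[OF small_M ultra_on] by blast
    have lu: "length (u i) = ?m" for i using morley_length[OF u] .
    have iu: "indiscernible L U M u" using morley_indiscernible[OF ultra_on subset_refl u] .
    obtain y where y: "length y = ?m" "realises (M \<union> seq_elems u) Q y"
      using realises_ex[OF small_M_Un[OF seq_cd] onQ] by blast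
    have uy: "tpeq M (d @ d1) (u i @ y)" for i
    proof (rule realises_tpeq[OF onQ subset_refl])
      show "tpeq M d (u i)" by (rule coheir_realises[OF V morley_realises[OF u]]) (auto simp: lu)
      show "realises (M \<union> set (u i)) Q y" by (rule realises_mono[OF y(2)]) (auto simp: seq_elems_def)
    qed (use d1 y in auto)
    \<comment> \<open>\<open>w\<close> is to be placed towards every \<open>u j\<close> as
      \<open>u\<close> is placed towards \<open>y\<close>. If a finite part \<open>\<chi>\<close> of
      this demand were inconsistent, \<open>\<chi>\<close> would divide along the Morley sequence
      \<open>u\<close>; then \<open>Q\<close> would force \<open>\<chi>\<close> to fail at
      \<open>u\<close> and \<open>y\<close>, where it holds.\<close>
    obtain w where w: "\<And>i. length (w i) = ?m"
      "\<And>N j. tpeq M (concat (map u [0..<N]) @ y) (concat (map w [0..<N]) @ u j)"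
    proof -
      define \<Gamma> where "\<Gamma> = {(N, \<lambda>a. R (a @ u j)) | N R j. dfn M (N * ?m + ?m) R \<and> R (concat (map u [0..<N]) @ y)}"
      have lc: "length (concat (map u [0..<N])) = N * ?m" for N
        using length_concat_const[of "[0..<N]" u ?m] lu by simp
      have "\<exists>J. (\<forall>i. length (J i) = ?m) \<and> (\<forall>(N, R)\<in>\<Gamma>. R (concat (map J [0..<N])))"
      proof (rule compact_seq[of "M \<union> seq_elems u" \<Gamma> ?m])
        show "small \<kappa> (M \<union> seq_elems u)" by (rule small_M_Un[OF seq_cd])
        fix N S assume "(N, S) \<in> \<Gamma>"
        then obtain R j where R: "dfn M (N * ?m + ?m) R" "S = (\<lambda>a. R (a @ u j))" unfolding \<Gamma>_def by auto
        have "dfn (M \<union> seq_elems u) (N * ?m + ?m) R" using dfn_mono[OF R(1)] by simp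
        then show "dfn (M \<union> seq_elems u) (N * ?m) S" unfolding R(2)
          by (rule dfn_inst) (auto simp: seq_elems_def lu)
      next
        fix \<Delta> assume \<Delta>: "finite \<Delta>" "\<Delta> \<subseteq> \<Gamma>"
        define wit where "wit x R j \<longleftrightarrow> dfn M (fst x * ?m + ?m) R \<and> R (concat (map u [0..<fst x]) @ y) \<and>
          snd x = (\<lambda>a. R (a @ u j))" for x R j
        have "\<exists>R j. wit x R j" if "x \<in> \<Delta>" for x
          using subsetD[OF \<Delta>(2) that] unfolding \<Gamma>_def wit_def
          by (elim CollectE exE conjE) (intro exI conjI, simp_all)
        then obtain r s where rs: "\<And>x. x \<in> \<Delta> \<Longrightarrow> wit x (r x) (s x)" by metis
        obtain P where P: "fst ` \<Delta> \<subseteq> {..<P}" using finite_nat_iff_bounded[of "fst ` \<Delta>"] \<Delta>(1) by auto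
        obtain k where k: "s ` \<Delta> \<subseteq> {..<k}" using finite_nat_iff_bounded[of "s ` \<Delta>"] \<Delta>(1) by auto
        define \<chi> where "\<chi> a \<longleftrightarrow> (\<forall>x\<in>\<Delta>. r x (take (fst x * ?m) a @ drop (P * ?m) a))" for a
        have d\<chi>: "dfn M (P * ?m + ?m) \<chi>" unfolding \<chi>_def[abs_def]
        proof (intro dfn_ball \<Delta>(1))
          fix x assume x: "x \<in> \<Delta>"
          have r: "dfn M (fst x * ?m + ?m) (r x)" using rs[OF x] by (simp add: wit_def)
          have "fst x * ?m \<le> P * ?m" using P x by (intro mult_le_mono1) auto
          then have le: "fst x * ?m \<le> P * ?m + ?m" by (rule trans_le_add1)
          show "dfn M (P * ?m + ?m) (\<lambda>a. r x (take (fst x * ?m) a @ drop (P * ?m) a))"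
            by (intro dfn_slc[OF r] slc_append slc_take[OF le] slc_drop refl)
        qed
        have \<chi>y: "\<chi> (concat (map u [0..<P]) @ y)"
          unfolding \<chi>_def
        proof
          fix x assume x: "x \<in> \<Delta>"
          have "fst x \<le> P" using P x by auto
          then have "[0..<P] = [0..<fst x] @ [fst x..<P]" using upt_add_eq_append[of 0 "fst x" "P - fst x"] by simp
          then have "take (fst x * ?m) (concat (map u [0..<P])) = concat (map u [0..<fst x])" by (simp add: lc)
          moreover have "fst x * ?m \<le> P * ?m" using \<open>fst x \<le> P\<close> by (rule mult_le_mono1)
          ultimately show "r x (take (fst x * ?m) (concat (map u [0..<P]) @ y) @ drop (P * ?m) (concat (map u [0..<P]) @ y))"
            using rs[OF x] by (simp add: wit_def lc)
        qed
        have "\<exists>x. length x = P * ?m \<and> (\<forall>j<k. \<chi> (x @ u j))"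
        proof (rule ccontr)
          assume no: "\<not> ?thesis"
          have "coheir_divides d (P * ?m) \<chi>" unfolding coheir_divides_def
          proof (intro conjI exI[of _ V] exI[of _ k] allI impI d\<chi> V notI)
            fix vs assume vs: "morley_list ?m V M vs \<and> length vs = k"
            assume "\<exists>x. length x = P * ?m \<and> (\<forall>v\<in>set vs. \<chi> (x @ v))"
            then obtain x where x: "length x = P * ?m" "\<forall>v\<in>set vs. \<chi> (x @ v)" by (elim exE conjE) (rule that)
            have "tpeq M ([] @ concat vs) ([] @ concat (map u [0..<k]))"
              using vs morley_morley_list[OF u, of "[0..<k]"] by (intro morley_list_tpeq[OF ultra_on subset_refl]) (auto simp: tpeq_refl)
            then have t: "tpeq M (concat vs) (concat (map u [0..<k]))" by simp
            have D: "dfn M (k * ?m) (\<lambda>a. \<exists>x. length x = P * ?m \<and> (\<forall>j<k. \<chi> (x @ pick ?m [j] a)))"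
              by (rule dfn_ex_pick[OF d\<chi>])
            have "\<forall>j<k. \<chi> (x @ pick ?m [j] (concat vs))"
              using x(2) vs pick_list[of vs ?m] morley_list_length[of ?m V M vs] by (simp add: all_set_conv_all_nth)
            with x(1) have "\<exists>x. length x = P * ?m \<and> (\<forall>j<k. \<chi> (x @ pick ?m [j] (concat vs)))"
              by (intro exI[of _ x] conjI)
            then have "\<exists>x. length x = P * ?m \<and> (\<forall>j<k. \<chi> (x @ pick ?m [j] (concat (map u [0..<k]))))"
              using tpeqD[OF t D] tpeq_length[OF t] lc by simp
            then show False using no pick_single[of u ?m _ k] lu by simp
          qed
          from Q(2)[rule_format, OF this, of "concat (map u [0..<P])"]
          have "eventually (\<lambda>y. \<not> \<chi> (concat (map u [0..<P]) @ y)) Q" by (simp add: lc)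
          moreover have "dfn (M \<union> seq_elems u) ?m (\<lambda>y. \<not> \<chi> (concat (map u [0..<P]) @ y))"
            by (rule dfn_not, rule dfn_inst1[OF dfn_mono[OF d\<chi>]]) (use lc in \<open>auto simp: seq_elems_def\<close>)
          ultimately show False using realisesD[OF y(2) _ y(1)] \<chi>y by blast
        qed
        then obtain x where x: "length x = P * ?m" "\<And>j. j < k \<Longrightarrow> \<chi> (x @ u j)" by blast
        \<comment> \<open>From \<open>P\<close> on no condition is imposed, and \<open>u 0\<close>
          merely has the right length.\<close>
        define K where "K i = (if i < P then pick ?m [i] x else u 0)" for i
        have K: "length (K i) = ?m" for i
          using slc_pick[of "[i]" P M ?m] x(1) lu unfolding slc_def by (auto simp: K_def)
        have "snd z (concat (map K [0..<fst z]))" if z: "z \<in> \<Delta>" for z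
        proof -
          have "fst z \<le> P" using P z by auto
          moreover from this have "map K [0..<fst z] = map (\<lambda>i. pick ?m [i] x) [0..<fst z]" by (auto simp: K_def)
          ultimately have "concat (map K [0..<fst z]) = take (fst z * ?m) x"
            using concat_pick[OF x(1)] by (simp del: map_eq_conv)
          moreover have "s z < k" using k z by auto
          then have "r z (take (fst z * ?m) (x @ u (s z)) @ drop (P * ?m) (x @ u (s z)))"
            using x(2) z unfolding \<chi>_def by blast
          moreover have "fst z * ?m \<le> P * ?m" using \<open>fst z \<le> P\<close> by (rule mult_le_mono1)
          ultimately show ?thesis using rs[OF z] x(1) by (simp add: wit_def)
        qed
        then show "\<exists>K. (\<forall>i. length (K i) = ?m) \<and> (\<forall>(N, R)\<in>\<Delta>. R (concat (map K [0..<N])))"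
          using K by (intro exI[of _ K]) (simp add: case_prod_beta)
      next
        fix J assume "\<And>i. length (J i) = ?m" and *: "\<And>N R. (N, R) \<in> \<Gamma> \<Longrightarrow> R (concat (map J [0..<N]))"
        then show ?thesis by (intro exI[of _ J]) auto
      qed
      then obtain w where w: "\<forall>i. length (w i) = ?m" "\<forall>(N, R)\<in>\<Gamma>. R (concat (map w [0..<N]))"
        by (elim exE conjE) (rule that)
      have "tpeq M (concat (map u [0..<N]) @ y) (concat (map w [0..<N]) @ u j)" for N j
      proof (rule tpeqI[of _ "N * ?m + ?m"])
        fix R assume "dfn M (N * ?m + ?m) R" "R (concat (map u [0..<N]) @ y)"
        then have "(N, \<lambda>a. R (a @ u j)) \<in> \<Gamma>" unfolding \<Gamma>_def by blast
        from bspec[OF w(2) this] show "R (concat (map w [0..<N]) @ u j)" by simp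
      qed (use lc y w lu length_concat_const[of "[0..<N]" w ?m] in auto)
      then show ?thesis using that[of w] w(1) by blast
    qed
    have wu: "tpeq M (d @ d1) (w i @ u j)" for i j
    proof (rule tpeq_trans[OF uy[of i]])
      let ?N = "Suc i"
      have "slc M (?N * ?m + ?m) (?m + ?m) (\<lambda>a. pick ?m [i] (take (?N * ?m) a) @ drop (?N * ?m) a)"
      proof (intro slc_append slc_drop)
        have "slc M (?N * ?m) ?m (pick ?m [i])" using slc_pick[of "[i]" ?N M ?m] by simp
        then show "slc M (?N * ?m + ?m) ?m (\<lambda>a. pick ?m [i] (take (?N * ?m) a))"
          by (intro slc_comp[OF slc_take]) auto
      qed simp
      moreover have l: "length (concat (map u [0..<?N])) = ?N * ?m" "length (concat (map w [0..<?N])) = ?N * ?m"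
        using length_concat_const[of "[0..<?N]" u ?m] length_concat_const[of "[0..<?N]" w ?m] lu w(1) by simp_all
      ultimately have "tpeq M
        (pick ?m [i] (take (?N * ?m) (concat (map u [0..<?N]) @ y)) @ drop (?N * ?m) (concat (map u [0..<?N]) @ y))
        (pick ?m [i] (take (?N * ?m) (concat (map w [0..<?N]) @ u j)) @ drop (?N * ?m) (concat (map w [0..<?N]) @ u j))"
        using y(1) by (intro tpeq_slc[OF w(2)[of ?N j]]) (simp del: upt_Suc)
      then show "tpeq M (u i @ y) (w i @ u j)"
        using l pick_single[OF lu, of i ?N] pick_single[OF w(1), of i ?N] by (simp del: upt_Suc)
    qed
    have ww: "tpeq M (concat (map u is)) (concat (map w js))"
      if s: "sorted_wrt (<) is" "sorted_wrt (<) js" "length is = length js" for "is" js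
    proof -
      obtain N where N: "set js \<subseteq> {..<N}" using finite_nat_iff_bounded[of "set js"] by auto
      have l: "length (concat (map u [0..<N])) = N * ?m" "length (concat (map w [0..<N])) = N * ?m"
        using length_concat_const[of "[0..<N]" u ?m] length_concat_const[of "[0..<N]" w ?m] lu w(1) by simp_all
      have "tpeq M (concat (map u [0..<N])) (concat (map w [0..<N]))"
        by (rule tpeq_append1[OF w(2)]) (simp add: l)
      moreover have "slc M (length (concat (map u [0..<N]))) (length js * ?m) (pick ?m js)"
        unfolding l using N by (intro slc_pick) auto
      ultimately have "tpeq M (pick ?m js (concat (map u [0..<N]))) (pick ?m js (concat (map w [0..<N])))"
        by (rule tpeq_slc)
      moreover have "pick ?m js (concat (map u [0..<N])) = concat (map u js)"
        "pick ?m js (concat (map w [0..<N])) = concat (map w js)"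
        using N lu w(1) by (auto intro!: pick_concat)
      ultimately show ?thesis using tpeq_trans[OF indiscernibleD[OF iu s]] by simp
    qed
    \<comment> \<open>First \<open>u\<close> is made indiscernible over \<open>w\<close>, then
      \<open>w\<close> over the result \<open>J\<close>. The second extraction does not spoil the
      first: that two increasing tuples of \<open>J\<close> agree over a tuple of \<open>w\<close>
      holds for all increasing tuples of \<open>w\<close>, so it passes to \<open>I\<close>.\<close>
    obtain J where J: "\<And>i. length (J i) = ?m" "indiscernible L U (M \<union> seq_elems w) J"
      and EJ: "\<And>k R is. dfn (M \<union> seq_elems w) (k * ?m) R \<Longrightarrow>
       (\<And>js. sorted_wrt (<) js \<Longrightarrow> length js = k \<Longrightarrow> R (concat (map u js))) \<Longrightarrow>
       sorted_wrt (<) is \<Longrightarrow> length is = k \<Longrightarrow> R (concat (map J is))"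
      by (rule extract_indiscernible[OF small_M_Un[OF seq_cd, of w], of u ?m]) (auto simp: lu)
    obtain I where I: "\<And>i. length (I i) = ?m" "indiscernible L U (M \<union> seq_elems J) I"
      and EI: "\<And>k R is. dfn (M \<union> seq_elems J) (k * ?m) R \<Longrightarrow>
       (\<And>js. sorted_wrt (<) js \<Longrightarrow> length js = k \<Longrightarrow> R (concat (map w js))) \<Longrightarrow>
       sorted_wrt (<) is \<Longrightarrow> length is = k \<Longrightarrow> R (concat (map I is))"
      by (rule extract_indiscernible[OF small_M_Un[OF seq_cd, of J], of w ?m]) (auto simp: w(1))
    have typeJ: "tpeq M (concat (map u is)) (concat (map J js))"
      if s: "sorted_wrt (<) is" "sorted_wrt (<) js" "length is = length js" for "is" js
    proof (rule tpeqI[of _ "length js * ?m"])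
      fix R assume R: "dfn M (length js * ?m) R" "R (concat (map u is))"
      have "dfn (M \<union> seq_elems w) (length js * ?m) R" using dfn_mono[OF R(1)] by simp
      then show "R (concat (map J js))"
      proof (rule EJ)
        fix ks :: "nat list" assume "sorted_wrt (<) ks" "length ks = length js"
        then have "tpeq M (concat (map u is)) (concat (map u ks))" using s by (intro indiscernibleD[OF iu]) auto
        from tpeqD[OF this R(1)] show "R (concat (map u ks))"
          using R(2) s length_concat_const[of "is" u ?m] lu by simp
      qed (use s in auto)
    qed (use s lu J(1) length_concat_const[of "is" u ?m] length_concat_const[of js J ?m] in auto)
    have typeI: "tpeq M (concat (map u is)) (concat (map I js))"
      if s: "sorted_wrt (<) is" "sorted_wrt (<) js" "length is = length js" for "is" js
    proof (rule tpeqI[of _ "length js * ?m"])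
      fix R assume R: "dfn M (length js * ?m) R" "R (concat (map u is))"
      have "dfn (M \<union> seq_elems J) (length js * ?m) R" using dfn_mono[OF R(1)] by simp
      then show "R (concat (map I js))"
      proof (rule EI)
        fix ks :: "nat list" assume "sorted_wrt (<) ks" "length ks = length js"
        then have "tpeq M (concat (map u is)) (concat (map w ks))" using s by (intro ww) auto
        from tpeqD[OF this R(1)] show "R (concat (map w ks))"
          using R(2) s length_concat_const[of "is" u ?m] lu by simp
      qed (use s in auto)
    qed (use s lu I(1) length_concat_const[of "is" u ?m] length_concat_const[of js I ?m] in auto)
    have wJ: "tpeq M (d @ d1) (w i @ J j)" for i j
    proof (rule tpeqI[of _ "?m + ?m"])
      fix R assume R: "dfn M (?m + ?m) R" "R (d @ d1)"
      have "dfn (M \<union> seq_elems w) (1 * ?m) (\<lambda>a. R (w i @ a))"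
        using dfn_inst1[OF dfn_mono[OF R(1)], of "M \<union> seq_elems w" "w i"] w(1) by (auto simp: seq_elems_def)
      then have "(\<lambda>a. R (w i @ a)) (concat (map J [j]))"
      proof (rule EJ)
        fix ks :: "nat list" assume "length ks = 1"
        then obtain z where "ks = [z]" by (auto simp: length_Suc_conv)
        then show "(\<lambda>a. R (w i @ a)) (concat (map u ks))" using tpeqD[OF wu R(1)] R(2) d1(1) by simp
      qed auto
      then show "R (w i @ J j)" by simp
    qed (use d1 w(1) J(1) in auto)
    have IJ: "tpeq M (d @ d1) (I i @ J j)" for i j
    proof (rule tpeqI[of _ "?m + ?m"])
      fix R assume R: "dfn M (?m + ?m) R" "R (d @ d1)"
      have "dfn (M \<union> seq_elems J) (1 * ?m) (\<lambda>a. R (a @ J j))"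
        using dfn_inst[OF dfn_mono[OF R(1)], of "M \<union> seq_elems J" "J j"] J(1) by (auto simp: seq_elems_def)
      then have "(\<lambda>a. R (a @ J j)) (concat (map I [i]))"
      proof (rule EI)
        fix ks :: "nat list" assume "length ks = 1"
        then obtain z where "ks = [z]" by (auto simp: length_Suc_conv)
        then show "(\<lambda>a. R (a @ J j)) (concat (map w ks))" using tpeqD[OF wJ R(1)] R(2) d1(1) by simp
      qed auto
      then show "R (I i @ J j)" by simp
    qed (use d1 I(1) J(1) in auto)
    have Jind: "indiscernible L U (M \<union> seq_elems I) J"
      unfolding indiscernible_iff
    proof (intro conjI allI impI)
      show "\<exists>n. \<forall>i. length (J i) = n" using J(1) by blast
      fix "is" js :: "nat list"
      assume s: "sorted_wrt (<) is \<and> sorted_wrt (<) js \<and> length is = length js"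
      let ?x = "concat (map J is)" and ?y = "concat (map J js)"
      have l: "length ?x = length is * ?m" "length ?y = length is * ?m"
        using s length_concat_const[of "is" J ?m] length_concat_const[of js J ?m] J(1) by auto
      show "tpeq (M \<union> seq_elems I) ?x ?y"
      proof (rule tpeq_params)
        fix p assume "set p \<subseteq> seq_elems I"
        then obtain k where k: "set p \<subseteq> set (concat (map I [0..<k]))" using seq_elems_prefix by blast
        have "tpeq M (concat (map I [0..<k]) @ ?x) (concat (map I [0..<k]) @ ?y)"
        proof (rule tpeqI[of _ "k * ?m + length is * ?m"])
          fix R assume R: "dfn M (k * ?m + length is * ?m) R" "R (concat (map I [0..<k]) @ ?x)"
          let ?S = "\<lambda>a. R (a @ ?x) \<longleftrightarrow> R (a @ ?y)"
          have "dfn (M \<union> seq_elems J) (k * ?m) ?S"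
            using l by (intro dfn_iff dfn_inst[OF dfn_mono[OF R(1)]]) (auto simp: seq_elems_def)
          then have "?S (concat (map I [0..<k]))"
          proof (rule EI)
            fix ks :: "nat list" assume ks: "sorted_wrt (<) ks" "length ks = k"
            have "dfn (M \<union> seq_elems w) (length is * ?m) (\<lambda>a. R (concat (map w ks) @ a))"
              using length_concat_const[of ks w ?m] w(1) ks
              by (intro dfn_inst1[OF dfn_mono[OF R(1)]]) (auto simp: seq_elems_def)
            moreover have "tpeq (M \<union> seq_elems w) ?x ?y" using s by (intro indiscernibleD[OF J(2)]) auto
            ultimately show "?S (concat (map w ks))" using tpeqD l(1) by blast
          qed auto
          then show "R (concat (map I [0..<k]) @ ?y)" using R(2) by simp
        qed (use l length_concat_const[of "[0..<k]" I ?m] I(1) in auto)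
        then show "tpeq M (p @ ?x) (p @ ?y)" using k by (rule tpeq_sub) (simp add: l)
      qed
    qed
    have u1: "realises (M \<union> set (u 0)) V (u 1)" by (rule morley_realises[OF u]) auto
    have "realises (M \<union> set (I 0)) V (I 1)"
      using typeI[of "[0, 1]" "[0, 1]"] lu I(1) by (intro realises_inv[OF ultra_on u1]) auto
    moreover have "realises (M \<union> set (J 0)) V (J 1)"
      using typeJ[of "[0, 1]" "[0, 1]"] lu J(1) by (intro realises_inv[OF ultra_on u1]) auto
    ultimately show "\<exists>I J. (\<forall>i. length (I i) = ?m) \<and> (\<forall>i. length (J i) = ?m) \<and>
       indiscernible L U (M \<union> seq_elems J) I \<and> indiscernible L U (M \<union> seq_elems I) J \<and>
       tpeq M (d @ d1) (I 0 @ J 0) \<and> realises (M \<union> set (I 0)) V (I 1) \<and> realises (M \<union> set (J 0)) V (J 1)"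
      using I J(1) Jind IJ by blast
  qed
qed

section \<open>Types definable over an elementary submodel\<close>

text \<open>In the usual terms: the type of \<open>a\<close> over \<open>B\<close> is definable over
  \<open>M\<close>.\<close>

definition def_type :: "'u set \<Rightarrow> nat \<Rightarrow> 'u list \<Rightarrow> bool" where
  "def_type B n a \<longleftrightarrow> length a = n \<and> (\<forall>k R. dfn M (n + k) R \<longrightarrow>
     (\<exists>S. dfn M k S \<and> (\<forall>e. set e \<subseteq> B \<and> length e = k \<longrightarrow> (R (a @ e) \<longleftrightarrow> S e))))"

lemma def_type_length: "def_type B n a \<Longrightarrow> length a = n"
  by (simp add: def_type_def)

lemma def_type_mono: "def_type B n a \<Longrightarrow> A \<subseteq> B \<Longrightarrow> def_type A n a"
  unfolding def_type_def by (meson subset_trans)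

text \<open>\<open>S\<close> defines the \<open>R\<close>-part of the type of \<open>a\<close> over
  \<open>M\<close>. Elementarity makes it unique, so the same \<open>S\<close> also describes every
  extension of this type that is definable over \<open>M\<close>.\<close>

definition schema :: "nat \<Rightarrow> 'u list \<Rightarrow> ('u list \<Rightarrow> bool) \<Rightarrow> ('u list \<Rightarrow> bool) \<Rightarrow> bool" where
  "schema k a R S \<longleftrightarrow> dfn M k S \<and> (\<forall>e. set e \<subseteq> M \<and> length e = k \<longrightarrow> (R (a @ e) \<longleftrightarrow> S e))"

lemma schemaD: "schema k a R S \<Longrightarrow> set e \<subseteq> M \<Longrightarrow> length e = k \<Longrightarrow> R (a @ e) \<longleftrightarrow> S e"
  by (simp add: schema_def)

lemma schema_dfn: "schema k a R S \<Longrightarrow> dfn M k S"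
  by (simp add: schema_def)

lemma def_type_schema:
  assumes "def_type B n a" "M \<subseteq> B" "dfn M (n + k) R"
  obtains S where "schema k a R S" "\<And>e. set e \<subseteq> B \<Longrightarrow> length e = k \<Longrightarrow> R (a @ e) \<longleftrightarrow> S e"
proof -
  obtain S where S: "dfn M k S" "\<forall>e. set e \<subseteq> B \<and> length e = k \<longrightarrow> (R (a @ e) \<longleftrightarrow> S e)"
    using assms(1,3) unfolding def_type_def by metis
  moreover have "schema k a R S" unfolding schema_def using S assms(2) by auto
  ultimately show thesis using that by simp
qed

lemma schema_unique:
  assumes "schema k a R S" "schema k a R S'" "length e = k" shows "S e \<longleftrightarrow> S' e"
  by (rule all_in_M[OF dfn_iff[OF schema_dfn[OF assms(1)] schema_dfn[OF assms(2)]] _ assms(3)])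
    (use assms(1,2) in \<open>simp add: schema_def\<close>)

lemma schema_tpeq:
  assumes "schema k a R S" "tpeq M a a'" "dfn M (n + k) R" "length a = n"
  shows "schema k a' R S"
  unfolding schema_def
proof (intro conjI allI impI schema_dfn[OF assms(1)])
  fix e assume e: "set e \<subseteq> M \<and> length e = k"
  have "dfn M n (\<lambda>x. R (x @ e))" using e by (intro dfn_inst[OF assms(3)]) auto
  from tpeqD[OF assms(2) this assms(4)] show "R (a' @ e) \<longleftrightarrow> S e"
    using schemaD[OF assms(1)] e by simp
qed

lemma def_type_schD:
  assumes "def_type B n a" "M \<subseteq> B" "dfn M (n + k) R" "schema k a R S" "set e \<subseteq> B" "length e = k"
  shows "R (a @ e) \<longleftrightarrow> S e"
proof -
  obtain S' where S': "schema k a R S'" "\<And>e. set e \<subseteq> B \<Longrightarrow> length e = k \<Longrightarrow> R (a @ e) \<longleftrightarrow> S' e"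
    by (rule def_type_schema[OF assms(1-3)]) (rule that)
  show ?thesis using S'(2)[OF assms(5,6)] schema_unique[OF S'(1) assms(4,6)] by simp
qed

lemma slc_set:
  assumes "slc A k n F" "length a = k" shows "set (F a) \<subseteq> A \<union> set a"
proof -
  obtain c \<rho> where c: "c \<in> lists A" "\<And>i. i < n \<Longrightarrow> \<rho> i < k + length c"
    "\<And>a. length a = k \<Longrightarrow> length (F a) = n"
    "\<And>a i. length a = k \<Longrightarrow> i < n \<Longrightarrow> F a ! i = (a @ c) ! \<rho> i"
    using assms(1) unfolding slc_def by blast
  have "F a ! i \<in> A \<union> set a" if "i < n" for i
  proof -
    have "(a @ c) ! \<rho> i \<in> set (a @ c)" using c(2)[OF that] assms(2) by (intro nth_mem) simp
    then show ?thesis using c(1) c(4)[OF assms(2) that] by auto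
  qed
  then show ?thesis using c(3)[OF assms(2)] by (metis in_set_conv_nth subsetI)
qed

text \<open>The schemas are applied to the parameters in \<open>B\<close>. A finite part of the
  resulting type is consistent: its parameters form one tuple \<open>E\<close>, consistency is a
  condition on \<open>E\<close> over \<open>M\<close>, and at tuples of \<open>M\<close> the tuple
  \<open>a\<close> itself is a witness.\<close>

lemma def_type_extend:
  assumes a: "def_type M n a" and B: "small \<kappa> B" "M \<subseteq> B"
  shows "\<exists>a'. def_type B n a' \<and> tpeq M a a'"
proof -
  have la: "length a = n" using def_type_length[OF a] .
  let ?I = "{(R, S, e). dfn M (n + length e) R \<and> schema (length e) a R S \<and> set e \<subseteq> B}"
  let ?g = "\<lambda>(R, S, e) x. R (x @ e) \<longleftrightarrow> S e"
  have "\<exists>x. length x = n \<and> (\<forall>Q\<in>?g ` ?I. Q x)"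
  proof (rule realize[OF B(1)])
    fix Q assume "Q \<in> ?g ` ?I"
    then obtain R S e where *: "Q = (\<lambda>x. R (x @ e) \<longleftrightarrow> S e)" "dfn M (n + length e) R" "set e \<subseteq> B" by auto
    show "dfn B n Q" unfolding *(1) using *(3) by (intro dfn_iff dfn_Const dfn_inst[OF dfn_mono[OF *(2) B(2)]]) auto
  next
    fix G assume "finite G" "G \<subseteq> ?g ` ?I"
    from finite_subset_image[OF this] obtain H where H: "H \<subseteq> ?I" "finite H" "G = ?g ` H" by auto
    obtain hs where hs: "set hs = H" using finite_list[OF H(2)] by blast
    define E where "E = concat (map (\<lambda>x. snd (snd x)) hs)"
    have HI: "dfn M (n + length (snd (snd x))) (fst x)" "schema (length (snd (snd x))) a (fst x) (fst (snd x))"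
      if "x \<in> H" for x using subsetD[OF H(1) that] by auto
    have "\<exists>F. slc M (length E) (length (snd (snd x))) F \<and> F E = snd (snd x)" if "x \<in> H" for x
      by (rule slc_params) (use that hs in \<open>auto simp: E_def\<close>)
    then obtain F where F: "\<And>x. x \<in> H \<Longrightarrow> slc M (length E) (length (snd (snd x))) (F x)"
      "\<And>x. x \<in> H \<Longrightarrow> F x E = snd (snd x)" by metis
    let ?T = "\<lambda>E. \<exists>x. length x = n \<and> (\<forall>h\<in>H. fst h (x @ F h E) \<longleftrightarrow> fst (snd h) (F h E))"
    have "dfn M (n + length E) (\<lambda>z. \<forall>h\<in>H. fst h (take n z @ F h (drop n z)) \<longleftrightarrow> fst (snd h) (F h (drop n z)))"
    proof (intro dfn_ball dfn_iff H(2))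
      fix h assume h: "h \<in> H"
      have s: "slc M (n + length E) (length (snd (snd h))) (\<lambda>z. F h (drop n z))"
        by (rule slc_comp[OF slc_drop F(1)[OF h]]) simp
      show "dfn M (n + length E) (\<lambda>z. fst h (take n z @ F h (drop n z)))"
        by (intro dfn_slc[OF HI(1)[OF h]] slc_append slc_take s) simp
      show "dfn M (n + length E) (\<lambda>z. fst (snd h) (F h (drop n z)))"
        by (rule dfn_slc[OF schema_dfn[OF HI(2)[OF h]] s])
    qed
    from dfn_exs[OF this] have "dfn M (length E) ?T" by (simp cong: conj_cong)
    then have "?T E"
    proof (rule all_in_M)
      fix c assume c: "set c \<subseteq> M" "length c = length E"
      have "fst h (a @ F h c) \<longleftrightarrow> fst (snd h) (F h c)" if h: "h \<in> H" for h
        using schemaD[OF HI(2)[OF h]] slc_set[OF F(1)[OF h] c(2)] F(1)[OF h] c unfolding slc_def by blast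
      then show "?T c" using la by blast
    qed simp
    then obtain x where "length x = n" "\<forall>h\<in>H. fst h (x @ F h E) \<longleftrightarrow> fst (snd h) (F h E)"
      by (elim exE conjE) (rule that)
    then show "\<exists>x. length x = n \<and> (\<forall>Q\<in>G. Q x)" unfolding H(3) using F(2)
      by (intro exI[of _ x]) (simp add: case_prod_beta)
  qed
  then obtain x where x: "length x = n" "\<forall>Q\<in>?g ` ?I. Q x" by (elim exE conjE) (rule that)
  have x': "R (x @ e) \<longleftrightarrow> S e" if "dfn M (n + length e) R" "schema (length e) a R S" "set e \<subseteq> B" for R S e
  proof -
    have "?g (R, S, e) \<in> ?g ` ?I" using that by (intro imageI) simp
    from bspec[OF x(2) this] show ?thesis by simp
  qed
  have "def_type B n x" unfolding def_type_def
  proof (intro conjI allI impI x(1))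
    fix k R assume R: "dfn M (n + k) R"
    obtain S where S: "schema k a R S" by (rule def_type_schema[OF a subset_refl R]) (rule that)
    show "\<exists>S. dfn M k S \<and> (\<forall>e. set e \<subseteq> B \<and> length e = k \<longrightarrow> (R (x @ e) \<longleftrightarrow> S e))"
      using schema_dfn[OF S] x' R S by (intro exI[of _ S]) auto
  qed
  moreover have "tpeq M a x"
  proof (rule tpeqI[OF la x(1)])
    fix R assume R: "dfn M n R" "R a"
    then have R': "dfn M (n + 0) R" by simp
    obtain S where S: "schema 0 a R S" by (rule def_type_schema[OF a subset_refl R']) (rule that)
    show "R x" using x'[of "[]" R S] R S schemaD[OF S, of "[]"] by simp
  qed
  ultimately show ?thesis by blast
qed

text \<open>Through the schema a formula about \<open>a @ c\<close> becomes a formula about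
  \<open>c\<close> over \<open>M\<close>, and the schema depends only on the type of
  \<open>a\<close> over \<open>M\<close>.\<close>

lemma def_type_tpeq:
  assumes "def_type B n a" "def_type B' n a'" "M \<subseteq> B" "M \<subseteq> B'" "tpeq M a a'" "tpeq M c c'" "set c \<subseteq> B" "set c' \<subseteq> B'"
  shows "tpeq M (a @ c) (a' @ c')"
proof (rule tpeqI[of _ "n + length c"])
  fix R assume R: "dfn M (n + length c) R" "R (a @ c)"
  obtain S where S: "schema (length c) a R S" by (rule def_type_schema[OF assms(1,3) R(1)]) (rule that)
  have "S c" using def_type_schD[OF assms(1,3) R(1) S assms(7)] R(2) by simp
  then have "S c'" using tpeqD[OF assms(6) schema_dfn[OF S]] by simp
  then show "R (a' @ c')"
    using def_type_schD[OF assms(2,4) R(1) schema_tpeq[OF S assms(5) R(1) def_type_length[OF assms(1)]] assms(8)]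
      tpeq_length[OF assms(6)] by simp
qed (use tpeq_length[OF assms(6)] def_type_length[OF assms(1)] def_type_length[OF assms(2)] in auto)

lemma tpeq_params_rev:
  assumes "tpeq (A \<union> C) xs ys" "set q \<subseteq> C" shows "tpeq A (q @ xs) (q @ ys)"
proof (rule tpeqI[of _ "length q + length xs"])
  fix R assume R: "dfn A (length q + length xs) R" "R (q @ xs)"
  have "dfn (A \<union> C) (length xs) (\<lambda>x. R (q @ x))"
    using assms(2) by (intro dfn_inst1[OF dfn_mono[OF R(1)]]) auto
  from tpeqD[OF assms(1) this] show "R (q @ ys)" using R(2) by simp
qed (use tpeq_length[OF assms(1)] in auto)

text \<open>By \<open>def_type_tpeq\<close>, adding \<open>a\<close> to the base cannot separate
  tuples of \<open>B\<close> with the same type over \<open>M\<close>. Mutually indiscernible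
  sequences in \<open>B\<close> thus stay so over \<open>M\<close> and \<open>a\<close>, which is
  the base over which dp-minimality is applied.\<close>

lemma def_type_indiscernible:
  assumes a: "def_type B n a" and I: "indiscernible L U (M \<union> seq_elems J) I"
    and B: "M \<union> seq_elems I \<union> seq_elems J \<subseteq> B"
  shows "indiscernible L U (M \<union> set a \<union> seq_elems J) I"
  unfolding indiscernible_iff
proof (intro conjI allI impI)
  show "\<exists>n. \<forall>i. length (I i) = n" using I by (simp add: indiscernible_iff)
  fix "is" js :: "nat list"
  assume s: "sorted_wrt (<) is \<and> sorted_wrt (<) js \<and> length is = length js"
  let ?x = "concat (map I is)" and ?y = "concat (map I js)"
  have xy: "tpeq (M \<union> seq_elems J) ?x ?y" using s by (intro indiscernibleD[OF I]) auto
  have "tpeq (M \<union> (set a \<union> seq_elems J)) ?x ?y"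
  proof (rule tpeq_params)
    fix p assume p: "set p \<subseteq> set a \<union> seq_elems J"
    let ?q = "filter (\<lambda>z. z \<in> seq_elems J) p"
    have "tpeq M (?q @ ?x) (?q @ ?y)" by (rule tpeq_params_rev[OF xy]) auto
    moreover have "set ?q \<subseteq> seq_elems J" "set ?x \<subseteq> seq_elems I" "set ?y \<subseteq> seq_elems I"
      by (auto simp: seq_elems_def[of I])
    moreover have "M \<subseteq> B" "seq_elems I \<subseteq> B" "seq_elems J \<subseteq> B" using B by auto
    ultimately have "tpeq M (a @ ?q @ ?x) (a @ ?q @ ?y)"
      by (intro def_type_tpeq[OF a a _ _ tpeq_refl]) auto
    then have "tpeq M ((a @ ?q) @ ?x) ((a @ ?q) @ ?y)" by simp
    then show "tpeq M (p @ ?x) (p @ ?y)" by (rule tpeq_sub) (use p tpeq_length[OF xy] in auto)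
  qed
  then show "tpeq (M \<union> set a \<union> seq_elems J) ?x ?y" by (simp add: Un_assoc)
qed

text \<open>Property (D) over \<open>M \<union> set a\<close> gives a type whose defining formulas
  may still mention \<open>a\<close>; definability of the type of \<open>a\<close> over
  \<open>M\<close> eliminates it. Only the type of \<open>u # a\<close> over \<open>M\<close> is
  obtained in this way.\<close>

lemma property_D_def_type:
  assumes a: "def_type M n a" and P: "dfn (M \<union> set a) 1 P" "P [u0]"
  shows "\<exists>u. P [u] \<and> def_type M (Suc n) (u # a)"
proof -
  let ?A = "M \<union> set a"
  have la: "length a = n" using def_type_length[OF a] .
  have A: "small \<kappa> ?A" by (intro small_M_Un countable_finite) simp
  obtain \<psi> b where \<psi>: "b \<in> lists ?A" "fm_in L (1 + length b) \<psi>"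
    "\<And>a. length a = 1 \<Longrightarrow> P a \<longleftrightarrow> sat U (a @ b) \<psi>" using P(1) unfolding dfn_def by blast
  have "(\<psi>, b) \<in> param_fms L 1 ?A" using \<psi> by (simp add: param_fms_def)
  moreover have "\<exists>a. sat U (a # b) \<psi>" using \<psi>(3)[of "[u0]"] P(2) by auto
  ultimately obtain p where p: "complete_type L U 1 ?A p" "(\<psi>, b) \<in> p" "definable_type L U ?A 1 ?A p"
    using property_D A unfolding property_D_def by blast
  obtain u where u: "\<forall>(\<phi>, b)\<in>p. sat U (u # b) \<phi>" using sat A p(1) unfolding saturated_def by blast
  have pu: "(\<phi>, e) \<in> p \<longleftrightarrow> sat U (u # e) \<phi>" if "(\<phi>, e) \<in> param_fms L 1 ?A" for \<phi> e
  proof -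
    have "(\<phi>, e) \<in> p \<or> (Neg \<phi>, e) \<in> p" using p(1) that unfolding complete_type_def by blast
    then show ?thesis using u by auto
  qed
  have "P [u]" using \<psi>(3)[of "[u]"] u p(2) by auto
  moreover have "def_type M (Suc n) (u # a)" unfolding def_type_def
  proof (intro conjI allI impI)
    show "length (u # a) = Suc n" using la by simp
    fix k R assume R: "dfn M (Suc n + k) R"
    then obtain \<phi> c where c: "c \<in> lists M" "fm_in L (Suc n + k + length c) \<phi>"
      "\<And>a. length a = Suc n + k \<Longrightarrow> R a \<longleftrightarrow> sat U (a @ c) \<phi>" unfolding dfn_def by blast
    let ?m = "n + k + length c"
    have "fm_in L (1 + ?m) \<phi>" using c(2) by (simp add: algebra_simps)
    then obtain \<psi>' a0 where a0: "(\<psi>', a0) \<in> param_fms L ?m ?A"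
      "\<And>e. e \<in> lists ?A \<Longrightarrow> length e = ?m \<Longrightarrow> (\<phi>, e) \<in> p \<longleftrightarrow> sat U (e @ a0) \<psi>'"
      using p(3) unfolding definable_type_def by blast
    have d: "dfn ?A ?m (\<lambda>e. sat U (e @ a0) \<psi>')"
      using a0(1) by (intro dfnI[of a0]) (auto simp: param_fms_def)
    have "slc ?A k (length a + (k + length c)) (\<lambda>e. a @ e @ c)"
      using c(1) by (intro slc_append slc_const slc_id) auto
    then have "dfn ?A k (\<lambda>e. sat U ((a @ e @ c) @ a0) \<psi>')"
      using la by (intro dfn_slc[OF d]) (simp add: add.assoc)
    from dfn_set_params[OF this] obtain S where S: "dfn M (length a + k) S"
      "\<forall>e. length e = k \<longrightarrow> (sat U ((a @ e @ c) @ a0) \<psi>' \<longleftrightarrow> S (a @ e))" by metis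
    obtain S' where S': "schema k a S S'" by (rule def_type_schema[OF a subset_refl S(1)[unfolded la]]) (rule that)
    have "R ((u # a) @ e) \<longleftrightarrow> S' e" if e: "set e \<subseteq> M \<and> length e = k" for e
    proof -
      have "R ((u # a) @ e) \<longleftrightarrow> sat U (u # a @ e @ c) \<phi>" using c(3)[of "u # a @ e"] e la by simp
      also have "\<dots> \<longleftrightarrow> (\<phi>, a @ e @ c) \<in> p"
        using pu[of \<phi> "a @ e @ c"] c(1,2) e la by (auto simp: param_fms_def add.assoc)
      also have "\<dots> \<longleftrightarrow> sat U ((a @ e @ c) @ a0) \<psi>'" using a0(2)[of "a @ e @ c"] c(1) e la by auto
      also have "\<dots> \<longleftrightarrow> S (a @ e)" using S(2) e by blast
      also have "\<dots> \<longleftrightarrow> S' e" using schemaD[OF S'] e by blast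
      finally show ?thesis .
    qed
    then show "\<exists>S. dfn M k S \<and> (\<forall>e. set e \<subseteq> M \<and> length e = k \<longrightarrow> (R ((u # a) @ e) \<longleftrightarrow> S e))"
      using schema_dfn[OF S'] by blast
  qed
  ultimately show ?thesis by blast
qed

section \<open>The step that uses dp-minimality and property (D) together\<close>

definition def_consistent :: "nat \<Rightarrow> ('u list \<Rightarrow> bool) \<Rightarrow> 'u list \<Rightarrow> bool" where
  "def_consistent n R d \<longleftrightarrow> (\<exists>a. def_type (M \<union> set d) n a \<and> R (a @ d))"

text \<open>The extension of the type of \<open>a\<close> from \<open>M\<close> to
  \<open>M \<union> set d\<close> obeys the same schemas, so the value of \<open>S\<close> at
  \<open>d\<close> decides whether it contains \<open>R\<close>.\<close>

lemma def_consistentI: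
  assumes "def_type M n a" "dfn M (n + length d) R" "schema (length d) a R S" "S d"
  shows "def_consistent n R d"
proof -
  have "small \<kappa> (M \<union> set d)" by (intro small_M_Un countable_finite) simp
  from def_type_extend[OF assms(1) this] obtain a' where a': "def_type (M \<union> set d) n a'" "tpeq M a a'" by blast
  have "R (a' @ d) \<longleftrightarrow> S d"
    using def_type_schD[OF a'(1) _ assms(2) schema_tpeq[OF assms(3) a'(2) assms(2) def_type_length[OF assms(1)]]] by simp
  then show ?thesis using a'(1) assms(4) unfolding def_consistent_def by blast
qed

lemma unbroken:
  assumes "indiscernible L U (insert u (M \<union> set a)) H" "\<And>i. length (H i) = m" "dfn M (Suc (length a) + m) R"
  shows "R (u # a @ H i) \<longleftrightarrow> R (u # a @ H j)"
proof -
  have "tpeq (insert u (M \<union> set a)) (H i) (H j)" using indiscernibleD[OF assms(1), of "[i]" "[j]"] by simp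
  moreover have "dfn (insert u (M \<union> set a)) m (\<lambda>x. R ((u # a) @ x))"
    by (rule dfn_inst1[OF dfn_mono[OF assms(3)]]) auto
  ultimately show ?thesis using tpeqD[of _ "H i" "H j" m "\<lambda>x. R ((u # a) @ x)"] assms(2) by simp
qed

lemma one_unbroken:
  assumes a: "def_type B n a" and B: "M \<union> seq_elems I \<union> seq_elems J \<subseteq> B"
    and "indiscernible L U (M \<union> seq_elems J) I" "indiscernible L U (M \<union> seq_elems I) J"
  shows "indiscernible L U (insert u (M \<union> set a)) I \<or> indiscernible L U (insert u (M \<union> set a)) J"
proof -
  have "indiscernible L U (M \<union> set a \<union> seq_elems J) I" "indiscernible L U (M \<union> set a \<union> seq_elems I) J"
    using def_type_indiscernible[OF a assms(3)] def_type_indiscernible[OF a assms(4)] B by auto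
  moreover have "small \<kappa> (M \<union> set a)" by (intro small_M_Un countable_finite) simp
  ultimately show ?thesis using dp unfolding dp_minimal_def by blast
qed

text \<open>With \<open>e\<close> a Morley sequence in the type of \<open>d\<close> and \<open>b\<^sub>0, b\<^sub>1, \<dots>\<close> a Morley sequence of \<open>V\<close> over it,
  dp-minimality gives \<open>R(u,a,e\<^sub>1) \<and> S(u,a,b\<^sub>0) \<and> \<not> S(u,a,b\<^sub>1) \<longrightarrow> R(u,a,e\<^sub>0)\<close> for all \<open>u\<close>. Finite satisfiability moves
  \<open>b\<^sub>1\<close>, \<open>b\<^sub>0\<close> and \<open>e\<^sub>1\<close> into \<open>M\<close>, and property (D) yields a definable type satisfying the left-hand side.\<close>

lemma def_consistent_if_nondefinable:
  assumes R: "dfn M (Suc n + length d) R" and S: "dfn M (Suc n + k) S"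
    and V: "ultra_on M k V" and d': "tpeq M d d'" and b: "realises (M \<union> set d') V b" "length b = k"
    and a: "def_type (M \<union> set d' \<union> set b) n a"
    and ev: "eventually (\<lambda>c. \<exists>u. R (u # a @ d') \<and> S (u # a @ b) \<and> \<not> S (u # a @ c)) V"
  shows "def_consistent (Suc n) R d"
proof -
  let ?m = "length d"
  obtain T where T: "coheir d T" by (rule coheir_ex')
  have onT: "ultra_on M ?m T" using T by (simp add: coheir_def)
  have cd: "countable (seq_elems e)" for e :: "nat \<Rightarrow> 'u list"
    by (auto simp: seq_elems_def intro: countable_finite)
  obtain e where e: "morley ?m T M e" using morley_ex[OF small_M onT] by blast
  have le: "length (e i) = ?m" for i using morley_length[OF e] .
  obtain f where f: "morley k V (M \<union> seq_elems e) f" using morley_ex[OF small_M_Un[OF cd] V] by blast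
  have lf: "length (f i) = k" for i using morley_length[OF f] .
  let ?B = "M \<union> (seq_elems e \<union> seq_elems f)"
  have el: "set (e i) \<subseteq> seq_elems e" "set (f i) \<subseteq> seq_elems f" for i by (auto simp: seq_elems_def)
  have eB: "set (e i) \<subseteq> ?B" "set (f i) \<subseteq> ?B" for i using el by blast+
  have MB: "M \<subseteq> ?B" by blast
  have "small \<kappa> ?B" using cd by (intro small_M_Un) simp
  from def_type_extend[OF def_type_mono[OF a] this MB] obtain a' where a': "def_type ?B n a'" "tpeq M a a'" by blast
  have la: "length a = n" "length a' = n" using def_type_length[OF a] def_type_length[OF a'(1)] .
  have de: "tpeq M d (e i)" for i by (rule coheir_realises[OF T morley_realises[OF e]]) (auto simp: le)
  have ld': "length d' = ?m" using tpeq_length[OF d'] by simp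
  \<comment> \<open>\<open>e 1\<close> and \<open>f 0\<close> take the parts of \<open>d'\<close>
    and \<open>b\<close>. The term \<open>e 0\<close> is left free as the place where
    \<open>R\<close> will be deduced, and \<open>f 1\<close> as the place where \<open>S\<close>
    fails.\<close>
  have db: "tpeq M (d' @ b) (e 1 @ f 0)"
  proof (rule realises_tpeq[OF V subset_refl tpeq_trans[OF tpeq_sym[OF d'] de] b(1)])
    show "realises (M \<union> set (e 1)) V (f 0)" using el(1)[of 1] by (intro morley_realises[OF f]) auto
  qed (use b lf in auto)
  have adb: "tpeq M (a @ d' @ b) (a' @ e 1 @ f 0)"
    using eB by (intro def_type_tpeq[OF a a'(1) _ _ a'(2) db]) auto
  \<comment> \<open>\<open>Y\<close> says that the left-hand side of the implication is solvable in
    \<open>u\<close>; \<open>Z\<close> below states the implication for every \<open>u\<close>, with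
    \<open>x'\<close> in the place of \<open>e 0\<close>.\<close>
  define Y where "Y z \<longleftrightarrow> (\<exists>u. R (u # take (n + ?m) z) \<and> S (u # take n z @ take k (drop (n + ?m) z)) \<and>
     \<not> S (u # take n z @ drop (n + ?m + k) z))" for z
  have Y: "Y (x @ y @ z @ w) \<longleftrightarrow> (\<exists>u. R (u # x @ y) \<and> S (u # x @ z) \<and> \<not> S (u # x @ w))"
    if "length x = n" "length y = ?m" "length z = k" for x y z w using that by (simp add: Y_def)
  have dY: "dfn M (n + ?m + k + k) Y"
  proof -
    have "dfn M (Suc (n + ?m + k + k)) (\<lambda>z. R (take (Suc (n + ?m)) z) \<and>
       S (take (Suc n) z @ take k (drop (Suc (n + ?m)) z)) \<and> \<not> S (take (Suc n) z @ drop (Suc (n + ?m + k)) z))"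
      by (rule dfn_conj dfn_not dfn_slc_eq[OF R] dfn_slc_eq[OF S] slc_append slc_take slc_seg slc_drop_le | simp)+
    from dfn_ex[OF this] show ?thesis by (simp add: Y_def[abs_def])
  qed
  have G: "eventually (\<lambda>c. Y (a' @ e 1 @ f 0 @ c)) V"
  proof -
    have "eventually (\<lambda>c. Y ((a @ d' @ b) @ c)) V"
      by (rule eventually_mono[OF ev]) (use Y la ld' b(2) in simp)
    moreover have "dfn M (length (a @ d' @ b) + k) Y" using dY la ld' b(2) by (simp add: add.assoc)
    ultimately show ?thesis using ultra_on_ev_inv[OF V subset_refl adb] by simp
  qed
  have ie: "indiscernible L U (M \<union> seq_elems f) e"
    using indiscernible_over_morley[OF V morley_indiscernible[OF onT subset_refl e] f] .
  have "indiscernible L U (M \<union> seq_elems e) f" by (rule morley_indiscernible[OF V _ f]) blast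
  \<comment> \<open>One of \<open>e\<close> and \<open>f\<close> stays indiscernible over
    \<open>u\<close> and \<open>a'\<close>. If it is \<open>e\<close>, then \<open>R\<close> passes
    from \<open>e 1\<close> to \<open>e 0\<close>; if it is \<open>f\<close>, then \<open>S\<close>
    cannot differ between \<open>f 0\<close> and \<open>f 1\<close>.\<close>
  have imp: "R (u # a' @ e 0)" if "R (u # a' @ e 1)" "S (u # a' @ f 0)" "\<not> S (u # a' @ f 1)" for u
    using one_unbroken[OF a'(1) _ ie \<open>indiscernible L U (M \<union> seq_elems e) f\<close>, of u]
      unbroken[of u a' e ?m R 1 0] unbroken[of u a' f k S 1 0] le lf la R S that by auto
  define Z where "Z z \<longleftrightarrow> (\<forall>u. R (u # take n z @ take ?m (drop (n + ?m) z)) \<and>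
       S (u # take n z @ take k (drop (n + ?m + ?m) z)) \<and> \<not> S (u # take n z @ drop (n + ?m + ?m + k) z) \<longrightarrow>
       R (u # take n z @ take ?m (drop n z)))" for z
  have Z: "Z (x @ x' @ y @ z @ w) \<longleftrightarrow> (\<forall>u. R (u # x @ y) \<and> S (u # x @ z) \<and> \<not> S (u # x @ w) \<longrightarrow> R (u # x @ x'))"
    if "length x = n" "length x' = ?m" "length y = ?m" "length z = k" for x x' y z w
    using that by (simp add: Z_def)
  have dZ: "dfn M (n + (?m + ?m + k + k)) Z"
  proof -
    have "dfn M (Suc (n + (?m + ?m + k + k))) (\<lambda>z. R (take (Suc n) z @ take ?m (drop (Suc (n + ?m)) z)) \<and>
       S (take (Suc n) z @ take k (drop (Suc (n + ?m + ?m)) z)) \<and>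
       \<not> S (take (Suc n) z @ drop (Suc (n + ?m + ?m + k)) z) \<longrightarrow>
       R (take (Suc n) z @ take ?m (drop (Suc n) z)))"
      by (rule dfn_imp dfn_conj dfn_not dfn_slc_eq[OF R] dfn_slc_eq[OF S] slc_append slc_take slc_seg slc_drop_le | simp)+
    from dfn_all[OF this] show ?thesis by (simp add: Z_def[abs_def])
  qed
  have dY': "dfn M (n + (?m + k + k)) Y" using dY by (simp add: add.assoc)
  obtain sY where sY: "schema (?m + k + k) a' Y sY" by (rule def_type_schema[OF a'(1) MB dY']) (rule that)
  obtain sZ where sZ: "schema (?m + ?m + k + k) a' Z sZ" by (rule def_type_schema[OF a'(1) MB dZ]) (rule that)
  \<comment> \<open>The schemas remove \<open>a'\<close>, which need not be related to the bases of
    the Morley sequences. What is left is a condition over \<open>M\<close> on terms of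
    \<open>e\<close> and \<open>f\<close>, and these can be pulled into \<open>M\<close> from the
    last to the first.\<close>
  define W where "W z \<longleftrightarrow> sZ z \<and> sY (drop ?m z)" for z
  have dW: "dfn M (?m + (?m + (k + k))) W"
  proof -
    have "dfn M (?m + ?m + k + k) (\<lambda>z. sZ z \<and> sY (drop ?m z))"
      by (rule dfn_conj schema_dfn[OF sZ] dfn_slc_eq[OF schema_dfn[OF sY]] slc_drop_le | simp add: add.assoc)+
    then show ?thesis by (simp add: W_def[abs_def] add.assoc)
  qed
  have eMB: "set x \<subseteq> ?B" if "set x \<subseteq> M" for x using that by blast
  have Z1: "sZ (e 0 @ e 1 @ f 0 @ f 1)"
    using def_type_schD[OF a'(1) MB dZ sZ, of "e 0 @ e 1 @ f 0 @ f 1"] eB le lf imp la by (simp add: Z)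
  let ?B1 = "M \<union> (seq_elems e \<union> set (f 0))"
  have "dfn ?B1 k (\<lambda>x. sZ ((e 0 @ e 1 @ f 0) @ x))"
    using el by (intro dfn_inst1[OF dfn_mono[OF schema_dfn[OF sZ]]]) (auto simp: le lf)
  then have "dfn ?B1 k (\<lambda>x. sZ (e 0 @ e 1 @ f 0 @ x))" by simp
  moreover have "realises ?B1 V (f 1)" by (rule morley_realises[OF f]) auto
  \<comment> \<open>\<open>f 1\<close> is not known to satisfy \<open>Y\<close> with
    \<open>a'\<close>, because it realises \<open>V\<close> over a base without \<open>a'\<close>.
    But \<open>Y\<close> is \<open>V\<close>-large, which is enough for one point of
    \<open>M\<close> to satisfy both \<open>sZ\<close> and \<open>Y\<close>.\<close>
  ultimately obtain c where c: "set c \<subseteq> M" "length c = k" "sZ (e 0 @ e 1 @ f 0 @ c)" "Y (a' @ e 1 @ f 0 @ c)"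
    using realises_pull[of ?B1 V "f 1" M k "\<lambda>x. sZ (e 0 @ e 1 @ f 0 @ x)" "\<lambda>c. Y (a' @ e 1 @ f 0 @ c)"] V Z1 lf G
    by (metis (no_types, lifting))
  have "sY (e 1 @ f 0 @ c)"
    using def_type_schD[OF a'(1) MB dY' sY, of "e 1 @ f 0 @ c"] eB eMB[OF c(1)] le lf c(2,4) by simp
  then have W0: "W (e 0 @ e 1 @ f 0 @ c)" using c(3) le by (simp add: W_def)
  let ?B2 = "M \<union> seq_elems e"
  have "slc ?B2 k (length (e 0 @ e 1) + (k + length c)) (\<lambda>x. (e 0 @ e 1) @ x @ c)"
    using el c by (intro slc_append slc_const slc_id) auto
  then have "dfn ?B2 k (\<lambda>x. W ((e 0 @ e 1) @ x @ c))"
    using le c(2) by (intro dfn_slc[OF dfn_mono[OF dW]]) (auto simp: add.assoc)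
  then have d2: "dfn ?B2 k (\<lambda>x. W (e 0 @ e 1 @ x @ c))" by simp
  have "realises ?B2 V (f 0)" by (rule morley_realises[OF f]) auto
  from realises_pull[OF this V d2 W0 lf always_eventually[of "\<lambda>_. True"]]
  obtain c0 where c0: "set c0 \<subseteq> M" "length c0 = k" "W (e 0 @ e 1 @ c0 @ c)" by auto
  let ?B3 = "M \<union> set (e 0)"
  have "slc ?B3 ?m (length (e 0) + (?m + length (c0 @ c))) (\<lambda>x. e 0 @ x @ c0 @ c)"
    using c c0 by (intro slc_append slc_const slc_id) auto
  then have d3: "dfn ?B3 ?m (\<lambda>x. W (e 0 @ x @ c0 @ c))"
    using le c(2) c0(2) by (intro dfn_slc[OF dfn_mono[OF dW]]) auto
  have "realises ?B3 T (e 1)" by (rule morley_realises[OF e]) auto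
  from realises_pull[OF this onT d3 c0(3) le always_eventually[of "\<lambda>_. True"]]
  obtain c1 where c1: "set c1 \<subseteq> M" "length c1 = ?m" "W (e 0 @ c1 @ c0 @ c)" by auto
  have "sY (c1 @ c0 @ c)" using c1(3) le by (simp add: W_def)
  then have "Y (a' @ c1 @ c0 @ c)"
    using def_type_schD[OF a'(1) MB dY' sY, of "c1 @ c0 @ c"] eMB c c0 c1 by simp
  then obtain u0 where u0: "R (u0 # a' @ c1)" "S (u0 # a' @ c0)" "\<not> S (u0 # a' @ c)"
    using la c0(2) c1(2) by (auto simp: Y)
  \<comment> \<open>Besides \<open>a'\<close> only parameters from \<open>M\<close> are left, and
    this is what makes property (D) applicable.\<close>
  let ?P = "\<lambda>l. R (l @ a' @ c1) \<and> S (l @ a' @ c0) \<and> \<not> S (l @ a' @ c)"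
  have "dfn (M \<union> set a') (1 + (n + ?m)) R" "dfn (M \<union> set a') (1 + (n + k)) S"
    using dfn_mono[OF R] dfn_mono[OF S] by simp_all
  then have "dfn (M \<union> set a') 1 ?P"
    using c c0 c1 la by (intro dfn_conj dfn_not dfn_inst) auto
  from property_D_def_type[OF def_type_mono[OF a'(1) MB] this, of u0] u0
  obtain u where u: "R (u # a' @ c1)" "S (u # a' @ c0)" "\<not> S (u # a' @ c)" "def_type M (Suc n) (u # a')" by auto
  obtain sR where sR: "schema ?m (u # a') R sR" by (rule def_type_schema[OF u(4) subset_refl R]) (rule that)
  \<comment> \<open>The chosen \<open>u\<close> is controlled on \<open>M\<close> only. A failure of
    \<open>sR\<close> at \<open>e 0\<close> is therefore moved, together with \<open>W\<close>, to a
    point \<open>x\<close> of \<open>M\<close>, where the implication \<open>Z\<close> contradicts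
    it.\<close>
  have "sR d"
  proof (rule ccontr)
    assume "\<not> sR d"
    then have ne: "\<not> sR (e 0)" using tpeqD[OF de schema_dfn[OF sR]] by simp
    have "slc M ?m (?m + length (c1 @ c0 @ c)) (\<lambda>x. x @ c1 @ c0 @ c)"
      using c c0 c1 by (intro slc_append slc_const slc_id) auto
    then have "dfn M ?m (\<lambda>x. W (x @ c1 @ c0 @ c))"
      using c c0 c1 by (intro dfn_slc[OF dW]) auto
    from witness_in_M[OF dfn_conj[OF this dfn_not[OF schema_dfn[OF sR]]] le[of 0]] c1(3) ne
    obtain x where x: "set x \<subseteq> M" "length x = ?m" "W (x @ c1 @ c0 @ c)" "\<not> sR x" by auto
    have "sZ (x @ c1 @ c0 @ c)" using x(3) by (simp add: W_def)
    then have "Z (a' @ x @ c1 @ c0 @ c)"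
      using def_type_schD[OF a'(1) MB dZ sZ, of "x @ c1 @ c0 @ c"] eMB c c0 c1 x by simp
    then have "R (u # a' @ x)" using u la c0 c1 x by (simp add: Z)
    then show False using schemaD[OF sR x(1,2)] x(4) by simp
  qed
  then show ?thesis using def_consistentI[OF u(4) R sR] by blast
qed

text \<open>\<open>V\<close> avoids the formulas over \<open>M\<close> that imply \<open>P\<close>; no formula in \<open>V\<close> can then imply \<open>P\<close>.\<close>

lemma opposite_coheirs:
  assumes "\<And>S. dfn M k S \<Longrightarrow> \<not> (\<forall>e. set e \<subseteq> M \<and> length e = k \<longrightarrow> (P e \<longleftrightarrow> S e))"
  shows "\<exists>V V'. ultra_on M k V \<and> ultra_on M k V' \<and> eventually P V \<and> eventually (\<lambda>c. \<not> P c) V' \<and>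
    (\<forall>\<theta>. dfn M k \<theta> \<longrightarrow> eventually \<theta> V \<longrightarrow> eventually \<theta> V')"
proof -
  define in_P where "in_P \<theta> \<longleftrightarrow> dfn M k \<theta> \<and> (\<forall>c. set c \<subseteq> M \<and> length c = k \<longrightarrow> \<theta> c \<longrightarrow> P c)" for \<theta>
  define g where "g \<theta> c \<longleftrightarrow> set c \<subseteq> M \<and> length c = k \<and> P c \<and> \<not> \<theta> c" for \<theta> :: "'u list \<Rightarrow> bool" and c
  have "\<exists>c. \<forall>Q\<in>G. Q c" if G: "finite G" "G \<subseteq> g ` {\<theta>. in_P \<theta>}" for G
  proof -
    from finite_subset_image[OF G] obtain H where H: "H \<subseteq> {\<theta>. in_P \<theta>}" "finite H" "G = g ` H" by auto
    have "dfn M k (\<lambda>c. \<exists>\<theta>\<in>H. \<theta> c)" using H(1,2) by (intro dfn_bex) (auto simp: in_P_def)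
    \<comment> \<open>A finite union of definable sets contained in \<open>P\<close> is definable,
      hence different from \<open>P\<close>, and so it misses a point of \<open>P\<close> in
      \<open>M\<close>.\<close>
    from assms[OF this] obtain c where c: "set c \<subseteq> M" "length c = k" "\<not> (P c \<longleftrightarrow> (\<exists>\<theta>\<in>H. \<theta> c))"
      by (simp only: not_all not_imp conj_assoc) (elim exE conjE, rule that)
    moreover have "P c" if "\<theta> \<in> H" "\<theta> c" for \<theta> using subsetD[OF H(1) that(1)] that(2) c by (simp add: in_P_def)
    ultimately have "P c" "\<forall>\<theta>\<in>H. \<not> \<theta> c" by blast+
    then show ?thesis using c(1,2) H(3) by (intro exI[of _ c]) (simp add: g_def)
  qed
  from ultra_filter_ex[OF this] obtain V where V: "ultra V" "\<forall>Q\<in>g ` {\<theta>. in_P \<theta>}. eventually Q V" by blast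
  have V': "eventually (g \<theta>) V" if "in_P \<theta>" for \<theta> using that by (intro bspec[OF V(2)]) simp
  have False_in: "in_P (\<lambda>_. False)" by (simp add: in_P_def dfn_Const)
  have V1: "ultra_on M k V" "eventually P V"
    using V(1) eventually_mono[OF V'[OF False_in], of "\<lambda>c. set c \<subseteq> M \<and> length c = k"]
      eventually_mono[OF V'[OF False_in], of P] by (auto simp: ultra_on_def g_def)
  define h where "h \<theta> c \<longleftrightarrow> set c \<subseteq> M \<and> length c = k \<and> \<not> P c \<and> \<theta> c" for \<theta> :: "'u list \<Rightarrow> bool" and c
  let ?D = "{\<theta>. dfn M k \<theta> \<and> eventually \<theta> V}"
  have "\<exists>c. \<forall>Q\<in>G. Q c" if G: "finite G" "G \<subseteq> h ` ?D" for G
  proof -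
    from finite_subset_image[OF G] obtain H where H: "H \<subseteq> ?D" "finite H" "G = h ` H" by auto
    let ?t = "\<lambda>c. \<forall>\<theta>\<in>H. \<theta> c"
    have t: "dfn M k ?t" "eventually ?t V" using H(1,2) by (auto intro!: dfn_ball eventually_ball_finite)
    have "\<not> in_P ?t"
    proof
      assume "in_P ?t"
      have "eventually (\<lambda>c. ?t c \<and> g ?t c) V" using t(2) V'[OF \<open>in_P ?t\<close>] by (rule eventually_conj)
      from ultra_happens[OF V(1) this] show False unfolding g_def by blast
    qed
    then obtain c where c: "set c \<subseteq> M" "length c = k" "\<forall>\<theta>\<in>H. \<theta> c" "\<not> P c" using t(1) unfolding in_P_def by blast
    have "h \<theta> c" if "\<theta> \<in> H" for \<theta> using c(1,2,4) bspec[OF c(3) that] by (simp add: h_def)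
    then show ?thesis unfolding H(3) by (intro exI[of _ c]) simp
  qed
  from ultra_filter_ex[OF this] obtain W where W: "ultra W" "\<forall>Q\<in>h ` ?D. eventually Q W" by blast
  have W': "eventually (h \<theta>) W" if "dfn M k \<theta>" "eventually \<theta> V" for \<theta> using that by (intro bspec[OF W(2)]) simp
  have W1: "ultra_on M k W" "eventually (\<lambda>c. \<not> P c) W"
    using W(1) eventually_mono[OF W'[OF dfn_True], of "\<lambda>c. set c \<subseteq> M \<and> length c = k"]
      eventually_mono[OF W'[OF dfn_True], of "\<lambda>c. \<not> P c"] by (auto simp: ultra_on_def h_def)
  have "eventually \<theta> W" if "dfn M k \<theta>" "eventually \<theta> V" for \<theta>
    by (rule eventually_mono[OF W'[OF that]]) (simp add: h_def)
  then show ?thesis using V1 W1 by blast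
qed

text \<open>The induction adds a coordinate \<open>u\<close> to a tuple \<open>a1\<close> of
  definable type. \<open>def_consistent_if_nondefinable\<close> needs a formula that changes along
  an ultrafilter while \<open>R\<close> holds at a conjugate of \<open>d\<close>. If some coheir of
  the type of \<open>d\<close> avoids \<open>R (u0 # a1 @ _)\<close>, then \<open>R\<close> itself
  is such a formula; otherwise any formula without a schema for \<open>u0 # a1\<close> is. If every
  formula has a schema, \<open>u0 # a1\<close> can be used directly.\<close>

lemma def_consistent_if_conjugates_consistent:
  "dfn M (n + length d) R \<Longrightarrow> conjugates_consistent n R d \<Longrightarrow> def_consistent n R d"
proof (induction n arbitrary: R d)
  case 0
  have "R d" using 0(2) unfolding conjugates_consistent_def by (auto dest: spec[of _ "{d}"] simp: tpeq_refl)
  moreover have "def_type (M \<union> set d) 0 []" unfolding def_type_def by auto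
  ultimately show ?case unfolding def_consistent_def by (intro exI[of _ "[]"]) simp
next
  case (Suc n)
  note R = Suc.prems(1)
  let ?m = "length d"
  obtain d1 where d1: "tpeq M d d1"
    and rows: "\<And>V. coheir d V \<Longrightarrow> \<exists>I J. (\<forall>i. length (I i) = ?m) \<and> (\<forall>i. length (J i) = ?m) \<and>
       indiscernible L U (M \<union> seq_elems J) I \<and> indiscernible L U (M \<union> seq_elems I) J \<and>
       tpeq M (d @ d1) (I 0 @ J 0) \<and> realises (M \<union> set (I 0)) V (I 1) \<and> realises (M \<union> set (J 0)) V (J 1)"
    by (rule independent_conjugate[of d]) blast
  have ld1: "length d1 = ?m" using tpeq_length[OF d1] by simp
  define \<Phi> where "\<Phi> z \<longleftrightarrow> (\<exists>u. R (u # take (n + ?m) z) \<and> R (u # take n z @ drop (n + ?m) z))" for z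
  have d\<Phi>: "dfn M (n + length (d @ d1)) \<Phi>"
  proof -
    have "dfn M (Suc (n + (?m + ?m))) (\<lambda>z. R (take (Suc (n + ?m)) z) \<and> R (take (Suc n) z @ drop (Suc (n + ?m)) z))"
      by (rule dfn_conj dfn_slc_eq[OF R] slc_append slc_take slc_drop_le | simp)+
    from dfn_ex[OF this] show ?thesis by (simp add: \<Phi>_def[abs_def] ld1)
  qed
  have "conjugates_consistent n \<Phi> (d @ d1)" unfolding conjugates_consistent_def
  proof (intro allI impI)
    fix D assume D: "finite D" "\<forall>e\<in>D. tpeq M (d @ d1) e"
    let ?D = "take ?m ` D \<union> drop ?m ` D"
    have *: "length e = ?m + ?m" "tpeq M d (take ?m e)" "tpeq M d (drop ?m e)" if "e \<in> D" for e
    proof -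
      show l: "length e = ?m + ?m" using D(2) that ld1 tpeq_length by fastforce
      have "tpeq M (d @ d1) (take ?m e @ drop ?m e)" using D(2) that by simp
      from tpeq_append1[OF this] tpeq_append2[OF this] l
      show "tpeq M d (take ?m e)" "tpeq M d (drop ?m e)" using tpeq_trans[OF d1] by simp_all
    qed
    have "finite ?D" "\<forall>e\<in>?D. tpeq M d e" using D(1) * by auto
    from Suc.prems(2)[unfolded conjugates_consistent_def, THEN spec, THEN mp, THEN mp, OF this]
    obtain x where x: "length x = Suc n" "\<forall>e\<in>?D. R (x @ e)" by (elim exE conjE) (rule that)
    obtain u y where y: "x = u # y" "length y = n" using x(1) by (cases x) auto
    have "\<Phi> (y @ e)" if "e \<in> D" for e
      using x(2) that y unfolding \<Phi>_def by (intro exI[of _ u]) auto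
    then show "\<exists>x. length x = n \<and> (\<forall>e\<in>D. \<Phi> (x @ e))" using y(2) by (intro exI[of _ y]) simp
  qed
  from Suc.IH[OF d\<Phi> this] obtain a1 where a1: "def_type (M \<union> set (d @ d1)) n a1" "\<Phi> (a1 @ d @ d1)"
    unfolding def_consistent_def by auto
  have la: "length a1 = n" using def_type_length[OF a1(1)] .
  have a1M: "def_type M n a1" by (rule def_type_mono[OF a1(1)]) blast
  obtain u0 where u0: "R (u0 # a1 @ d)" "R (u0 # a1 @ d1)" using a1(2) la by (auto simp: \<Phi>_def)
  have cd: "countable (seq_elems e)" for e :: "nat \<Rightarrow> 'u list"
    by (auto simp: seq_elems_def intro: countable_finite)
  show ?case
  proof (cases "\<exists>\<theta>. dfn M ?m \<theta> \<and> \<theta> d \<and> (\<forall>c. set c \<subseteq> M \<longrightarrow> length c = ?m \<longrightarrow> \<theta> c \<longrightarrow> R (u0 # a1 @ c))")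
    case False
    have "\<exists>V. coheir d V \<and> eventually (\<lambda>c. \<not> R (u0 # a1 @ c)) V"
      by (rule coheir_ex) (use False in blast)
    then obtain V where V: "coheir d V" "eventually (\<lambda>c. \<not> R (u0 # a1 @ c)) V" by blast
    have ultra_on: "ultra_on M ?m V" using V(1) by (simp add: coheir_def)
    obtain I J where l: "\<And>i. length (I i) = ?m" "\<And>i. length (J i) = ?m"
      and IJ: "indiscernible L U (M \<union> seq_elems J) I" "indiscernible L U (M \<union> seq_elems I) J"
      and t: "tpeq M (d @ d1) (I 0 @ J 0)"
      and realises: "realises (M \<union> set (I 0)) V (I 1)" "realises (M \<union> set (J 0)) V (J 1)"
      using rows[OF V(1)] by blast
    let ?B = "M \<union> (seq_elems I \<union> seq_elems J)"
    have el: "set (I i) \<subseteq> ?B" "set (J i) \<subseteq> ?B" for i by (auto simp: seq_elems_def)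
    have "small \<kappa> ?B" using cd by (intro small_M_Un) simp
    from def_type_extend[OF a1M this] obtain a where a: "def_type ?B n a" "tpeq M a1 a" by blast
    have la': "length a = n" using def_type_length[OF a(1)] .
    have "tpeq M (a1 @ d @ d1) (a @ I 0 @ J 0)"
      using el by (intro def_type_tpeq[OF a1(1) a(1) _ _ a(2) t]) auto
    from tpeq_extend[OF small_M this, of "[u0]"] obtain w where w: "length w = 1"
      "tpeq M ((a1 @ d @ d1) @ [u0]) ((a @ I 0 @ J 0) @ w)" by auto
    then obtain u where u: "w = [u]" by (auto simp: length_Suc_conv)
    have tt: "tpeq M ((a1 @ d @ d1) @ [u0]) ((a @ I 0 @ J 0) @ [u])" using w(2) u by simp
    have tu: "tpeq M ([u0] @ a1 @ d @ d1) ([u] @ a @ I 0 @ J 0)"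
      by (rule tpeq_swap[OF tt]) (simp add: la la' l ld1)
    have dr: "dfn M (Suc n + (?m + ?m)) (\<lambda>z. R (take (Suc n + ?m) z))"
      "dfn M (Suc n + (?m + ?m)) (\<lambda>z. R (take (Suc n) z @ drop (Suc n + ?m) z))"
      by (rule dfn_slc_eq[OF R] slc_append slc_take slc_drop_le | simp)+
    have Rd: "R (u # a @ I 0)" "R (u # a @ J 0)"
      using tpeqD[OF tu dr(1)] tpeqD[OF tu dr(2)] u0 la la' l ld1 by simp_all
    have tu1: "tpeq M ([u0] @ a1) ([u] @ a)"
      using tpeq_append1[of M "[u0] @ a1" "d @ d1" "[u] @ a" "I 0 @ J 0"] tu la la' by simp
    have Pc: "R (u # a @ c) \<longleftrightarrow> R (u0 # a1 @ c)" if "set c \<subseteq> M" "length c = ?m" for c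
      using tpeqD[OF tu1 dfn_inst[OF R that]] la by simp
    have ev: "eventually (\<lambda>c. \<not> R (u # a @ c)) V"
      by (rule eventually_mono[OF eventually_conj[OF V(2) eventually_conj[OF ultra_onD(2,3)[OF ultra_on]]]])
        (use Pc in blast)
    have use: "def_consistent (Suc n) R d" if "R (u # a @ H 0)" "R (u # a @ H 1)" "tpeq M d (H 0)" "realises (M \<union> set (H 0)) V (H 1)"
      "set (H 0) \<subseteq> ?B" "set (H 1) \<subseteq> ?B" "length (H 1) = ?m" for H :: "nat \<Rightarrow> 'u list"
    proof (rule def_consistent_if_nondefinable[OF R R ultra_on that(3,4,7)])
      show "def_type (M \<union> set (H 0) \<union> set (H 1)) n a" using that(5,6) by (intro def_type_mono[OF a(1)]) auto
      show "eventually (\<lambda>c. \<exists>u. R (u # a @ H 0) \<and> R (u # a @ H 1) \<and> \<not> R (u # a @ c)) V"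
        by (rule eventually_mono[OF ev]) (use that(1,2) in blast)
    qed
    have t0: "tpeq M d (I 0)" "tpeq M d (J 0)"
      using tpeq_append1[OF t] tpeq_trans[OF d1 tpeq_append2[OF t]] l by simp_all
    \<comment> \<open>One row survives over \<open>u\<close> and \<open>a\<close>. \<open>R\<close>
      holds at its first term by the choice of \<open>\<Phi>\<close>, hence at its second, which
      realises \<open>V\<close> over the first, while \<open>V\<close> avoids
      \<open>R\<close>.\<close>
    from one_unbroken[OF a(1) _ IJ, of u] show ?thesis
    proof
      assume "indiscernible L U (insert u (M \<union> set a)) I"
      from unbroken[OF this l(1), of R 0 1] R la' Rd(1) show ?thesis
        using use[OF Rd(1) _ t0(1) realises(1)] el l by simp
    next
      assume "indiscernible L U (insert u (M \<union> set a)) J"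
      from unbroken[OF this l(2), of R 0 1] R la' Rd(2) show ?thesis
        using use[OF Rd(2) _ t0(2) realises(2)] el l by simp
    qed blast
  next
    case True
    then obtain \<theta> where \<theta>: "dfn M ?m \<theta>" "\<theta> d"
      "\<And>c. set c \<subseteq> M \<Longrightarrow> length c = ?m \<Longrightarrow> \<theta> c \<Longrightarrow> R (u0 # a1 @ c)" by blast
    show ?thesis
    proof (cases "def_type M (Suc n) (u0 # a1)")
      case True
      obtain sR where sR: "schema ?m (u0 # a1) R sR" by (rule def_type_schema[OF True subset_refl R]) (rule that)
      have "\<theta> d \<longrightarrow> sR d"
      proof (rule all_in_M[OF dfn_imp[OF \<theta>(1) schema_dfn[OF sR]] _ refl])
        fix c assume "set c \<subseteq> M" "length c = ?m"
        then show "\<theta> c \<longrightarrow> sR c" using \<theta>(3)[of c] schemaD[OF sR] by simp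
      qed
      then show ?thesis using def_consistentI[OF True R sR] \<theta>(2) by blast
    next
      case False
      then obtain k S where S: "dfn M (Suc n + k) S"
        "\<not> (\<exists>S'. dfn M k S' \<and> (\<forall>e. set e \<subseteq> M \<and> length e = k \<longrightarrow> (S ((u0 # a1) @ e) \<longleftrightarrow> S' e)))"
        unfolding def_type_def using la by auto
      define P where "P c \<longleftrightarrow> S (u0 # a1 @ c)" for c
      have nP: "\<not> (\<forall>e. set e \<subseteq> M \<and> length e = k \<longrightarrow> (P e \<longleftrightarrow> S' e))" if "dfn M k S'" for S'
        using S(2) that unfolding P_def by auto
      obtain V1 V2 where V: "ultra_on M k V1" "ultra_on M k V2" "eventually P V1" "eventually (\<lambda>c. \<not> P c) V2"
        "\<And>\<theta>. dfn M k \<theta> \<Longrightarrow> eventually \<theta> V1 \<Longrightarrow> eventually \<theta> V2"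
        using opposite_coheirs[of k P] nP by metis
      have sm: "small \<kappa> (M \<union> set d)" by (intro small_M_Un countable_finite) simp
      obtain b where b: "length b = k" "realises (M \<union> set d) V1 b" using realises_ex[OF sm V(1)] by blast
      obtain b2 where b2: "length b2 = k" "realises (M \<union> set d) V2 b2" using realises_ex[OF sm V(2)] by blast
      have bb: "tpeq M b2 b"
      proof (rule tpeq_sym, rule tpeqI[OF b(1) b2(1)])
        fix \<theta> assume \<theta>: "dfn M k \<theta>" "\<theta> b"
        have "eventually \<theta> V1" using realisesD[OF realises_mono[OF b(2) Un_upper1] \<theta>(1) b(1)] \<theta>(2) by simp
        then show "\<theta> b2" using realisesD[OF realises_mono[OF b2(2) Un_upper1] \<theta>(1) b2(1)] V(5)[OF \<theta>(1)] by simp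
      qed
      \<comment> \<open>The same \<open>b\<close> realises \<open>V1\<close> over \<open>M\<close>
        and \<open>d\<close>, and \<open>V2\<close> over \<open>M\<close> and \<open>d2\<close>.
        Whatever truth value \<open>S\<close> takes at \<open>b\<close>, one of the two ultrafilters
        has the opposite value.\<close>
      from tpeq_extend[OF small_M bb, of d] obtain d2 where d2: "length d2 = ?m" "tpeq M (b2 @ d) (b @ d2)" by blast
      have db: "tpeq M (d @ b2) (d2 @ b)" by (rule tpeq_swap[OF d2(2)]) (simp add: b b2)
      have dd2: "tpeq M d d2" by (rule tpeq_append1[OF db]) (simp add: d2)
      have rz2: "realises (M \<union> set d2) V2 b" by (rule realises_inv[OF V(2) b2(2) db]) (simp_all add: d2 b2)
      let ?B = "M \<union> (set d \<union> set d2 \<union> set b)"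
      have "small \<kappa> ?B" by (intro small_M_Un countable_finite) simp
      from def_type_extend[OF a1M this] obtain a where a: "def_type ?B n a" "tpeq M a1 a" by blast
      have la': "length a = n" using def_type_length[OF a(1)] .
      \<comment> \<open>Wanted is a \<open>u\<close> such that \<open>a @ [u]\<close> has the type
        of \<open>a1 @ [u0]\<close> over \<open>M\<close> and \<open>R\<close> holds at both
        \<open>d\<close> and \<open>d2\<close>. Its existence comes from \<open>\<theta>\<close>: at
        points of \<open>M\<close> satisfying \<open>\<theta>\<close> the element \<open>u0\<close>
        behaves like this over \<open>a1\<close>, and both \<open>d\<close> and \<open>d2\<close>
        satisfy \<open>\<theta>\<close>.\<close>
      let ?K = "{\<kappa>. dfn M (n + 1) \<kappa> \<and> \<kappa> (a1 @ [u0])}"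
      let ?g = "\<lambda>\<kappa> l. \<kappa> (a @ l) \<and> R (l @ a @ d) \<and> R (l @ a @ d2)"
      have "\<exists>l. length l = 1 \<and> (\<forall>Q\<in>?g ` ?K. Q l)"
      proof (rule realize)
        show "small \<kappa> (M \<union> (set a \<union> set d \<union> set d2))" by (intro small_M_Un countable_finite) simp
        fix Q assume "Q \<in> ?g ` ?K"
        then obtain \<theta> where \<theta>: "Q = ?g \<theta>" "dfn M (n + 1) \<theta>" by auto
        let ?C = "M \<union> (set a \<union> set d \<union> set d2)"
        have "dfn ?C (n + 1) \<theta>" "dfn ?C (1 + (n + ?m)) R"
          using dfn_mono[OF \<theta>(2), of ?C] dfn_mono[OF R, of ?C] by auto
        then show "dfn ?C 1 Q" unfolding \<theta>(1)
          using la' d2(1) by (intro dfn_conj dfn_inst1 dfn_inst) auto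
      next
        fix G assume "finite G" "G \<subseteq> ?g ` ?K"
        from finite_subset_image[OF this] obtain H where H: "H \<subseteq> ?K" "finite H" "G = ?g ` H" by auto
        define \<Xi> where "\<Xi> z \<longleftrightarrow> (\<exists>u. (\<forall>\<theta>\<in>H. \<theta> (take n z @ [u])) \<and> R (u # take (n + ?m) z) \<and>
           R (u # take n z @ drop (n + ?m) z))" for z
        have d\<Xi>: "dfn M (n + (?m + ?m)) \<Xi>"
        proof -
          have H': "dfn M (Suc (n + (?m + ?m))) (\<lambda>z. \<theta> (take n (drop 1 z) @ take 1 z))" if \<theta>: "\<theta> \<in> H" for \<theta>
          proof -
            have "dfn M (n + 1) \<theta>" using subsetD[OF H(1) \<theta>] by simp
            from dfn_slc[OF this slc_append[OF slc_seg slc_take]] show ?thesis by simp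
          qed
          have "dfn M (Suc (n + (?m + ?m))) (\<lambda>z. (\<forall>\<theta>\<in>H. \<theta> (take n (drop 1 z) @ take 1 z)) \<and>
             R (take (Suc (n + ?m)) z) \<and> R (take (Suc n) z @ drop (Suc (n + ?m)) z))"
            by (rule dfn_conj dfn_ball H(2) H' dfn_slc_eq[OF R] slc_append slc_take slc_drop_le | assumption | simp)+
          from dfn_ex[OF this] show ?thesis by (simp add: \<Xi>_def[abs_def])
        qed
        obtain s\<Xi> where s: "schema (?m + ?m) a1 \<Xi> s\<Xi>" by (rule def_type_schema[OF a1M subset_refl d\<Xi>]) (rule that)
        let ?Q = "\<lambda>z. \<theta> (take ?m z) \<and> \<theta> (drop ?m z) \<longrightarrow> s\<Xi> z"
        have "dfn M (?m + ?m) ?Q"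
          by (rule dfn_imp dfn_conj dfn_slc_eq[OF \<theta>(1)] slc_take slc_drop_le schema_dfn[OF s] | simp)+
        then have "?Q (d @ d2)"
        proof (rule all_in_M)
          fix c assume c: "set c \<subseteq> M" "length c = ?m + ?m"
          show "?Q c"
          proof
            assume "\<theta> (take ?m c) \<and> \<theta> (drop ?m c)"
            then have "R (u0 # a1 @ take ?m c)" "R (u0 # a1 @ drop ?m c)"
              using c by (auto intro!: \<theta>(3) dest: in_set_takeD in_set_dropD)
            moreover have "\<forall>\<theta>\<in>H. \<theta> (a1 @ [u0])" using H(1) by auto
            ultimately have "\<Xi> (a1 @ c)" using la c(2) unfolding \<Xi>_def by (intro exI[of _ u0]) simp
            then show "s\<Xi> c" using schemaD[OF s] c by simp
          qed
        qed (simp add: d2)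
        moreover have "\<theta> d2" using tpeqD[OF dd2 \<theta>(1)] \<theta>(2) by simp
        ultimately have "s\<Xi> (d @ d2)" using \<theta>(2) by simp
        then have "\<Xi> (a @ d @ d2)"
          using def_type_schD[OF a(1) _ d\<Xi> schema_tpeq[OF s a(2) d\<Xi> la], of "d @ d2"] d2(1) by auto
        then obtain u where "\<forall>\<theta>\<in>H. \<theta> (a @ [u])" "R (u # a @ d)" "R (u # a @ d2)"
          using la' by (auto simp: \<Xi>_def)
        then show "\<exists>l. length l = 1 \<and> (\<forall>Q\<in>G. Q l)" unfolding H(3) by (intro exI[of _ "[u]"]) simp
      qed
      then obtain l where l: "length l = 1" "\<forall>Q\<in>?g ` ?K. Q l" by (elim exE conjE) (rule that)
      then obtain u where u: "l = [u]" by (auto simp: length_Suc_conv)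
      have g: "\<theta> (a @ [u]) \<and> R (u # a @ d) \<and> R (u # a @ d2)" if "dfn M (n + 1) \<theta>" "\<theta> (a1 @ [u0])" for \<theta>
      proof -
        have "?g \<theta> \<in> ?g ` ?K" using that by (intro imageI) simp
        from bspec[OF l(2) this] show ?thesis using u by simp
      qed
      have Ru: "R (u # a @ d)" "R (u # a @ d2)" using g[OF dfn_True] by simp_all
      have "tpeq M (a1 @ [u0]) (a @ [u])"
        by (rule tpeqI[of _ "n + 1"]) (use g la la' in auto)
      then have tu: "tpeq M ([u0] @ a1) ([u] @ a)" by (rule tpeq_swap) (simp add: la la')
      have Pc: "P c \<longleftrightarrow> S (u # a @ c)" if "set c \<subseteq> M" "length c = k" for c
        using tpeqD[OF tu dfn_inst[OF S(1) that]] la by (simp add: P_def)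
      show ?thesis
      proof (cases "S (u # a @ b)")
        case True
        show ?thesis
        proof (rule def_consistent_if_nondefinable[OF R S(1) V(2) dd2 rz2 b(1)])
          show "def_type (M \<union> set d2 \<union> set b) n a" by (rule def_type_mono[OF a(1)]) auto
          show "eventually (\<lambda>c. \<exists>u. R (u # a @ d2) \<and> S (u # a @ b) \<and> \<not> S (u # a @ c)) V2"
            by (rule eventually_mono[OF eventually_conj[OF V(4) eventually_conj[OF ultra_onD(2,3)[OF V(2)]]]])
              (use True Ru Pc in blast)
        qed
      next
        case False
        show ?thesis
        proof (rule def_consistent_if_nondefinable[OF R dfn_not[OF S(1)] V(1) tpeq_refl b(2,1)])
          show "def_type (M \<union> set d \<union> set b) n a" by (rule def_type_mono[OF a(1)]) auto
          show "eventually (\<lambda>c. \<exists>u. R (u # a @ d) \<and> \<not> S (u # a @ b) \<and> \<not> \<not> S (u # a @ c)) V1"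
            by (rule eventually_mono[OF eventually_conj[OF V(3) eventually_conj[OF ultra_onD(2,3)[OF V(1)]]]])
              (use False Ru Pc in blast)
        qed
      qed
    qed
  qed
qed

end

section \<open>The global type\<close>

theorem theorem5:
  fixes L :: "('f, 'r) lang"
    and T :: "('f, 'r) fm set"
    and \<kappa> :: "'k rel"
    and U :: "('f, 'r, 'u) interp"
    and M :: "'u set"
    and n :: nat
    and \<phi> :: "('f, 'r) fm"
    and d :: "'u list"
  assumes "countable_lang L"
    and "complete_theory L T"
    and "monster_model L T \<kappa> U"
    and "dp_minimal L \<kappa> U"
    and "property_D L \<kappa> U"
    and "elementary_submodel L U M" and "small \<kappa> M"
    and "fm_in L (n + length d) \<phi>"
    and "\<not> forks L U M n (\<phi>, d)"
  shows "\<exists>p. complete_type L U n UNIV p \<and> (\<phi>, d) \<in> p \<and> definable_type L U M n UNIV p"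
proof -
  interpret dp_model L U \<kappa> M
    by unfold_locales (use assms in \<open>auto simp: monster_model_def\<close>)
  note \<phi> = assms(8)
  have "def_consistent n (\<lambda>a. sat_in U UNIV a \<phi>) d"
    using def_consistent_if_conjugates_consistent[OF dfn_fm[OF \<phi>] conjugates_consistent_if_not_forks[OF assms(9) \<phi>]] .
  then obtain a where a: "def_type (M \<union> set d) n a" "sat_in U UNIV (a @ d) \<phi>" unfolding def_consistent_def by blast
  have aM: "def_type M n a" by (rule def_type_mono[OF a(1)]) blast
  have la: "length a = n" using def_type_length[OF aM] .
  \<comment> \<open>The schemas of the type of \<open>a\<close> over \<open>M\<close> are evaluated
    at all tuples of the monster model. \<open>UNIV\<close> need not be small, so \<open>p\<close>
    is compared with actual tuples only over \<open>M\<close> and finitely many further elements,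
    where \<open>def_type_extend\<close> provides them.\<close>
  define p where "p = {(\<psi>, b). fm_in L (n + length b) \<psi> \<and>
     (\<exists>S. schema (length b) a (\<lambda>x. sat_in U UNIV x \<psi>) S \<and> S b)}"
  have mem: "(\<psi>, b) \<in> p \<longleftrightarrow> S b"
    if "fm_in L (n + length b) \<psi>" "schema (length b) a (\<lambda>x. sat_in U UNIV x \<psi>) S" for \<psi> b S
    unfolding p_def using that schema_unique[OF that(2)] by blast
  have mem_sat: "(\<psi>, b) \<in> p \<longleftrightarrow> sat_in U UNIV (a' @ b) \<psi>"
    if \<psi>: "fm_in L (n + length b) \<psi>" and a': "def_type B n a'" "tpeq M a a'" "M \<subseteq> B" "set b \<subseteq> B" for \<psi> b a' B
  proof -
    obtain S where S: "schema (length b) a (\<lambda>x. sat_in U UNIV x \<psi>) S"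
      by (rule def_type_schema[OF aM subset_refl dfn_fm[OF \<psi>]]) (rule that)
    show ?thesis
      using mem[OF \<psi> S] def_type_schD[OF a'(1,3) dfn_fm[OF \<psi>] schema_tpeq[OF S a'(2) dfn_fm[OF \<psi>] la] a'(4)] by simp
  qed
  have ext: "\<exists>a'. def_type (M \<union> C) n a' \<and> tpeq M a a'" if "finite C" for C
    using that by (intro def_type_extend[OF aM] small_M_Un countable_finite) auto
  have "complete_type L U n UNIV p" unfolding complete_type_def
  proof (intro conjI allI impI)
    show "p \<subseteq> param_fms L n UNIV" by (auto simp: p_def param_fms_def)
    fix q assume q: "q \<subseteq> p" "finite q"
    let ?C = "\<Union>x\<in>q. set (snd x)"
    obtain a' where a': "def_type (M \<union> ?C) n a'" "tpeq M a a'" using ext[of ?C] q(2) by auto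
    have "sat_in U UNIV (a' @ b) \<psi>" if "(\<psi>, b) \<in> q" for \<psi> b
    proof -
      have "(\<psi>, b) \<in> p" using q(1) that by blast
      moreover from this have "fm_in L (n + length b) \<psi>" by (simp add: p_def)
      moreover have "set b \<subseteq> M \<union> ?C" using that by force
      ultimately show ?thesis using mem_sat a' by blast
    qed
    then show "\<exists>a. length a = n \<and> (\<forall>(\<phi>, b)\<in>q. sat_in U UNIV (a @ b) \<phi>)"
      using def_type_length[OF a'(1)] by blast
  next
    show "\<forall>(\<phi>, b)\<in>param_fms L n UNIV. (\<phi>, b) \<in> p \<or> (Neg \<phi>, b) \<in> p"
    proof clarify
      fix \<psi> b assume "(\<psi>, b) \<in> param_fms L n UNIV" and no: "(Neg \<psi>, b) \<notin> p"
      then have \<psi>: "fm_in L (n + length b) \<psi>" "fm_in L (n + length b) (Neg \<psi>)" by (auto simp: param_fms_def)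
      obtain a' where a': "def_type (M \<union> set b) n a'" "tpeq M a a'" using ext[of "set b"] by auto
      show "(\<psi>, b) \<in> p"
        using mem_sat[OF \<psi>(1) a'] mem_sat[OF \<psi>(2) a'] no by auto
    qed
  qed
  moreover have "(\<phi>, d) \<in> p"
    using mem_sat[OF \<phi> a(1) tpeq_refl] a(2) by auto
  moreover have "definable_type L U M n UNIV p" unfolding definable_type_def
  proof (intro allI impI)
    fix m \<psi> assume \<psi>: "fm_in L (n + m) \<psi>"
    obtain S where S: "schema m a (\<lambda>x. sat_in U UNIV x \<psi>) S"
      by (rule def_type_schema[OF aM subset_refl dfn_fm[OF \<psi>]]) (rule that)
    obtain \<chi> c where \<chi>: "c \<in> lists M" "fm_in L (m + length c) \<chi>"
      "\<And>e. length e = m \<Longrightarrow> S e \<longleftrightarrow> sat_in U UNIV (e @ c) \<chi>"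
      using schema_dfn[OF S] unfolding dfn_def by blast
    have "(\<psi>, e) \<in> p \<longleftrightarrow> sat_in U UNIV (e @ c) \<chi>" if "length e = m" for e
      using mem[of e \<psi> S] \<psi> S \<chi>(3)[OF that] that by simp
    then show "\<exists>(\<chi>, c)\<in>param_fms L m M. \<forall>e\<in>lists UNIV. length e = m \<longrightarrow>
        ((\<psi>, e) \<in> p \<longleftrightarrow> sat_in U UNIV (e @ c) \<chi>)"
      using \<chi>(1,2) by (intro bexI[of _ "(\<chi>, c)"]) (auto simp: param_fms_def)
  qed
  ultimately show ?thesis by blast
qed

end
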